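(* Assume (A1) and (A2). Let $\Gamma \subset \mathbb{Z}^d$ and $s \in (0,1/3)$. Then, for sufficiently large disorder $\lambda$, there are constants $\mu, A \in (0,\infty)$, depending only on $d$, $\rho$, $u$, $s$ and $\lambda$, such that for all $z \in \mathbb{C}\setminus\mathbb{R}$ and all $x,y \in \Gamma$ \[ \mathbb{E}\bigl\{ |G_\Gamma(z;x,y)|^{s/(2|\Theta|)} \bigr\} \le A\, e^{-\mu |x-y|_\infty}. \]
   Context: Let $d\ge 1$. For $x\in\mathbb{Z}^d$, $|x|_1=\sum_i|x_i|$ and $|x|_\infty=\max_i|x_i|$. For $\Gamma\subset\mathbb{Z}^d$, $\ell^2(\Gamma)$ is the usual Hilbert space with basis $\{\delta_k\}_{k\in\Gamma}$. The discrete Laplacian is $(\Delta\psi)(x)=\sum_{|e|_1=1}\psi(x+e)$. Let $\mu$ be a probability measure on $\mathbb{R}$, $\Omega=\times_{k\in\mathbb{Z}^d}\mathbb{R}$ with product measure $\mathbb{P}=\bigotimes_{k}\mu$; $\omega=(\omega_k)_{k\in\mathbb{Z}^d}$ are i.i.d. with law $\mu$, and $\mathbb{E}$ denotes expectation. Let $u:\mathbb{Z}^d\to\mathbb{R}$ have finite nonempty support $\Theta=\{k:u(k)\neq0\}$ with $0\in\Theta$; $|\Theta|$ is its cardinality. The potential is $V_\omega(x)=\sum_{k}\omega_k u(x-k)$ and $H_\omega=-\Delta+\lambda V_\omega$ on $\ell^2(\mathbb{Z}^d)$, $\lambda>0$. For $\Gamma\subset\mathbb{Z}^d$, $H_\Gamma$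 is the restriction of $H_\omega$ to $\ell^2(\Gamma)$ (matrix entries $\langle\delta_x,H_\omega\delta_y\rangle$, $x,y\in\Gamma$), $G_\Gamma(z)=(H_\Gamma-z)^{-1}$ and $G_\Gamma(z;x,y)=\langle\delta_x,G_\Gamma(z)\delta_y\rangle$. For $\Lambda\subset\mathbb{Z}^d$, the interior boundary is $\partial^{\rm i}\Lambda=\{k\in\Lambda:\#\{j\in\Lambda:|k-j|_1=1\}<2d\}$. Assumption (A1): $\mu$ has a bounded, compactly supported density $\rho$. Assumption (A2): $u(k)>0$ for all $k\in\partial^{\rm i}\Theta$. *)

theory Defs
  imports "HOL-Probability.Probability"
begin

definition norm1 :: "int^'d \<Rightarrow> int" where
  "norm1 x = (\<Sum>i\<in>UNIV. \<bar>x $ i\<bar>)"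

definition norminf :: "int^'d \<Rightarrow> int" where
  "norminf x = Max ((\<lambda>i. \<bar>x $ i\<bar>) ` UNIV)"

definition supp_u :: "(int^'d \<Rightarrow> real) \<Rightarrow> (int^'d) set" where
  "supp_u u = {k. u k \<noteq> 0}"

definition interior_boundary :: "(int^'d) set \<Rightarrow> (int^'d) set" where
  "interior_boundary L =
     {k \<in> L. card {j \<in> L. norm1 (k - j) = 1} < 2 * CARD('d)}"

text \<open>Alloy-type potential V_omega(x) = sum_k omega_k u(x-k) (finite sum since u has finite support).\<close>
definition pot :: "(int^'d \<Rightarrow> real) \<Rightarrow> (int^'d \<Rightarrow> real) \<Rightarrow> int^'d \<Rightarrow> real" where
  "pot u \<omega> x = (\<Sum>k\<in>{k. u (x - k) \<noteq> 0}. \<omega> k * u (x - k))"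

text \<open>Action of the restricted operator H_Gamma = -Delta + lambda V_omega on a function psi
  (supported in Gamma), evaluated at x in Gamma: matrix entries of H_omega between points of Gamma.\<close>
definition H_restr ::
  "(int^'d \<Rightarrow> real) \<Rightarrow> real \<Rightarrow> (int^'d \<Rightarrow> real) \<Rightarrow> (int^'d) set
     \<Rightarrow> (int^'d \<Rightarrow> complex) \<Rightarrow> int^'d \<Rightarrow> complex" where
  "H_restr u lam \<omega> \<Gamma> \<psi> x =
     - (\<Sum>y\<in>{y \<in> \<Gamma>. norm1 (x - y) = 1}. \<psi> y)
     + complex_of_real (lam * pot u \<omega> x) * \<psi> x"

definition l2_on :: "(int^'d) set \<Rightarrow> (int^'d \<Rightarrow> complex) \<Rightarrow> bool" where
  "l2_on \<Gamma> \<psi> \<longleftrightarrow> (\<forall>x. x \<notin> \<Gamma> \<longrightarrow> \<psi> x = 0) \<and> ((\<lambda>x. (norm (\<psi> x))\<^sup>2) summable_on \<Gamma>)"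

text \<open>Green's function G_Gamma(z;x,y) = < delta_x, (H_Gamma - z)^{-1} delta_y >:
  the value at x of the (unique) l^2(Gamma) vector psi = (H_Gamma - z)^{-1} delta_y,
  i.e. the l^2(Gamma) solution of (H_Gamma - z) psi = delta_y.\<close>
definition green ::
  "(int^'d \<Rightarrow> real) \<Rightarrow> real \<Rightarrow> (int^'d \<Rightarrow> real) \<Rightarrow> (int^'d) set
     \<Rightarrow> complex \<Rightarrow> int^'d \<Rightarrow> int^'d \<Rightarrow> complex" where
  "green u lam \<omega> \<Gamma> z x y =
     (THE \<psi>. l2_on \<Gamma> \<psi> \<and>
        (\<forall>v\<in>\<Gamma>. H_restr u lam \<omega> \<Gamma> \<psi> v - z * \<psi> v = (if v = y then 1 else 0))) x"

definition disorder_space :: "(real \<Rightarrow> real) \<Rightarrow> (int^'d \<Rightarrow> real) measure" where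
  "disorder_space \<rho> = PiM UNIV (\<lambda>_. density lborel (\<lambda>t. ennreal (\<rho> t)))"

end

theory Submission
  imports Defs "Jordan_Normal_Form.Determinant"
    "HOL-Computational_Algebra.Fundamental_Theorem_Algebra"
begin

text \<open>
  Fix a finite \<open>\<Gamma>\<close>, a site \<open>k\<close> and the block \<open>W = (\<Theta> + k) \<inter> \<Gamma>\<close>. As a function of \<open>r = \<omega> k\<close>, the
  Green function \<open>G(k, w)\<close> with \<open>w \<in> W\<close> is by Cramer's rule a rational function of degree at most
  \<open>|\<Theta>|\<close>. It makes sense for complex \<open>r\<close>, and if \<open>Im r\<close> is large and of the sign opposite to
  \<open>Im z\<close>, it is \<open>O(1 / \<lambda>)\<close>: on the boundary of the block, where \<open>u > 0\<close>, this follows from the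
  imaginary part of the quadratic form, regardless of the surroundings, and in its interior, which
  does not see the surroundings, from the size of the diagonal. Lagrange interpolation at such
  points controls the numerator by the denominator, so that averaging over \<open>r\<close> alone gives
  \<open>E |G(k, w)|^t \<le> K \<lambda>^-t\<close> for \<open>t |\<Theta>| \<le> 1/2\<close>.

  The resolvent identity \<open>G_\<Gamma>(x, y) = \<Sum> G_\<Gamma>(x, w) G_(\<Gamma> - W)(w', y)\<close> over the edges from the
  block \<open>W\<close> of \<open>x\<close> to its complement has a second factor independent of \<open>\<omega> x\<close>. Hence
  \<open>E |G_\<Gamma>(x, y)|^t\<close> is a small multiple of the same quantity for the smaller set \<open>\<Gamma> - W\<close>, and
  induction on \<open>\<Gamma>\<close> yields exponential decay. Infinite \<open>\<Gamma>\<close> follow by exhaustion and Fatou's lemma.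
\<close>

subsection \<open>Determinants over finite index sets\<close>

text \<open>Since \<open>u\<close> may change sign, the resolvent is not monotone in a single
  coupling, and the determinant, as a polynomial in that coupling, comes with no lower bound on its
  leading coefficient. Comparing numerator and denominator at common points avoids such a bound: the
  leading coefficient cancels. At complex couplings the term \<lambda> \<open>u\<close> Im r takes
  over the role of Im z, which keeps the estimate uniform as z approaches the real axis. In the
  interior of the block the shift must dominate z. A fixed shift does so for |z| of order \<lambda>;
  for larger |z| the whole diagonal is large and a maximum principle gives the same bound without
  averaging. The condition t |\<Theta>| \<le> 1/2 turns the worst singularity, a pole of order
  |\<Theta>|, into |r - a| to the power -1/2, which is integrable against a bounded density. The
  whole block is removed because \<omega> at x acts on all its sites. Each removal bridges at most
  the radius of \<Theta> plus one, and \<lambda> is chosen so that the small factor beats the number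
  of edges times the exponential of that distance.\<close>

definition enum_of :: "'a set \<Rightarrow> nat \<Rightarrow> 'a" where
  "enum_of S = (SOME f. bij_betw f {0..<card S} S)"

lemma bij_betw_enum_of:
  assumes "finite S" shows "bij_betw (enum_of S) {0..<card S} S"
  unfolding enum_of_def using ex_bij_betw_nat_finite[OF assms] by (rule someI_ex)

lemma enum_of_in: "finite S \<Longrightarrow> i < card S \<Longrightarrow> enum_of S i \<in> S"
  using bij_betw_enum_of[of S] by (auto simp: bij_betw_def)

lemma enum_of_obtain:
  assumes "finite S" "v \<in> S"
  obtains i where "i < card S" "enum_of S i = v"
proof -
  have "v \<in> enum_of S ` {0..<card S}"
    using bij_betw_enum_of[OF assms(1)] assms(2) by (simp add: bij_betw_def)
  then show ?thesis using that by auto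
qed

definition mat_of :: "'a set \<Rightarrow> ('a \<Rightarrow> 'a \<Rightarrow> 'b) \<Rightarrow> 'b Matrix.mat" where
  "mat_of S A = Matrix.mat (card S) (card S) (\<lambda>(i, j). A (enum_of S i) (enum_of S j))"

definition fdet :: "'a set \<Rightarrow> ('a \<Rightarrow> 'a \<Rightarrow> 'b::comm_ring_1) \<Rightarrow> 'b" where
  "fdet S A = Determinant.det (mat_of S A)"

lemma mat_of_carrier [simp]: "mat_of S A \<in> carrier_mat (card S) (card S)"
  by (simp add: mat_of_def)

text \<open>The Leibniz formula with sites as indices; evaluation, degree and measurability of
  \<open>fdet\<close> are read off from it.\<close>

lemma fdet_expand:
  "fdet S A = (\<Sum>p | p permutes {0..<card S}.
     signof p * (\<Prod>i = 0..<card S. A (enum_of S i) (enum_of S (p i))))"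
proof -
  have "p i < card S" if "p permutes {0..<card S}" "i < card S" for p i
    using permutes_in_image[OF that(1), of i] that(2) by simp
  then show ?thesis
    unfolding fdet_def Determinant.det_def mat_of_def
    by (auto intro!: sum.cong prod.cong)
qed

lemma mult_mat_of_vec_index:
  assumes "finite S" "i < card S"
  shows "vec_index (mat_of S A *\<^sub>v Matrix.vec (card S) (\<lambda>j. \<psi> (enum_of S j))) i
         = (\<Sum>w\<in>S. A (enum_of S i) w * \<psi> w)"
proof -
  have "(\<Sum>j = 0..<card S. A (enum_of S i) (enum_of S j) * \<psi> (enum_of S j))
      = (\<Sum>w\<in>S. A (enum_of S i) w * \<psi> w)"
    by (rule sum.reindex_bij_betw[OF bij_betw_enum_of[OF assms(1)]])
  then show ?thesis
    using assms(2) by (simp add: mat_of_def scalar_prod_def)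
qed

text \<open>The product form survives a vanishing determinant, so for entries that depend on a
  parameter it holds at every value of the parameter.\<close>

lemma fdet_cramer:
  assumes S: "finite S" and x: "x \<in> S"
    and eq: "\<And>v. v \<in> S \<Longrightarrow> (\<Sum>w\<in>S. A v w * \<psi> w) = g v"
  shows "\<psi> x * fdet S A = fdet S (\<lambda>v w. if w = x then g v else A v w)"
proof -
  note b = bij_betw_enum_of[OF S]
  obtain k where k: "k < card S" "enum_of S k = x"
    using enum_of_obtain[OF S x] .
  note inS = enum_of_in[OF S]
  have inj: "enum_of S j = x \<longleftrightarrow> j = k" if "j < card S" for j
    using b k that by (auto simp: bij_betw_def inj_on_def)
  let ?v = "Matrix.vec (card S) (\<lambda>j. \<psi> (enum_of S j))"
  have "Determinant.det (replace_col (mat_of S A) (mat_of S A *\<^sub>v ?v) k)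
      = vec_index ?v k * Determinant.det (mat_of S A)"
    by (rule cramer_lemma_mat) (use k in auto)
  moreover have "replace_col (mat_of S A) (mat_of S A *\<^sub>v ?v) k
      = mat_of S (\<lambda>v w. if w = x then g v else A v w)" (is "?l = ?r")
  proof (rule eq_matI)
    show "dim_row ?l = dim_row ?r" "dim_col ?l = dim_col ?r"
      by (auto simp: replace_col_def mat_of_def)
    fix i j assume "i < dim_row ?r" "j < dim_col ?r"
    then have ij: "i < card S" "j < card S" by (auto simp: mat_of_def)
    show "index_mat ?l (i, j) = index_mat ?r (i, j)"
    proof (cases "j = k")
      case True
      then have "index_mat ?l (i, j) = vec_index (mat_of S A *\<^sub>v ?v) i"
        using ij by (simp add: replace_col_def mat_of_def)
      also have "\<dots> = g (enum_of S i)"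
        using mult_mat_of_vec_index[OF S ij(1), of A \<psi>] eq[OF inS[OF ij(1)]] by simp
      finally show ?thesis using True ij k by (simp add: mat_of_def)
    next
      case False
      then show ?thesis using ij inj[OF ij(2)] by (simp add: replace_col_def mat_of_def)
    qed
  qed
  ultimately show ?thesis using k by (simp add: fdet_def)
qed

text \<open>The adjugate divided by the determinant acts as the inverse matrix.\<close>

lemma fdet_solution:
  fixes A :: "'a \<Rightarrow> 'a \<Rightarrow> 'b::field"
  assumes S: "finite S" and "fdet S A \<noteq> 0"
  shows "\<exists>\<psi>. \<forall>v\<in>S. (\<Sum>w\<in>S. A v w * \<psi> w) = g v"
proof -
  note b = bij_betw_enum_of[OF S]
  let ?n = "card S" let ?A = "mat_of S A"
  define gv where "gv = Matrix.vec ?n (\<lambda>i. g (enum_of S i))"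
  define \<phi> where "\<phi> = (1 / Determinant.det ?A) \<cdot>\<^sub>v (adj_mat ?A *\<^sub>v gv)"
  define \<psi> where "\<psi> w = vec_index \<phi> (inv_into {0..<?n} (enum_of S) w)" for w
  have adj: "adj_mat ?A \<in> carrier_mat ?n ?n" by (rule adj_mat(1)) simp
  have gv: "gv \<in> carrier_vec ?n" by (simp add: gv_def)
  have \<phi>c: "\<phi> \<in> carrier_vec ?n" using adj gv by (simp add: \<phi>_def)
  have "Matrix.vec ?n (\<lambda>j. \<psi> (enum_of S j)) = \<phi>"
  proof (rule eq_vecI)
    show "dim_vec (Matrix.vec ?n (\<lambda>j. \<psi> (enum_of S j))) = dim_vec \<phi>"
      using \<phi>c by auto
    fix i assume "i < dim_vec \<phi>"
    then have "i < ?n" using \<phi>c by auto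
    then show "vec_index (Matrix.vec ?n (\<lambda>j. \<psi> (enum_of S j))) i = vec_index \<phi> i"
      using b by (simp add: \<psi>_def bij_betw_def inv_into_f_f)
  qed
  moreover have "?A *\<^sub>v \<phi> = gv"
  proof -
    have "?A *\<^sub>v \<phi> = (1 / Determinant.det ?A) \<cdot>\<^sub>v (?A *\<^sub>v (adj_mat ?A *\<^sub>v gv))"
      unfolding \<phi>_def using adj gv by (intro mult_mat_vec[of _ ?n ?n]) auto
    also have "?A *\<^sub>v (adj_mat ?A *\<^sub>v gv) = (?A * adj_mat ?A) *\<^sub>v gv"
      using adj gv by (subst assoc_mult_mat_vec[of _ ?n ?n _ ?n]) auto
    also have "\<dots> = Determinant.det ?A \<cdot>\<^sub>v gv"
      using gv by (subst adj_mat(2)[of _ ?n]) auto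
    also have "(1 / Determinant.det ?A) \<cdot>\<^sub>v (Determinant.det ?A \<cdot>\<^sub>v gv) = gv"
      using assms(2) by (simp add: fdet_def smult_smult_assoc)
    finally show ?thesis .
  qed
  ultimately have eq: "?A *\<^sub>v Matrix.vec ?n (\<lambda>j. \<psi> (enum_of S j)) = gv" by simp
  have "(\<Sum>w\<in>S. A v w * \<psi> w) = g v" if "v \<in> S" for v
  proof -
    obtain i where i: "i < ?n" "enum_of S i = v"
      using enum_of_obtain[OF S \<open>v \<in> S\<close>] .
    show ?thesis using mult_mat_of_vec_index[OF S i(1), of A \<psi>] eq i by (simp add: gv_def)
  qed
  then show ?thesis by blast
qed

lemma fdet_nonzero:
  fixes A :: "'a \<Rightarrow> 'a \<Rightarrow> 'b::field"
  assumes S: "finite S"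
    and inj: "\<And>\<psi>. (\<And>v. v \<in> S \<Longrightarrow> (\<Sum>w\<in>S. A v w * \<psi> w) = 0) \<Longrightarrow> \<forall>v\<in>S. \<psi> v = 0"
  shows "fdet S A \<noteq> 0"
proof
  assume "fdet S A = 0"
  note b = bij_betw_enum_of[OF S]
  let ?n = "card S" let ?A = "mat_of S A"
  obtain \<phi> where \<phi>: "\<phi> \<in> carrier_vec ?n" "\<phi> \<noteq> 0\<^sub>v ?n" "?A *\<^sub>v \<phi> = 0\<^sub>v ?n"
    using det_0_iff_vec_prod_zero_field[of ?A ?n] \<open>fdet S A = 0\<close> by (auto simp: fdet_def)
  define \<psi> where "\<psi> w = vec_index \<phi> (inv_into {0..<?n} (enum_of S) w)" for w
  have \<psi>: "\<psi> (enum_of S j) = vec_index \<phi> j" if "j < ?n" for j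
    using b that by (simp add: \<psi>_def bij_betw_def inv_into_f_f)
  have "Matrix.vec ?n (\<lambda>j. \<psi> (enum_of S j)) = \<phi>"
    using \<phi>(1) \<psi> by (intro eq_vecI) auto
  then have "(\<Sum>w\<in>S. A v w * \<psi> w) = 0" if "v \<in> S" for v
  proof -
    obtain i where i: "i < ?n" "enum_of S i = v"
      using enum_of_obtain[OF S \<open>v \<in> S\<close>] .
    show ?thesis
      using mult_mat_of_vec_index[OF S i(1), of A \<psi>] \<phi> i
        \<open>Matrix.vec ?n (\<lambda>j. \<psi> (enum_of S j)) = \<phi>\<close> by simp
  qed
  then have "\<forall>v\<in>S. \<psi> v = 0" by (rule inj)
  then have "vec_index \<phi> j = 0" if "j < ?n" for j
    using \<psi>[OF that] enum_of_in[OF S that] by metis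
  then show False using \<phi>(1,2) by (auto intro!: eq_vecI)
qed

lemma fdet_poly:
  fixes A :: "'a \<Rightarrow> 'a \<Rightarrow> 'b::idom poly"
  shows "poly (fdet S A) r = fdet S (\<lambda>v w. poly (A v w) r)"
  unfolding fdet_expand
  by (simp add: poly_sum poly_prod sign_def)

text \<open>A Leibniz product takes one entry from each row, so row bounds add up. With
  \<open>m\<close> the indicator of the rows that contain the coupling, the bound does not grow with
  \<open>S\<close>.\<close>

lemma degree_fdet_le:
  fixes A :: "'a \<Rightarrow> 'a \<Rightarrow> 'b::idom poly"
  assumes S: "finite S" and deg: "\<And>v w. v \<in> S \<Longrightarrow> degree (A v w) \<le> m v"
  shows "degree (fdet S A) \<le> (\<Sum>v\<in>S. m v)"
  unfolding fdet_expand
proof (intro degree_sum_le)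
  note b = bij_betw_enum_of[OF S]
  show "finite {p. p permutes {0..<card S}}" by (simp add: finite_permutations)
  fix p :: "nat \<Rightarrow> nat"
  have "degree (signof p * (\<Prod>i = 0..<card S. A (enum_of S i) (enum_of S (p i))))
      \<le> degree (\<Prod>i = 0..<card S. A (enum_of S i) (enum_of S (p i)))"
    by (cases "sign p = 1") (auto simp: sign_def)
  also have "\<dots> \<le> (\<Sum>i = 0..<card S. degree (A (enum_of S i) (enum_of S (p i))))"
    using degree_prod_sum_le[of "{0..<card S}" "\<lambda>i. A (enum_of S i) (enum_of S (p i))"]
    by (simp add: o_def)
  also have "\<dots> \<le> (\<Sum>i = 0..<card S. m (enum_of S i))"
    using b by (intro sum_mono deg) (auto simp: bij_betw_def)
  also have "\<dots> = (\<Sum>v\<in>S. m v)" by (rule sum.reindex_bij_betw[OF b])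
  finally show "degree (signof p * (\<Prod>i = 0..<card S. A (enum_of S i) (enum_of S (p i))))
      \<le> (\<Sum>v\<in>S. m v)" .
qed

lemma borel_measurable_fdet:
  fixes A :: "'c \<Rightarrow> 'a \<Rightarrow> 'a \<Rightarrow> complex"
  assumes S: "finite S"
    and meas: "\<And>v w. v \<in> S \<Longrightarrow> w \<in> S \<Longrightarrow> (\<lambda>\<omega>. A \<omega> v w) \<in> borel_measurable M"
  shows "(\<lambda>\<omega>. fdet S (A \<omega>)) \<in> borel_measurable M"
  unfolding fdet_expand
proof (intro borel_measurable_sum borel_measurable_times borel_measurable_const
    borel_measurable_prod meas)
  note b = bij_betw_enum_of[OF S]
  fix p i assume *: "p \<in> {p. p permutes {0..<card S}}" "i \<in> {0..<card S}"
  then have "p i \<in> {0..<card S}" using permutes_in_image[of p "{0..<card S}" i] by simp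
  with * b show "enum_of S i \<in> S" "enum_of S (p i) \<in> S" by (auto simp: bij_betw_def)
qed

subsection \<open>The hopping operator and its energy identity\<close>

no_notation vec_index (infixl "$" 100)

lemma norm1_minus_commute: "norm1 (x - y) = norm1 (y - x)"
  unfolding norm1_def by (intro sum.cong) auto

lemma unit_vectors_subset:
  "{v :: int^'d. norm1 v = 1} \<subseteq> (\<lambda>(i, c). axis i c) ` (UNIV \<times> {1, -1})"
proof
  fix v :: "int^'d" assume "v \<in> {v. norm1 v = 1}"
  then have v: "(\<Sum>i\<in>UNIV. \<bar>v $ i\<bar>) = 1" by (simp add: norm1_def)
  then obtain i where i: "v $ i \<noteq> 0"
    by (metis (no_types, lifting) abs_0 sum.neutral zero_neq_one)
  have split: "\<bar>v $ i\<bar> + (\<Sum>j\<in>UNIV - {i}. \<bar>v $ j\<bar>) = 1"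
    using v by (subst (asm) sum.remove[of _ i]) auto
  have nn: "(\<Sum>j\<in>UNIV - {i}. \<bar>v $ j\<bar>) \<ge> 0" by (intro sum_nonneg) auto
  with split i have 1: "\<bar>v $ i\<bar> = 1" "(\<Sum>j\<in>UNIV - {i}. \<bar>v $ j\<bar>) = 0" by linarith+
  then have "v $ j = 0" if "j \<noteq> i" for j
    using that by (subst (asm) sum_nonneg_eq_0_iff) auto
  then have "v = axis i (v $ i)" by (auto simp: Finite_Cartesian_Product.vec_eq_iff axis_def)
  moreover have "v $ i \<in> {1, -1}" using 1 by auto
  ultimately show "v \<in> (\<lambda>(i, c). axis i c) ` (UNIV \<times> {1, -1})" by force
qed

lemma finite_nbrs: "finite {y :: int^'d. norm1 (x - y) = 1}"
  and card_nbrs_le: "card {y :: int^'d. norm1 (x - y) = 1} \<le> 2 * CARD('d)"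
proof -
  have fin: "finite {v :: int^'d. norm1 v = 1}"
    by (rule finite_subset[OF unit_vectors_subset]) auto
  have "card {v :: int^'d. norm1 v = 1}
      \<le> card ((\<lambda>(i, c). axis i c :: int^'d) ` (UNIV \<times> {1, -1}))"
    by (intro card_mono unit_vectors_subset) auto
  also have "\<dots> \<le> card (UNIV \<times> {1, -1} :: ('d \<times> int) set)" by (intro card_image_le) auto
  also have "\<dots> = 2 * CARD('d)" by (simp add: card_cartesian_product)
  finally have card: "card {v :: int^'d. norm1 v = 1} \<le> 2 * CARD('d)" .
  have eq: "{y :: int^'d. norm1 (x - y) = 1} = (\<lambda>v. x - v) ` {v. norm1 v = 1}"
    by (force simp: image_iff)
  show "finite {y :: int^'d. norm1 (x - y) = 1}" unfolding eq using fin by simp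
  show "card {y :: int^'d. norm1 (x - y) = 1} \<le> 2 * CARD('d)"
    unfolding eq using card_image_le[OF fin, of "\<lambda>v. x - v"] card by linarith
qed

lemma finite_nbrs_in [simp]: "finite {y \<in> A. norm1 (x - y) = 1}"
  by (rule finite_subset[OF _ finite_nbrs[of x]]) auto

lemma card_nbrs_in_le: "card {y \<in> A. norm1 (x - y :: int^'d) = 1} \<le> 2 * CARD('d)"
proof -
  have "card {y \<in> A. norm1 (x - y) = 1} \<le> card {y. norm1 (x - y) = 1}"
    by (intro card_mono finite_nbrs) auto
  then show ?thesis using card_nbrs_le[of x] by linarith
qed

section \<open>The maximum norm and lattice boxes\<close>

lemma abs_le_norminf: "\<bar>x $ i\<bar> \<le> norminf x"
  unfolding norminf_def by (intro Max_ge) auto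

lemma norminf_le_iff: "norminf x \<le> c \<longleftrightarrow> (\<forall>i. \<bar>x $ i\<bar> \<le> c)"
  unfolding norminf_def by (subst Max_le_iff) auto

lemma norminf_nonneg: "norminf x \<ge> 0"
  using abs_le_norminf[of x undefined] by linarith

lemma norminf_triangle: "norminf (x + y) \<le> norminf x + norminf y"
  unfolding norminf_le_iff
proof
  fix i show "\<bar>(x + y) $ i\<bar> \<le> norminf x + norminf y"
    using abs_le_norminf[of x i] abs_le_norminf[of y i] by simp
qed

lemma norminf_le_norm1: "norminf x \<le> norm1 x"
  unfolding norminf_le_iff norm1_def by (auto intro: member_le_sum)

lemma norminf_nbr: "norm1 (x - y) = 1 \<Longrightarrow> norminf y \<le> norminf x + 1"
  using norminf_triangle[of x "y - x"] norminf_le_norm1[of "y - x"] norm1_minus_commute[of x y]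
  by simp

definition lattice_box :: "nat \<Rightarrow> (int^'d) set" where
  "lattice_box N = {v. norminf v \<le> int N}"

lemma finite_lattice_box [simp]: "finite (lattice_box N :: (int^'d) set)"
proof (rule finite_subset)
  show "(lattice_box N :: (int^'d) set)
      \<subseteq> vec_lambda ` (PiE UNIV (\<lambda>_. {- int N..int N}))"
  proof
    fix v :: "int^'d" assume "v \<in> lattice_box N"
    then have "\<bar>v $ i\<bar> \<le> int N" for i by (simp add: lattice_box_def norminf_le_iff)
    then have "vec_nth v \<in> PiE UNIV (\<lambda>_. {- int N..int N})"
      by (auto simp: abs_le_iff PiE_def Pi_def minus_le_iff)
    then show "v \<in> vec_lambda ` (PiE UNIV (\<lambda>_. {- int N..int N}))"
      by (metis image_eqI vec_nth_inverse)
  qed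
  show "finite (vec_lambda ` (PiE UNIV (\<lambda>_ :: 'd. {- int N..int N})))"
    by (intro finite_imageI finite_PiE) auto
qed

text \<open>The diagonal is an arbitrary complex function: one operator covers
  \<open>H_restr\<close> minus \<open>z\<close> as well as its continuation to a complex
  coupling.\<close>

definition hop_op :: "(int^'d) set \<Rightarrow> (int^'d \<Rightarrow> complex) \<Rightarrow> (int^'d \<Rightarrow> complex) \<Rightarrow> int^'d \<Rightarrow> complex" where
  "hop_op \<Gamma> D \<psi> v = - (\<Sum>y\<in>{y \<in> \<Gamma>. norm1 (v - y) = 1}. \<psi> y) + D v * \<psi> v"

definition hop_mat :: "(int^'d \<Rightarrow> complex) \<Rightarrow> int^'d \<Rightarrow> int^'d \<Rightarrow> complex" where
  "hop_mat D v w = (if norm1 (v - w) = 1 then -1 else 0) + (if v = w then D v else 0)"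

lemma hop_op_eq_hop_mat:
  assumes "finite \<Gamma>" "v \<in> \<Gamma>"
  shows "hop_op \<Gamma> D \<psi> v = (\<Sum>w\<in>\<Gamma>. hop_mat D v w * \<psi> w)"
proof -
  have "(\<Sum>w\<in>\<Gamma>. hop_mat D v w * \<psi> w)
      = (\<Sum>w\<in>\<Gamma>. if norm1 (v - w) = 1 then - \<psi> w else 0) + (\<Sum>w\<in>\<Gamma>. if v = w then D v * \<psi> w else 0)"
    unfolding sum.distrib[symmetric] by (intro sum.cong) (auto simp: hop_mat_def algebra_simps)
  also have "(\<Sum>w\<in>\<Gamma>. if norm1 (v - w) = 1 then - \<psi> w else 0)
      = - (\<Sum>y\<in>{y \<in> \<Gamma>. norm1 (v - y) = 1}. \<psi> y)"
    using assms by (simp add: sum.inter_filter sum_negf[symmetric] if_distrib cong: if_cong)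
  also have "(\<Sum>w\<in>\<Gamma>. if v = w then D v * \<psi> w else 0) = D v * \<psi> v"
    using assms by simp
  finally show ?thesis by (simp add: hop_op_def)
qed

lemma hop_op_diff: "hop_op \<Gamma> D (\<lambda>v. \<phi> v - \<psi> v) v = hop_op \<Gamma> D \<phi> v - hop_op \<Gamma> D \<psi> v"
  by (simp add: hop_op_def sum_subtractf algebra_simps)

lemma hop_op_scale: "hop_op \<Gamma> D (\<lambda>v. c * \<phi> v) v = c * hop_op \<Gamma> D \<phi> v"
  by (simp add: hop_op_def sum_distrib_left algebra_simps)

lemma hop_op_sum: "hop_op \<Gamma> D (\<lambda>v. \<Sum>i\<in>I. \<phi> i v) v = (\<Sum>i\<in>I. hop_op \<Gamma> D (\<phi> i) v)"
  by (simp add: hop_op_def sum.distrib sum_negf sum_subtractf sum_distrib_left sum.swap[of _ I])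

text \<open>Hopping inside \<open>F\<close> is a real symmetric kernel, so its quadratic form is
  real. Only the diagonal and the current through the boundary of \<open>F\<close> have an imaginary
  part.\<close>

lemma Im_hop_energy:
  assumes F: "finite F" "F \<subseteq> \<Gamma>"
  shows "Im (\<Sum>v\<in>F. cnj (\<psi> v) * hop_op \<Gamma> D \<psi> v) =
    (\<Sum>v\<in>F. Im (D v) * (norm (\<psi> v))\<^sup>2)
    - Im (\<Sum>v\<in>F. \<Sum>y\<in>{y \<in> \<Gamma> - F. norm1 (v - y) = 1}. cnj (\<psi> v) * \<psi> y)"
proof -
  define X where "X = (\<Sum>v\<in>F. \<Sum>y\<in>{y \<in> F. norm1 (v - y) = 1}. cnj (\<psi> v) * \<psi> y)"
  have X: "X = (\<Sum>v\<in>F. \<Sum>y\<in>F. if norm1 (v - y) = 1 then cnj (\<psi> v) * \<psi> y else 0)"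
    unfolding X_def using F by (simp add: sum.inter_filter)
  have "cnj X = (\<Sum>v\<in>F. \<Sum>y\<in>F. if norm1 (v - y) = 1 then cnj (\<psi> y) * \<psi> v else 0)"
    unfolding X by (simp add: if_distrib mult.commute cong: if_cong)
  also have "\<dots> = X"
    unfolding X by (subst sum.swap) (simp add: norm1_minus_commute)
  finally have ImX: "Im X = 0" by (metis Reals_cnj_iff complex_is_Real_iff)
  have "cnj (\<psi> v) * hop_op \<Gamma> D \<psi> v = D v * of_real ((norm (\<psi> v))\<^sup>2)
      - (\<Sum>y\<in>{y \<in> F. norm1 (v - y) = 1}. cnj (\<psi> v) * \<psi> y)
      - (\<Sum>y\<in>{y \<in> \<Gamma> - F. norm1 (v - y) = 1}. cnj (\<psi> v) * \<psi> y)" for v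
  proof -
    have "{y \<in> \<Gamma>. norm1 (v - y) = 1} = {y \<in> F. norm1 (v - y) = 1} \<union> {y \<in> \<Gamma> - F. norm1 (v - y) = 1}"
      using F by auto
    moreover have "(\<Sum>y\<in>{y \<in> F. norm1 (v - y) = 1} \<union> {y \<in> \<Gamma> - F. norm1 (v - y) = 1}. cnj (\<psi> v) * \<psi> y) =
       (\<Sum>y\<in>{y \<in> F. norm1 (v - y) = 1}. cnj (\<psi> v) * \<psi> y)
       + (\<Sum>y\<in>{y \<in> \<Gamma> - F. norm1 (v - y) = 1}. cnj (\<psi> v) * \<psi> y)"
      by (intro sum.union_disjoint finite_nbrs_in) auto
    ultimately have "(\<Sum>y\<in>{y \<in> \<Gamma>. norm1 (v - y) = 1}. cnj (\<psi> v) * \<psi> y) =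
       (\<Sum>y\<in>{y \<in> F. norm1 (v - y) = 1}. cnj (\<psi> v) * \<psi> y)
       + (\<Sum>y\<in>{y \<in> \<Gamma> - F. norm1 (v - y) = 1}. cnj (\<psi> v) * \<psi> y)"
      by (simp only:)
    moreover have "of_real ((norm (\<psi> v))\<^sup>2) = \<psi> v * cnj (\<psi> v)"
      by (metis complex_norm_square of_real_power)
    ultimately show ?thesis by (simp add: hop_op_def sum_distrib_left algebra_simps)
  qed
  then have "(\<Sum>v\<in>F. cnj (\<psi> v) * hop_op \<Gamma> D \<psi> v) =
     (\<Sum>v\<in>F. D v * of_real ((norm (\<psi> v))\<^sup>2)) - X
     - (\<Sum>v\<in>F. \<Sum>y\<in>{y \<in> \<Gamma> - F. norm1 (v - y) = 1}. cnj (\<psi> v) * \<psi> y)"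
    by (simp add: sum_subtractf X_def)
  then show ?thesis using ImX by (simp add: Im_sum)
qed

lemma Im_hop_energy_full:
  assumes "finite \<Gamma>"
  shows "Im (\<Sum>v\<in>\<Gamma>. cnj (\<psi> v) * hop_op \<Gamma> D \<psi> v) = (\<Sum>v\<in>\<Gamma>. Im (D v) * (norm (\<psi> v))\<^sup>2)"
  using Im_hop_energy[OF assms subset_refl, of \<psi> D] by simp

text \<open>Summation over the concentric boxes: the flux of the current through the boundary of a box
  is controlled by the mass of two consecutive shells, and these masses add up to at most \<open>K\<close>.\<close>

lemma local_energy_decay:
  fixes \<Gamma> :: "(int^'d) set" and K :: real
  assumes Im_D: "\<And>v. v \<in> \<Gamma> \<Longrightarrow> Im (D v) = c"
    and sol: "\<And>v. v \<in> \<Gamma> \<Longrightarrow> norminf v < int N \<Longrightarrow> hop_op \<Gamma> D \<phi> v = 0"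
    and bound: "\<And>F. finite F \<Longrightarrow> F \<subseteq> \<Gamma> \<Longrightarrow> (\<Sum>v\<in>F. (norm (\<phi> v))\<^sup>2) \<le> K"
    and J: "J \<le> N"
  shows "\<bar>c\<bar> * (real N - real J) * (\<Sum>v\<in>\<Gamma> \<inter> lattice_box J. (norm (\<phi> v))\<^sup>2) \<le> 2 * CARD('d) * K"
proof -
  define S where "S j = {v \<in> \<Gamma>. norminf v = int j}" for j
  define m where "m j = (\<Sum>v\<in>S j. (norm (\<phi> v))\<^sup>2)" for j
  have finS: "finite (S j)" for j
    by (rule finite_subset[OF _ finite_lattice_box[of j]]) (auto simp: S_def lattice_box_def)
  have flux: "\<bar>c\<bar> * (\<Sum>v\<in>\<Gamma> \<inter> lattice_box j. (norm (\<phi> v))\<^sup>2) \<le> CARD('d) * (m j + m (Suc j))"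
    if j: "j < N" for j
  proof -
    let ?F = "\<Gamma> \<inter> lattice_box j"
    \<comment> \<open>An edge that leaves the box joins the sphere of radius \<open>j\<close> to the
      next one, so only these two spheres carry flux.\<close>
    have shell: "v \<in> S j \<and> y \<in> S (Suc j)"
      if "v \<in> ?F" "y \<in> \<Gamma> - ?F" "norm1 (v - y) = 1" for v y
      using that norminf_nbr[of v y] by (auto simp: S_def lattice_box_def)
    have "(\<Sum>v\<in>?F. cnj (\<phi> v) * hop_op \<Gamma> D \<phi> v) = 0"
      using j by (intro sum.neutral) (auto simp: lattice_box_def intro!: sol)
    then have "c * (\<Sum>v\<in>?F. (norm (\<phi> v))\<^sup>2)
       = Im (\<Sum>v\<in>?F. \<Sum>y\<in>{y \<in> \<Gamma> - ?F. norm1 (v - y) = 1}. cnj (\<phi> v) * \<phi> y)" (is "c * ?M = Im ?X")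
      using Im_hop_energy[of ?F \<Gamma> \<phi> D] Im_D by (simp add: sum_distrib_left)
    then have "\<bar>Im ?X\<bar> = \<bar>c * ?M\<bar>" by (rule arg_cong[symmetric])
    also have "\<dots> = \<bar>c\<bar> * ?M" by (simp only: abs_mult abs_of_nonneg[OF sum_nonneg[OF zero_le_power2]])
    finally have "\<bar>c\<bar> * ?M = \<bar>Im ?X\<bar>" by (rule sym)
    also have "\<dots> \<le> norm (\<Sum>v\<in>?F. \<Sum>y\<in>{y \<in> \<Gamma> - ?F. norm1 (v - y) = 1}. cnj (\<phi> v) * \<phi> y)"
      by (rule abs_Im_le_cmod)
    also have "\<dots> \<le> (\<Sum>v\<in>?F. \<Sum>y\<in>{y \<in> \<Gamma> - ?F. norm1 (v - y) = 1}. norm (\<phi> v) * norm (\<phi> y))"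
      by (intro order.trans[OF norm_sum] sum_mono) (simp add: norm_mult)
    also have "\<dots> \<le> (\<Sum>v\<in>?F. \<Sum>y\<in>{y \<in> \<Gamma> - ?F. norm1 (v - y) = 1}.
        (norm (\<phi> v))\<^sup>2 / 2 + (norm (\<phi> y))\<^sup>2 / 2)"
    proof (intro sum_mono)
      fix v y :: "int^'d"
      show "norm (\<phi> v) * norm (\<phi> y) \<le> (norm (\<phi> v))\<^sup>2 / 2 + (norm (\<phi> y))\<^sup>2 / 2"
        using sum_squares_bound[of "norm (\<phi> v)" "norm (\<phi> y)"] by simp
    qed
    also have "\<dots> = (\<Sum>v\<in>?F. \<Sum>y\<in>{y \<in> \<Gamma> - ?F. norm1 (v - y) = 1}. (norm (\<phi> v))\<^sup>2 / 2)
        + (\<Sum>v\<in>?F. \<Sum>y\<in>{y \<in> \<Gamma> - ?F. norm1 (v - y) = 1}. (norm (\<phi> y))\<^sup>2 / 2)"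
      by (simp add: sum.distrib)
    \<comment> \<open>At most 2d edges meet a site; with the factor 1/2 each shell gets the weight
      d.\<close>
    also have "(\<Sum>v\<in>?F. \<Sum>y\<in>{y \<in> \<Gamma> - ?F. norm1 (v - y) = 1}. (norm (\<phi> v))\<^sup>2 / 2)
        \<le> (\<Sum>v\<in>S j. CARD('d) * (norm (\<phi> v))\<^sup>2)"
    proof -
      have "(\<Sum>v\<in>?F. \<Sum>y\<in>{y \<in> \<Gamma> - ?F. norm1 (v - y) = 1}. (norm (\<phi> v))\<^sup>2 / 2)
          = (\<Sum>v\<in>S j. \<Sum>y\<in>{y \<in> \<Gamma> - ?F. norm1 (v - y) = 1}. (norm (\<phi> v))\<^sup>2 / 2)"
      proof (rule sum.mono_neutral_right)
        show "S j \<subseteq> ?F" by (auto simp: S_def lattice_box_def)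
        show "\<forall>v\<in>?F - S j. (\<Sum>y\<in>{y \<in> \<Gamma> - ?F. norm1 (v - y) = 1}. (norm (\<phi> v))\<^sup>2 / 2) = 0"
        proof
          fix v assume "v \<in> ?F - S j"
          then have "{y \<in> \<Gamma> - ?F. norm1 (v - y) = 1} = {}" using shell by blast
          then show "(\<Sum>y\<in>{y \<in> \<Gamma> - ?F. norm1 (v - y) = 1}. (norm (\<phi> v))\<^sup>2 / 2) = 0"
            by (metis sum.empty)
        qed
      qed simp
      also have "\<dots> \<le> (\<Sum>v\<in>S j. CARD('d) * (norm (\<phi> v))\<^sup>2)"
      proof (intro sum_mono)
        fix v :: "int^'d"
        have "real (card {y \<in> \<Gamma> - ?F. norm1 (v - y) = 1}) \<le> 2 * CARD('d)"
          using card_nbrs_in_le[of "\<Gamma> - ?F" v] by linarith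
        then show "(\<Sum>y\<in>{y \<in> \<Gamma> - ?F. norm1 (v - y) = 1}. (norm (\<phi> v))\<^sup>2 / 2)
            \<le> CARD('d) * (norm (\<phi> v))\<^sup>2"
          using mult_right_mono[of "real (card {y \<in> \<Gamma> - ?F. norm1 (v - y) = 1})" "2 * CARD('d)"
              "(norm (\<phi> v))\<^sup>2 / 2"] by simp
      qed
      finally show ?thesis .
    qed
    also have "(\<Sum>v\<in>?F. \<Sum>y\<in>{y \<in> \<Gamma> - ?F. norm1 (v - y) = 1}. (norm (\<phi> y))\<^sup>2 / 2)
        \<le> (\<Sum>y\<in>S (Suc j). CARD('d) * (norm (\<phi> y))\<^sup>2)"
    proof -
      have "(\<Sum>v\<in>?F. \<Sum>y\<in>{y \<in> \<Gamma> - ?F. norm1 (v - y) = 1}. (norm (\<phi> y))\<^sup>2 / 2)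
          \<le> (\<Sum>v\<in>?F. \<Sum>y\<in>{y \<in> S (Suc j). norm1 (v - y) = 1}. (norm (\<phi> y))\<^sup>2 / 2)"
        using shell by (intro sum_mono sum_mono2 finite_nbrs_in) auto
      also have "\<dots> = (\<Sum>y\<in>S (Suc j). \<Sum>v\<in>{v \<in> ?F. norm1 (v - y) = 1}. (norm (\<phi> y))\<^sup>2 / 2)"
        by (rule sum.swap_restrict) (use finS in auto)
      also have "\<dots> \<le> (\<Sum>y\<in>S (Suc j). CARD('d) * (norm (\<phi> y))\<^sup>2)"
      proof (intro sum_mono)
        fix y :: "int^'d"
        have "real (card {v \<in> ?F. norm1 (v - y) = 1}) \<le> 2 * CARD('d)"
          using card_nbrs_in_le[of ?F y] by (simp add: norm1_minus_commute[of _ y])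
        then show "(\<Sum>v\<in>{v \<in> ?F. norm1 (v - y) = 1}. (norm (\<phi> y))\<^sup>2 / 2)
            \<le> CARD('d) * (norm (\<phi> y))\<^sup>2"
          using mult_right_mono[of "real (card {v \<in> ?F. norm1 (v - y) = 1})" "2 * CARD('d)"
              "(norm (\<phi> y))\<^sup>2 / 2"] by simp
      qed
      finally show ?thesis .
    qed
    finally show ?thesis
      by (simp add: m_def sum_distrib_left distrib_left)
  qed
  have mass: "(\<Sum>j\<in>A. m j) \<le> K" if A: "finite A" for A
  proof -
    have "(\<Sum>j\<in>A. m j) = (\<Sum>v\<in>(\<Union>j\<in>A. S j). (norm (\<phi> v))\<^sup>2)"
      unfolding m_def
      by (rule sum.UNION_disjoint[symmetric]) (use A finS in \<open>auto simp: S_def\<close>)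
    also have "\<dots> \<le> K" using A finS by (intro bound) (auto simp: S_def)
    finally show ?thesis .
  qed
  \<comment> \<open>The inner box is counted once for each radius \<open>j\<close> from
    \<open>J\<close> to \<open>N - 1\<close>, and each of these boxes contains it.\<close>
  have "\<bar>c\<bar> * (real N - real J) * (\<Sum>v\<in>\<Gamma> \<inter> lattice_box J. (norm (\<phi> v))\<^sup>2)
      = (\<Sum>j\<in>{J..<N}. \<bar>c\<bar> * (\<Sum>v\<in>\<Gamma> \<inter> lattice_box J. (norm (\<phi> v))\<^sup>2))"
    using J by (simp add: of_nat_diff)
  also have "\<dots> \<le> (\<Sum>j\<in>{J..<N}. CARD('d) * (m j + m (Suc j)))"
  proof (intro sum_mono)
    fix j assume j: "j \<in> {J..<N}"
    have "(\<Sum>v\<in>\<Gamma> \<inter> lattice_box J. (norm (\<phi> v))\<^sup>2) \<le> (\<Sum>v\<in>\<Gamma> \<inter> lattice_box j. (norm (\<phi> v))\<^sup>2)"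
      using j by (intro sum_mono2 finite_Int disjI2 finite_lattice_box) (auto simp: lattice_box_def)
    then show "\<bar>c\<bar> * (\<Sum>v\<in>\<Gamma> \<inter> lattice_box J. (norm (\<phi> v))\<^sup>2) \<le> CARD('d) * (m j + m (Suc j))"
      using flux[of j] j by (meson abs_ge_zero atLeastLessThan_iff mult_left_mono order_trans)
  qed
  also have "\<dots> = CARD('d) * ((\<Sum>j\<in>{J..<N}. m j) + (\<Sum>j\<in>Suc ` {J..<N}. m j))"
    by (simp add: sum_distrib_left sum.distrib distrib_left sum.reindex
        del: image_Suc_atLeastLessThan)
  also have "\<dots> \<le> CARD('d) * (K + K)"
    by (intro mult_left_mono add_mono mass) auto
  finally show ?thesis by simp
qed

subsection \<open>Green's function and its finite-volume approximation\<close>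

definition hop_solves :: "(int^'d) set \<Rightarrow> (int^'d \<Rightarrow> complex) \<Rightarrow> int^'d \<Rightarrow> (int^'d \<Rightarrow> complex) \<Rightarrow> bool" where
  "hop_solves \<Gamma> D y \<psi> \<longleftrightarrow> (\<forall>v\<in>\<Gamma>. hop_op \<Gamma> D \<psi> v = (if v = y then 1 else 0))"

text \<open>In \<open>local_energy_decay\<close> the outer radius may grow while the right-hand side
  stays fixed, so the mass near \<open>x\<close> is zero. This gives uniqueness of the resolvent
  column without spectral theory.\<close>

lemma hop_homogeneous_l2_zero:
  fixes \<Gamma> :: "(int^'d) set"
  assumes l2: "l2_on \<Gamma> \<phi>" and Im_D: "\<And>v. v \<in> \<Gamma> \<Longrightarrow> Im (D v) = c" and c: "c \<noteq> 0"
    and sol: "\<And>v. v \<in> \<Gamma> \<Longrightarrow> hop_op \<Gamma> D \<phi> v = 0"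
  shows "\<phi> x = 0"
proof (cases "x \<in> \<Gamma>")
  case True
  define K where "K = infsum (\<lambda>v. (norm (\<phi> v))\<^sup>2) \<Gamma>"
  have bound: "(\<Sum>v\<in>F. (norm (\<phi> v))\<^sup>2) \<le> K" if "finite F" "F \<subseteq> \<Gamma>" for F
    unfolding K_def using l2 that by (intro finite_sum_le_infsum) (auto simp: l2_on_def)
  define J where "J = nat (norminf x)"
  have x: "x \<in> \<Gamma> \<inter> lattice_box J" using True norminf_nonneg[of x] by (simp add: lattice_box_def J_def)
  have le: "\<bar>c\<bar> * real n * (norm (\<phi> x))\<^sup>2 \<le> 2 * CARD('d) * K" for n
  proof -
    have "(norm (\<phi> x))\<^sup>2 \<le> (\<Sum>v\<in>\<Gamma> \<inter> lattice_box J. (norm (\<phi> v))\<^sup>2)"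
      using x by (intro member_le_sum) auto
    then have "\<bar>c\<bar> * real n * (norm (\<phi> x))\<^sup>2
        \<le> \<bar>c\<bar> * real n * (\<Sum>v\<in>\<Gamma> \<inter> lattice_box J. (norm (\<phi> v))\<^sup>2)"
      by (intro mult_left_mono) auto
    also have "\<dots> \<le> 2 * CARD('d) * K"
      using local_energy_decay[where D = D and c = c and N = "J + n" and J = J, OF Im_D sol bound]
      by simp
    finally show ?thesis .
  qed
  show ?thesis
  proof (rule ccontr)
    assume "\<phi> x \<noteq> 0"
    then have pos: "\<bar>c\<bar> * (norm (\<phi> x))\<^sup>2 > 0" using c by simp
    obtain n where "2 * CARD('d) * K < real n * (\<bar>c\<bar> * (norm (\<phi> x))\<^sup>2)"
      using reals_Archimedean3[OF pos] by blast
    with le[of n] show False by (simp add: mult_ac)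
  qed
qed (use l2 in \<open>simp add: l2_on_def\<close>)

lemma l2_on_finite: "finite \<Gamma> \<Longrightarrow> (\<And>v. v \<notin> \<Gamma> \<Longrightarrow> \<psi> v = 0) \<Longrightarrow> l2_on \<Gamma> \<psi>"
  by (simp add: l2_on_def)

lemma l2_on_diff:
  assumes "l2_on \<Gamma> \<phi>" "l2_on \<Gamma> \<psi>" shows "l2_on \<Gamma> (\<lambda>v. \<phi> v - \<psi> v)"
proof -
  have "(\<lambda>v. 2 * ((norm (\<phi> v))\<^sup>2 + (norm (\<psi> v))\<^sup>2)) summable_on \<Gamma>"
    using assms by (intro summable_on_cmult_right summable_on_add) (auto simp: l2_on_def)
  then have "(\<lambda>v. (norm (\<phi> v - \<psi> v))\<^sup>2) summable_on \<Gamma>"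
  proof (rule summable_on_comparison_test)
    fix v
    have "(norm (\<phi> v - \<psi> v))\<^sup>2 \<le> (norm (\<phi> v) + norm (\<psi> v))\<^sup>2"
      by (intro power_mono norm_triangle_ineq4) auto
    also have "\<dots> \<le> 2 * ((norm (\<phi> v))\<^sup>2 + (norm (\<psi> v))\<^sup>2)"
      using sum_squares_bound[of "norm (\<phi> v)" "norm (\<psi> v)"] by (simp add: power2_sum)
    finally show "(norm (\<phi> v - \<psi> v))\<^sup>2 \<le> 2 * ((norm (\<phi> v))\<^sup>2 + (norm (\<psi> v))\<^sup>2)" .
  qed auto
  then show ?thesis using assms by (auto simp: l2_on_def)
qed

lemma hop_solves_unique:
  assumes "l2_on \<Gamma> \<phi>" "l2_on \<Gamma> \<psi>" "hop_solves \<Gamma> D y \<phi>" "hop_solves \<Gamma> D y \<psi>"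
    and "\<And>v. v \<in> \<Gamma> \<Longrightarrow> Im (D v) = c" "c \<noteq> 0"
  shows "\<phi> = \<psi>"
proof
  fix x
  have "\<phi> x - \<psi> x = 0"
    by (rule hop_homogeneous_l2_zero[OF l2_on_diff[OF assms(1,2)] assms(5,6)])
      (use assms(3,4) in \<open>auto simp: hop_op_diff hop_solves_def\<close>)
  then show "\<phi> x = \<psi> x" by simp
qed

text \<open>Injectivity is a hypothesis because it has two sources: the constant nonzero imaginary
  part of \<open>green_diag\<close>, and \<open>hop_block_injective\<close> at complex couplings,
  where the imaginary part of the diagonal varies from site to site.\<close>

lemma hop_solves_finite_ex:
  assumes fin: "finite \<Gamma>"
    and inj: "\<And>\<psi>. (\<And>v. v \<in> \<Gamma> \<Longrightarrow> hop_op \<Gamma> D \<psi> v = 0) \<Longrightarrow> \<forall>v\<in>\<Gamma>. \<psi> v = 0"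
  shows "fdet \<Gamma> (hop_mat D) \<noteq> 0" "\<exists>\<psi>. l2_on \<Gamma> \<psi> \<and> hop_solves \<Gamma> D y \<psi>"
proof -
  show det: "fdet \<Gamma> (hop_mat D) \<noteq> 0"
    by (rule fdet_nonzero[OF fin inj]) (simp add: hop_op_eq_hop_mat fin)
  obtain \<psi> where \<psi>: "\<forall>v\<in>\<Gamma>. (\<Sum>w\<in>\<Gamma>. hop_mat D v w * \<psi> w) = (if v = y then 1 else 0)"
    using fdet_solution[OF fin det, of "\<lambda>v. if v = y then 1 else 0"] by blast
  define \<phi> where "\<phi> v = (if v \<in> \<Gamma> then \<psi> v else 0)" for v
  have "l2_on \<Gamma> \<phi>" by (rule l2_on_finite[OF fin]) (simp add: \<phi>_def)
  moreover have "hop_solves \<Gamma> D y \<phi>"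
    unfolding hop_solves_def
  proof
    fix v assume "v \<in> \<Gamma>"
    then have "hop_op \<Gamma> D \<phi> v = (\<Sum>w\<in>\<Gamma>. hop_mat D v w * \<psi> w)"
      by (subst hop_op_eq_hop_mat[OF fin]) (auto simp: \<phi>_def intro!: sum.cong)
    then show "hop_op \<Gamma> D \<phi> v = (if v = y then 1 else 0)" using \<psi> \<open>v \<in> \<Gamma>\<close> by auto
  qed
  ultimately show "\<exists>\<psi>. l2_on \<Gamma> \<psi> \<and> hop_solves \<Gamma> D y \<psi>" by blast
qed

lemma hop_finite_injective:
  assumes fin: "finite \<Gamma>" and Im_D: "\<And>v. v \<in> \<Gamma> \<Longrightarrow> Im (D v) = c" "c \<noteq> 0"
    and eq: "\<And>v. v \<in> \<Gamma> \<Longrightarrow> hop_op \<Gamma> D \<psi> v = 0"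
  shows "\<forall>v\<in>\<Gamma>. \<psi> v = 0"
proof -
  have "c * (\<Sum>v\<in>\<Gamma>. (norm (\<psi> v))\<^sup>2) = 0"
    using Im_hop_energy_full[OF fin, of \<psi> D] eq Im_D(1) by (simp add: sum_distrib_left)
  then have "(\<Sum>v\<in>\<Gamma>. (norm (\<psi> v))\<^sup>2) = 0" using Im_D(2) by simp
  then show ?thesis using fin by (subst (asm) sum_nonneg_eq_0_iff) auto
qed

text \<open>The resolvent bound 1 / |Im z|: the energy identity bounds |c| times the mass by the
  modulus of \<psi> at \<open>y\<close>, which is at most the square root of the mass.\<close>

lemma hop_solves_finite_norm:
  assumes fin: "finite \<Gamma>" and Im_D: "\<And>v. v \<in> \<Gamma> \<Longrightarrow> Im (D v) = c" and c: "c \<noteq> 0"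
    and sol: "hop_solves \<Gamma> D y \<psi>"
  shows "(\<Sum>v\<in>\<Gamma>. (norm (\<psi> v))\<^sup>2) \<le> 1 / c\<^sup>2"
proof (cases "y \<in> \<Gamma>")
  case True
  let ?m = "\<Sum>v\<in>\<Gamma>. (norm (\<psi> v))\<^sup>2"
  have "(\<Sum>v\<in>\<Gamma>. cnj (\<psi> v) * hop_op \<Gamma> D \<psi> v) = (\<Sum>v\<in>\<Gamma>. if v = y then cnj (\<psi> v) else 0)"
    using sol by (intro sum.cong) (auto simp: hop_solves_def)
  also have "\<dots> = cnj (\<psi> y)" using True fin by simp
  finally have "Im (cnj (\<psi> y)) = c * ?m"
    using Im_hop_energy_full[OF fin, of \<psi> D] Im_D by (simp add: sum_distrib_left)
  then have "\<bar>c\<bar> * ?m = \<bar>Im (cnj (\<psi> y))\<bar>" by (simp add: abs_mult sum_nonneg)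
  also have "\<dots> \<le> norm (\<psi> y)" using abs_Im_le_cmod[of "\<psi> y"] by simp
  finally have 1: "\<bar>c\<bar> * ?m \<le> norm (\<psi> y)" .
  have 2: "(norm (\<psi> y))\<^sup>2 \<le> ?m" using True fin by (intro member_le_sum) auto
  have m0: "?m \<ge> 0" by (simp add: sum_nonneg)
  have "(\<bar>c\<bar> * ?m)\<^sup>2 \<le> (norm (\<psi> y))\<^sup>2" using 1 m0 by (intro power_mono) auto
  with 2 have "c\<^sup>2 * ?m * ?m \<le> 1 * ?m" by (simp add: power2_eq_square mult_ac abs_mult_self_eq)
  then have "c\<^sup>2 * ?m \<le> 1 \<or> ?m = 0" using m0 by (metis mult_right_le_imp_le order_le_less)
  then show ?thesis using c by (auto simp: field_simps)
next
  case False
  then have "hop_op \<Gamma> D \<psi> v = 0" if "v \<in> \<Gamma>" for v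
    using sol that by (auto simp: hop_solves_def)
  from hop_finite_injective[OF fin Im_D c this] show ?thesis by simp
qed

text \<open>Neighbouring truncations satisfy the same equation away from the boundary, so
  the local energy estimate makes the finite-volume solutions pointwise Cauchy.\<close>

lemma hop_solves_limit:
  fixes \<Gamma> :: "(int^'d) set"
  assumes Im_D: "\<And>v. v \<in> \<Gamma> \<Longrightarrow> Im (D v) = c" and c: "c \<noteq> 0"
    and l2: "\<And>N. l2_on (\<Gamma> \<inter> lattice_box N) (\<psi> N)"
    and sol: "\<And>N. hop_solves (\<Gamma> \<inter> lattice_box N) D y (\<psi> N)"
  shows "\<exists>\<phi>. l2_on \<Gamma> \<phi> \<and> hop_solves \<Gamma> D y \<phi> \<and> (\<forall>x. (\<lambda>N. \<psi> N x) \<longlonglongrightarrow> \<phi> x)"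
proof -
  let ?\<Gamma> = "\<lambda>N. \<Gamma> \<inter> lattice_box N"
  have zero: "\<psi> N v = 0" if "v \<notin> ?\<Gamma> N" for N v using l2[of N] that by (auto simp: l2_on_def)
  \<comment> \<open>The strict inequality puts all neighbours of \<open>v\<close> in \<Gamma> into
    the box, so the truncation is invisible at \<open>v\<close>.\<close>
  have eq: "hop_op \<Gamma> D (\<psi> M) v = (if v = y then 1 else 0)"
    if "v \<in> \<Gamma>" "norminf v < int N" "N \<le> M" for v N M
  proof -
    have "{y \<in> ?\<Gamma> M. norm1 (v - y) = 1} = {y \<in> \<Gamma>. norm1 (v - y) = 1}"
      using that norminf_nbr[of v] by (fastforce simp: lattice_box_def)
    then have "hop_op \<Gamma> D (\<psi> M) v = hop_op (?\<Gamma> M) D (\<psi> M) v" by (simp add: hop_op_def)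
    moreover have "v \<in> ?\<Gamma> M" using that by (simp add: lattice_box_def)
    ultimately show ?thesis using sol[of M] by (simp add: hop_solves_def)
  qed
  have bound: "(\<Sum>v\<in>F. (norm (\<psi> N v))\<^sup>2) \<le> 1 / c\<^sup>2" if "finite F" for F N
  proof -
    have "(\<Sum>v\<in>F. (norm (\<psi> N v))\<^sup>2) = (\<Sum>v\<in>F \<inter> ?\<Gamma> N. (norm (\<psi> N v))\<^sup>2)"
      using that zero[of _ N] by (intro sum.mono_neutral_right) auto
    also have "\<dots> \<le> (\<Sum>v\<in>?\<Gamma> N. (norm (\<psi> N v))\<^sup>2)" by (intro sum_mono2) auto
    also have "\<dots> \<le> 1 / c\<^sup>2"
      using Im_D c sol[of N] by (intro hop_solves_finite_norm) auto
    finally show ?thesis .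
  qed
  define K where "K = 4 / c\<^sup>2"
  have bound_diff: "(\<Sum>v\<in>F. (norm (\<psi> M v - \<psi> M' v))\<^sup>2) \<le> K" if "finite F" for F M M'
  proof -
    have "(\<Sum>v\<in>F. (norm (\<psi> M v - \<psi> M' v))\<^sup>2)
        \<le> (\<Sum>v\<in>F. 2 * (norm (\<psi> M v))\<^sup>2 + 2 * (norm (\<psi> M' v))\<^sup>2)"
    proof (intro sum_mono)
      fix v
      have "(norm (\<psi> M v - \<psi> M' v))\<^sup>2 \<le> (norm (\<psi> M v) + norm (\<psi> M' v))\<^sup>2"
        by (intro power_mono norm_triangle_ineq4) auto
      also have "\<dots> \<le> 2 * (norm (\<psi> M v))\<^sup>2 + 2 * (norm (\<psi> M' v))\<^sup>2"
        using sum_squares_bound[of "norm (\<psi> M v)" "norm (\<psi> M' v)"] by (simp add: power2_sum)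
      finally show "(norm (\<psi> M v - \<psi> M' v))\<^sup>2 \<le> 2 * (norm (\<psi> M v))\<^sup>2 + 2 * (norm (\<psi> M' v))\<^sup>2" .
    qed
    also have "\<dots> = 2 * (\<Sum>v\<in>F. (norm (\<psi> M v))\<^sup>2) + 2 * (\<Sum>v\<in>F. (norm (\<psi> M' v))\<^sup>2)"
      by (simp add: sum.distrib sum_distrib_left)
    also have "\<dots> \<le> 2 * (1 / c\<^sup>2) + 2 * (1 / c\<^sup>2)"
      by (intro add_mono mult_left_mono bound that) auto
    finally show ?thesis by (simp add: K_def)
  qed
  have conv: "convergent (\<lambda>N. \<psi> N x)" for x
  proof (cases "x \<in> \<Gamma>")
    case True
    define J where "J = nat (norminf x)"
    have x: "x \<in> ?\<Gamma> J" using True norminf_nonneg[of x] by (simp add: lattice_box_def J_def)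
    \<comment> \<open>The difference of two truncated solutions is homogeneous inside the smaller
      box, also at \<open>y\<close>, where the two sources cancel. The gap \<open>n\<close> between
      the radii makes it small at \<open>x\<close>.\<close>
    have le: "\<bar>c\<bar> * real n * (norm (\<psi> M x - \<psi> M' x))\<^sup>2 \<le> 2 * CARD('d) * K"
      if "J + n \<le> M" "J + n \<le> M'" for n M M'
    proof -
      let ?\<phi> = "\<lambda>v. \<psi> M v - \<psi> M' v"
      have "(norm (?\<phi> x))\<^sup>2 \<le> (\<Sum>v\<in>?\<Gamma> J. (norm (?\<phi> v))\<^sup>2)"
        using x by (intro member_le_sum[where f = "\<lambda>v. (norm (?\<phi> v))\<^sup>2"]) auto
      then have "\<bar>c\<bar> * real n * (norm (?\<phi> x))\<^sup>2 \<le> \<bar>c\<bar> * real n * (\<Sum>v\<in>?\<Gamma> J. (norm (?\<phi> v))\<^sup>2)"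
        by (intro mult_left_mono) auto
      also have "\<dots> = \<bar>c\<bar> * (real (J + n) - real J) * (\<Sum>v\<in>?\<Gamma> J. (norm (?\<phi> v))\<^sup>2)" by simp
      also have "\<dots> \<le> 2 * CARD('d) * K"
      proof (rule local_energy_decay[where D = D])
        show "hop_op \<Gamma> D ?\<phi> v = 0" if "v \<in> \<Gamma>" "norminf v < int (J + n)" for v
          using eq[OF that \<open>J + n \<le> M\<close>] eq[OF that \<open>J + n \<le> M'\<close>] by (simp add: hop_op_diff)
      qed (use Im_D bound_diff in auto)
      finally show ?thesis .
    qed
    have "Cauchy (\<lambda>N. \<psi> N x)"
    proof (rule metric_CauchyI)
      fix e :: real assume e: "e > 0"
      then have "\<bar>c\<bar> * e\<^sup>2 > 0" using c by simp
      then obtain n where n: "2 * CARD('d) * K < real n * (\<bar>c\<bar> * e\<^sup>2)"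
        using reals_Archimedean3 by blast
      show "\<exists>L. \<forall>M\<ge>L. \<forall>M'\<ge>L. dist (\<psi> M x) (\<psi> M' x) < e"
      proof (intro exI allI impI)
        fix M M' assume *: "M \<ge> J + n" "M' \<ge> J + n"
        have "(real n * \<bar>c\<bar>) * (norm (\<psi> M x - \<psi> M' x))\<^sup>2 < (real n * \<bar>c\<bar>) * e\<^sup>2"
          using le[OF *] n by (simp add: mult_ac)
        then have "(norm (\<psi> M x - \<psi> M' x))\<^sup>2 < e\<^sup>2"
          by (rule mult_left_less_imp_less) simp
        then show "dist (\<psi> M x) (\<psi> M' x) < e"
          using e by (simp add: dist_norm power2_less_imp_less)
      qed
    qed
    then show ?thesis by (rule Cauchy_convergent)
  next
    case False
    then show ?thesis using zero[of x] by (simp add: convergent_const)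
  qed
  define \<phi> where "\<phi> x = lim (\<lambda>N. \<psi> N x)" for x
  have lim: "(\<lambda>N. \<psi> N x) \<longlonglongrightarrow> \<phi> x" for x
    unfolding \<phi>_def using conv[of x] convergent_LIMSEQ_iff by blast
  have "\<phi> x = 0" if "x \<notin> \<Gamma>" for x using zero[of x] that by (simp add: \<phi>_def)
  moreover have "(\<lambda>x. (norm (\<phi> x))\<^sup>2) summable_on \<Gamma>"
  proof (rule nonneg_bdd_above_summable_on)
    show "bdd_above (sum (\<lambda>x. (norm (\<phi> x))\<^sup>2) ` {F. F \<subseteq> \<Gamma> \<and> finite F})"
    proof (rule bdd_aboveI2)
      fix F assume "F \<in> {F. F \<subseteq> \<Gamma> \<and> finite F}"
      then have "finite F" by simp
      have "(\<lambda>N. \<Sum>v\<in>F. (norm (\<psi> N v))\<^sup>2) \<longlonglongrightarrow> (\<Sum>v\<in>F. (norm (\<phi> v))\<^sup>2)"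
        by (intro tendsto_sum tendsto_power tendsto_norm lim)
      then show "(\<Sum>v\<in>F. (norm (\<phi> v))\<^sup>2) \<le> 1 / c\<^sup>2"
        by (rule LIMSEQ_le_const2) (use bound[OF \<open>finite F\<close>] in auto)
    qed
  qed auto
  ultimately have "l2_on \<Gamma> \<phi>" by (auto simp: l2_on_def)
  moreover have "hop_solves \<Gamma> D y \<phi>"
    unfolding hop_solves_def
  proof
    fix v assume v: "v \<in> \<Gamma>"
    have 1: "(\<lambda>N. hop_op \<Gamma> D (\<psi> N) v) \<longlonglongrightarrow> hop_op \<Gamma> D \<phi> v"
      unfolding hop_op_def by (intro tendsto_intros lim)
    have "eventually (\<lambda>N. hop_op \<Gamma> D (\<psi> N) v = (if v = y then 1 else 0)) sequentially"
      using eventually_gt_at_top[of "nat (norminf v)"]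
    proof eventually_elim
      case (elim N)
      then have "norminf v < int N" by linarith
      from eq[OF v this order_refl] show ?case .
    qed
    then have 2: "(\<lambda>N. hop_op \<Gamma> D (\<psi> N) v) \<longlonglongrightarrow> (if v = y then 1 else 0)"
      by (rule tendsto_eventually)
    show "hop_op \<Gamma> D \<phi> v = (if v = y then 1 else 0)" by (rule LIMSEQ_unique[OF 1 2])
  qed
  ultimately show ?thesis using lim by blast
qed

section \<open>The Green function of the random operator\<close>

definition green_diag :: "(int^'d \<Rightarrow> real) \<Rightarrow> real \<Rightarrow> (int^'d \<Rightarrow> real) \<Rightarrow> complex \<Rightarrow> int^'d \<Rightarrow> complex" where
  "green_diag u lam \<omega> z v = complex_of_real (lam * pot u \<omega> v) - z"

lemma Im_green_diag [simp]: "Im (green_diag u lam \<omega> z v) = - Im z"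
  by (simp add: green_diag_def)

lemma H_restr_eq_hop_op:
  "H_restr u lam \<omega> \<Gamma> \<psi> v - z * \<psi> v = hop_op \<Gamma> (green_diag u lam \<omega> z) \<psi> v"
  by (simp add: H_restr_def hop_op_def green_diag_def algebra_simps)

text \<open>As \<open>green\<close> is a definite description, its value is known only once a
  solution is exhibited; uniqueness then identifies it.\<close>

lemma green_eqI:
  assumes "l2_on \<Gamma> \<psi>" "hop_solves \<Gamma> (green_diag u lam \<omega> z) y \<psi>" "Im z \<noteq> 0"
  shows "green u lam \<omega> \<Gamma> z x y = \<psi> x"
proof -
  have "(THE \<psi>. l2_on \<Gamma> \<psi> \<and> hop_solves \<Gamma> (green_diag u lam \<omega> z) y \<psi>) = \<psi>"
    using assms by (intro the_equality) (auto intro!: hop_solves_unique[where c = "- Im z"])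
  then show ?thesis by (simp add: green_def H_restr_eq_hop_op hop_solves_def)
qed

lemma green_finite:
  assumes "finite \<Gamma>" "Im z \<noteq> 0"
  shows "l2_on \<Gamma> (\<lambda>x. green u lam \<omega> \<Gamma> z x y)"
    "hop_solves \<Gamma> (green_diag u lam \<omega> z) y (\<lambda>x. green u lam \<omega> \<Gamma> z x y)"
    "fdet \<Gamma> (hop_mat (green_diag u lam \<omega> z)) \<noteq> 0"
proof -
  have inj: "\<forall>v\<in>\<Gamma>. \<psi> v = 0"
    if "\<And>v. v \<in> \<Gamma> \<Longrightarrow> hop_op \<Gamma> (green_diag u lam \<omega> z) \<psi> v = 0" for \<psi>
    using hop_finite_injective[OF assms(1) _ _ that, of "- Im z"] assms(2) by auto
  show "fdet \<Gamma> (hop_mat (green_diag u lam \<omega> z)) \<noteq> 0"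
    by (rule hop_solves_finite_ex(1)[OF assms(1) inj])
  obtain \<psi> where \<psi>: "l2_on \<Gamma> \<psi>" "hop_solves \<Gamma> (green_diag u lam \<omega> z) y \<psi>"
    using hop_solves_finite_ex(2)[OF assms(1) inj] by blast
  have "(\<lambda>x. green u lam \<omega> \<Gamma> z x y) = \<psi>" using green_eqI[OF \<psi> assms(2)] by blast
  with \<psi> show "l2_on \<Gamma> (\<lambda>x. green u lam \<omega> \<Gamma> z x y)"
    "hop_solves \<Gamma> (green_diag u lam \<omega> z) y (\<lambda>x. green u lam \<omega> \<Gamma> z x y)" by simp_all
qed

text \<open>For infinite \<Gamma> the limit of the truncations is also what supplies the
  square-summable solution behind \<open>green\<close>.\<close>

lemma green_finite_volume_limit:
  assumes "Im z \<noteq> 0"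
  shows "(\<lambda>N. green u lam \<omega> (\<Gamma> \<inter> lattice_box N) z x y) \<longlonglongrightarrow> green u lam \<omega> \<Gamma> z x y"
proof -
  obtain \<phi> where \<phi>: "l2_on \<Gamma> \<phi>" "hop_solves \<Gamma> (green_diag u lam \<omega> z) y \<phi>"
    "\<forall>x. (\<lambda>N. green u lam \<omega> (\<Gamma> \<inter> lattice_box N) z x y) \<longlonglongrightarrow> \<phi> x"
    using hop_solves_limit[where D = "green_diag u lam \<omega> z" and c = "- Im z" and \<Gamma> = \<Gamma>
        and y = y and \<psi> = "\<lambda>N x. green u lam \<omega> (\<Gamma> \<inter> lattice_box N) z x y"]
      green_finite(1,2)[of "\<Gamma> \<inter> lattice_box _"] assms by auto
  then show ?thesis using green_eqI[OF \<phi>(1,2) assms] by simp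
qed

lemma green_eq_fdet:
  assumes "finite \<Gamma>" "Im z \<noteq> 0" "x \<in> \<Gamma>"
  shows "green u lam \<omega> \<Gamma> z x y =
    fdet \<Gamma> (\<lambda>v w. if w = x then (if v = y then 1 else 0) else hop_mat (green_diag u lam \<omega> z) v w)
      / fdet \<Gamma> (hop_mat (green_diag u lam \<omega> z))"
proof -
  have "green u lam \<omega> \<Gamma> z x y * fdet \<Gamma> (hop_mat (green_diag u lam \<omega> z)) =
      fdet \<Gamma> (\<lambda>v w. if w = x then (if v = y then 1 else 0) else hop_mat (green_diag u lam \<omega> z) v w)"
    using green_finite(2)[OF assms(1,2), of u lam \<omega> y]
    by (intro fdet_cramer assms) (simp add: hop_solves_def hop_op_eq_hop_mat[OF assms(1)])
  then show ?thesis using green_finite(3)[OF assms(1,2), of u lam \<omega>] by (simp add: field_simps)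
qed

text \<open>The geometric resolvent identity. The column of the smaller set, extended by zero,
  solves the equation on \<Gamma> up to errors on \<open>W\<close>, which columns of the full
  resolvent correct.\<close>

lemma green_cut:
  assumes fin: "finite \<Gamma>" and z: "Im z \<noteq> 0" and W: "W \<subseteq> \<Gamma>" "x \<in> W" "y \<in> \<Gamma> - W"
  shows "green u lam \<omega> \<Gamma> z x y = (\<Sum>w\<in>W. \<Sum>w'\<in>{w' \<in> \<Gamma> - W. norm1 (w - w') = 1}.
     green u lam \<omega> \<Gamma> z x w * green u lam \<omega> (\<Gamma> - W) z w' y)"
proof -
  let ?D = "green_diag u lam \<omega> z"
  let ?G = "\<lambda>y x. green u lam \<omega> \<Gamma> z x y"
  define \<phi> where "\<phi> x = green u lam \<omega> (\<Gamma> - W) z x y" for x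
  define b where "b w = (\<Sum>w'\<in>{w' \<in> \<Gamma> - W. norm1 (w - w') = 1}. \<phi> w')" for w
  \<comment> \<open>On \<open>W\<close>, where \<phi> vanishes, the operator applied to \<phi>
    leaves \<open>- b w\<close>; the sum removes exactly this. At \<open>x\<close> only the sum
    survives.\<close>
  define \<psi> where "\<psi> v = \<phi> v - (\<Sum>w\<in>W. - b w * ?G w v)" for v
  have fW: "finite W" using fin W finite_subset by blast
  have \<phi>: "l2_on (\<Gamma> - W) \<phi>" "hop_solves (\<Gamma> - W) ?D y \<phi>"
    using green_finite(1,2)[of "\<Gamma> - W" z u lam \<omega> y] fin z by (simp_all add: \<phi>_def[abs_def])
  have \<phi>0: "\<phi> v = 0" if "v \<notin> \<Gamma> - W" for v using \<phi>(1) that by (auto simp: l2_on_def)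
  have G: "l2_on \<Gamma> (?G w)" "hop_solves \<Gamma> ?D w (?G w)" for w
    using green_finite(1,2)[OF fin z] by auto
  have sum_eq: "(\<Sum>y\<in>{y \<in> \<Gamma>. norm1 (v - y) = 1}. \<phi> y)
      = (\<Sum>y\<in>{y \<in> \<Gamma> - W. norm1 (v - y) = 1}. \<phi> y)" for v
    using \<phi>0 by (intro sum.mono_neutral_right) auto
  have "l2_on \<Gamma> \<psi>"
  proof (rule l2_on_finite[OF fin])
    fix v assume "v \<notin> \<Gamma>"
    then show "\<psi> v = 0" using \<phi>0[of v] G(1) by (simp add: \<psi>_def l2_on_def)
  qed
  moreover have "hop_solves \<Gamma> ?D y \<psi>"
    unfolding hop_solves_def
  proof
    fix v assume v: "v \<in> \<Gamma>"
    have "hop_op \<Gamma> ?D \<psi> v = hop_op \<Gamma> ?D \<phi> v - (\<Sum>w\<in>W. - b w * hop_op \<Gamma> ?D (?G w) v)"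
      unfolding \<psi>_def[abs_def] by (subst hop_op_diff, subst hop_op_sum, subst hop_op_scale) simp
    also have "(\<Sum>w\<in>W. - b w * hop_op \<Gamma> ?D (?G w) v) = (\<Sum>w\<in>W. if v = w then - b w else 0)"
      using G(2) v by (intro sum.cong) (auto simp: hop_solves_def)
    also have "\<dots> = (if v \<in> W then - b v else 0)" using fW by simp
    also have "hop_op \<Gamma> ?D \<phi> v = (if v \<in> W then - b v else (if v = y then 1 else 0))"
    proof (cases "v \<in> W")
      case True
      then show ?thesis using \<phi>0[of v] by (simp add: hop_op_def sum_eq b_def)
    next
      case False
      then have "hop_op \<Gamma> ?D \<phi> v = hop_op (\<Gamma> - W) ?D \<phi> v" by (simp add: hop_op_def sum_eq)
      then show ?thesis using False v \<phi>(2) by (simp add: hop_solves_def)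
    qed
    finally show "hop_op \<Gamma> ?D \<psi> v = (if v = y then 1 else 0)" using W by auto
  qed
  ultimately have "?G y x = \<psi> x" using green_eqI z by blast
  also have "\<dots> = (\<Sum>w\<in>W. ?G w x * b w)"
    using \<phi>0[of x] W by (simp add: \<psi>_def sum_negf mult.commute)
  finally show ?thesis by (simp add: b_def sum_distrib_left \<phi>_def)
qed

subsection \<open>Fractional moments of rational functions\<close>

text \<open>Both sides have degree at most \<open>n\<close> and agree at \<open>n + 1\<close>
  distinct nodes.\<close>

lemma lagrange_interpolation:
  fixes p :: "'a::field poly"
  assumes deg: "degree p \<le> n" and inj: "inj_on \<zeta> {..n}"
  shows "poly p r = (\<Sum>j\<le>n. poly p (\<zeta> j) * (\<Prod>l\<in>{..n} - {j}. (r - \<zeta> l) / (\<zeta> j - \<zeta> l)))"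
proof -
  define L where "L j = Polynomial.smult (poly p (\<zeta> j) / (\<Prod>l\<in>{..n} - {j}. \<zeta> j - \<zeta> l))
      (\<Prod>l\<in>{..n} - {j}. [:- \<zeta> l, 1:])" for j
  have polyL: "poly (L j) x = poly p (\<zeta> j) * (\<Prod>l\<in>{..n} - {j}. (x - \<zeta> l) / (\<zeta> j - \<zeta> l))" for j x
    by (simp add: L_def poly_prod prod_dividef)
  have degL: "degree (L j) \<le> n" if "j \<le> n" for j
  proof -
    have "degree (L j) \<le> degree (\<Prod>l\<in>{..n} - {j}. [:- \<zeta> l, 1:])"
      unfolding L_def by (rule degree_smult_le)
    also have "\<dots> \<le> (\<Sum>l\<in>{..n} - {j}. degree [:- \<zeta> l, 1:])"
      using degree_prod_sum_le[of "{..n} - {j}" "\<lambda>l. [:- \<zeta> l, 1:]"] by (simp add: o_def)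
    also have "\<dots> = n" using that by simp
    finally show ?thesis .
  qed
  have "p = (\<Sum>j\<le>n. L j)"
  proof (rule poly_eqI_degree[where A = "\<zeta> ` {..n}"])
    have card: "card (\<zeta> ` {..n}) = Suc n" using inj by (simp add: card_image)
    show "degree p < card (\<zeta> ` {..n})" using deg card by simp
    have "degree (\<Sum>j\<le>n. L j) \<le> n" by (intro degree_sum_le) (auto simp: degL)
    then show "degree (\<Sum>j\<le>n. L j) < card (\<zeta> ` {..n})" using card by simp
    fix x assume "x \<in> \<zeta> ` {..n}"
    then obtain i where i: "i \<le> n" "x = \<zeta> i" by auto
    have "poly (\<Sum>j\<le>n. L j) x = (\<Sum>j\<le>n. if j = i then poly p (\<zeta> i) else 0)"
      unfolding poly_sum
    proof (intro sum.cong refl)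
      fix j assume j: "j \<in> {..n}"
      show "poly (L j) x = (if j = i then poly p (\<zeta> i) else 0)"
      proof (cases "j = i")
        case True
        have "(\<Prod>l\<in>{..n} - {i}. (\<zeta> i - \<zeta> l) / (\<zeta> i - \<zeta> l)) = 1"
          using inj i by (intro prod.neutral) (auto simp: inj_on_def)
        then show ?thesis using True i by (simp add: polyL)
      next
        case False
        have "(\<Prod>l\<in>{..n} - {j}. (x - \<zeta> l) / (\<zeta> j - \<zeta> l)) = 0"
          using i False by (intro prod_zero) auto
        then show ?thesis using False by (simp add: polyL)
      qed
    qed
    also have "\<dots> = poly p x" using i by simp
    finally show "poly p x = poly (\<Sum>j\<le>n. L j) x" by simp
  qed
  then show ?thesis by (metis (no_types, lifting) poly_sum polyL sum.cong)
qed

lemma norm_poly_le_interpolation: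
  fixes p :: "complex poly"
  assumes deg: "degree p \<le> n" and sep: "\<And>i j. i \<le> n \<Longrightarrow> j \<le> n \<Longrightarrow> i \<noteq> j \<Longrightarrow> 1 \<le> norm (\<zeta> i - \<zeta> j)"
    and D: "\<And>j. j \<le> n \<Longrightarrow> norm (r - \<zeta> j) \<le> D"
  shows "norm (poly p r) \<le> D ^ n * (\<Sum>j\<le>n. norm (poly p (\<zeta> j)))"
proof -
  have inj: "inj_on \<zeta> {..n}"
  proof (rule inj_onI)
    fix i j assume "i \<in> {..n}" "j \<in> {..n}" "\<zeta> i = \<zeta> j"
    then show "i = j" using sep[of i j] by (cases "i = j") auto
  qed
  have "norm (poly p r) \<le> (\<Sum>j\<le>n. norm (poly p (\<zeta> j)) * (\<Prod>l\<in>{..n} - {j}. norm (r - \<zeta> l) / norm (\<zeta> j - \<zeta> l)))"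
    unfolding lagrange_interpolation[OF deg inj, of r]
    by (rule order.trans[OF norm_sum]) (simp add: norm_mult norm_divide prod_norm[symmetric])
  also have "\<dots> \<le> (\<Sum>j\<le>n. norm (poly p (\<zeta> j)) * D ^ n)"
  proof (intro sum_mono mult_left_mono)
    fix j assume j: "j \<in> {..n}"
    have "(\<Prod>l\<in>{..n} - {j}. norm (r - \<zeta> l) / norm (\<zeta> j - \<zeta> l)) \<le> (\<Prod>l\<in>{..n} - {j}. D)"
    proof (intro prod_mono conjI)
      fix l assume l: "l \<in> {..n} - {j}"
      have "norm (r - \<zeta> l) / norm (\<zeta> j - \<zeta> l) \<le> norm (r - \<zeta> l) / 1"
        using sep[of j l] j l by (intro divide_left_mono) auto
      then show "norm (r - \<zeta> l) / norm (\<zeta> j - \<zeta> l) \<le> D" using D[of l] l by simp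
    qed simp
    also have "\<dots> = D ^ n" using j by simp
    finally show "(\<Prod>l\<in>{..n} - {j}. norm (r - \<zeta> l) / norm (\<zeta> j - \<zeta> l)) \<le> D ^ n" .
  qed simp
  finally show ?thesis by (simp add: sum_distrib_left mult.commute)
qed

text \<open>Factor by factor, |\<zeta> - a| \<le> |r - a| + D. The loss depends only on the
  distances from \<open>r\<close> to the roots, wherever the roots lie.\<close>

lemma norm_linear_factors_le:
  fixes A :: "complex multiset"
  assumes "norm (r - \<zeta>) \<le> D" "r \<notin># A"
  shows "norm (poly (\<Prod>x\<in>#A. [:-x, 1:]) \<zeta>)
    \<le> norm (poly (\<Prod>x\<in>#A. [:-x, 1:]) r) * (\<Prod>x\<in>#A. 1 + D / norm (r - x))"
  using assms(2)
proof (induction A)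
  case empty
  then show ?case by simp
next
  case (add a A)
  have pos: "norm (r - a) > 0" using add.prems by auto
  have "norm (\<zeta> - a) \<le> norm (r - a) + D"
    using norm_triangle_ineq4[of "r - a" "r - \<zeta>"] assms(1) by simp
  then have 1: "norm (\<zeta> - a) \<le> norm (r - a) * (1 + D / norm (r - a))"
    using pos by (simp add: distrib_left)
  have D0: "D \<ge> 0" using assms(1) norm_ge_zero order_trans by blast
  have 2: "norm (poly (\<Prod>x\<in>#A. [:-x, 1:]) \<zeta>)
    \<le> norm (poly (\<Prod>x\<in>#A. [:-x, 1:]) r) * (\<Prod>x\<in>#A. 1 + D / norm (r - x))"
    using add by auto
  have "norm (poly (\<Prod>x\<in>#add_mset a A. [:-x, 1:]) \<zeta>)
      = norm (\<zeta> - a) * norm (poly (\<Prod>x\<in>#A. [:-x, 1:]) \<zeta>)"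
    by (simp add: norm_mult[symmetric] algebra_simps)
  also have "\<dots> \<le> (norm (r - a) * (1 + D / norm (r - a))) *
      (norm (poly (\<Prod>x\<in>#A. [:-x, 1:]) r) * (\<Prod>x\<in>#A. 1 + D / norm (r - x)))"
    using 1 2 D0 by (intro mult_mono) auto
  also have "\<dots> = (norm (r - a) * norm (poly (\<Prod>x\<in>#A. [:-x, 1:]) r)) *
      ((1 + D / norm (r - a)) * (\<Prod>x\<in>#A. 1 + D / norm (r - x)))" by (simp add: mult_ac)
  also have "norm (r - a) * norm (poly (\<Prod>x\<in>#A. [:-x, 1:]) r)
      = norm (poly (\<Prod>x\<in>#add_mset a A. [:-x, 1:]) r)"
    by (simp add: norm_mult[symmetric] algebra_simps)
  finally show ?case by simp
qed

text \<open>The product is at most the n-th power of its largest factor, and n t \<le> 1/2 leaves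
  the square root of that factor. Bounding the maximum by a sum over the roots leaves one integrable
  singularity per root.\<close>

lemma linear_factors_powr_le:
  fixes A :: "complex multiset" and r :: real
  assumes size: "size A \<le> n" and t: "0 \<le> t" "real n * t \<le> 1 / 2" and D: "D \<ge> 0"
    and r: "r \<notin> Re ` set_mset A"
  shows "(\<Prod>x\<in>#A. 1 + D / norm (complex_of_real r - x)) powr t
    \<le> 1 + (\<Sum>a\<in>set_mset A. sqrt D * \<bar>r - Re a\<bar> powr (- 1 / 2))"
proof -
  define h where "h x = 1 + D / norm (complex_of_real r - x)" for x
  have h1: "h x \<ge> 1" for x using D by (simp add: h_def)
  \<comment> \<open>\<open>b\<close> is the largest factor, or 1 when there are no roots.\<close>
  have "\<exists>b. (b = 1 \<or> b \<in> h ` set_mset A) \<and> 1 \<le> b \<and> (\<Prod>x\<in>#A. h x) \<le> b ^ size A"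
  proof (cases "A = {#}")
    case False
    define b where "b = Max (h ` set_mset A)"
    have bin: "b \<in> h ` set_mset A" unfolding b_def using False by (intro Max_in) auto
    have le: "h x \<le> b" if "x \<in># A" for x unfolding b_def using that by (intro Max_ge) auto
    have b1: "1 \<le> b" using bin h1 by auto
    have "(\<Prod>x\<in>#B. h x) \<le> b ^ size B" if "B \<subseteq># A" for B
      using that
    proof (induction B)
      case (add x B)
      then have "x \<in># A" by (meson mset_subset_eqD union_single_eq_member)
      moreover have "(\<Prod>x\<in>#B. h x) \<le> b ^ size B"
        using add by (meson mset_subset_eq_insertD subset_mset.less_imp_le)
      moreover have "(\<Prod>x\<in>#B. h x) \<ge> 0"
        by (induction B) (use h1 in \<open>auto intro!: mult_nonneg_nonneg order_trans[OF zero_le_one h1]\<close>)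
      ultimately show ?case using le[of x] h1[of x] b1 by (auto intro!: mult_mono)
    qed simp
    then show ?thesis using bin b1 by blast
  qed auto
  then obtain b where b: "b = 1 \<or> b \<in> h ` set_mset A" "1 \<le> b" "(\<Prod>x\<in>#A. h x) \<le> b ^ size A" by blast
  have prod0: "(\<Prod>x\<in>#A. h x) \<ge> 0"
    by (induction A) (use h1 in \<open>auto intro!: mult_nonneg_nonneg order_trans[OF zero_le_one h1]\<close>)
  have "(\<Prod>x\<in>#A. h x) \<le> b ^ n"
    using b(3) power_increasing[OF size b(2)] by linarith
  then have "(\<Prod>x\<in>#A. h x) powr t \<le> (b ^ n) powr t" using t prod0 by (intro powr_mono2) auto
  also have "\<dots> = b powr (real n * t)" using b(2) by (simp add: powr_powr flip: powr_realpow)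
  also have "\<dots> \<le> b powr (1 / 2)" using b(2) t by (intro powr_mono) auto
  also have "\<dots> = sqrt b" using b(2) by (simp add: powr_half_sqrt)
  also have "\<dots> \<le> 1 + (\<Sum>a\<in>set_mset A. sqrt D * \<bar>r - Re a\<bar> powr (- 1 / 2))"
    using b(1)
  proof
    assume "b = 1" then show ?thesis using D by (simp add: sum_nonneg)
  next
    assume "b \<in> h ` set_mset A"
    then obtain a where a: "a \<in># A" "b = h a" by auto
    have pos: "\<bar>r - Re a\<bar> > 0" using r a by auto
    \<comment> \<open>Projecting the root to the real axis only decreases the distance, and the
      integral bound becomes uniform in the root.\<close>
    have le: "\<bar>r - Re a\<bar> \<le> norm (complex_of_real r - a)"
      using abs_Re_le_cmod[of "complex_of_real r - a"] by simp
    then have "b \<le> 1 + D / \<bar>r - Re a\<bar>"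
      unfolding a h_def using pos D le
      by (intro add_left_mono divide_left_mono mult_pos_pos order_less_le_trans[OF pos le]) auto
    then have "sqrt b \<le> sqrt (1 + D / \<bar>r - Re a\<bar>)" by simp
    also have "\<dots> \<le> sqrt 1 + sqrt (D / \<bar>r - Re a\<bar>)" using D by (intro sqrt_add_le_add_sqrt) auto
    also have "\<dots> = 1 + sqrt D * \<bar>r - Re a\<bar> powr (- 1 / 2)"
      using pos by (simp add: real_sqrt_divide powr_minus powr_half_sqrt field_simps)
    also have "\<dots> \<le> 1 + (\<Sum>a\<in>set_mset A. sqrt D * \<bar>r - Re a\<bar> powr (- 1 / 2))"
      using a(1) D by (intro add_left_mono member_le_sum) auto
    finally show ?thesis .
  qed
  finally show ?thesis by (simp add: h_def)
qed

lemma nn_integral_inv_sqrt_unit: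
  "(\<integral>\<^sup>+ x. ennreal (indicator {0..1} x * x powr (- 1 / 2)) \<partial>lborel) = 2"
proof -
  have "((\<lambda>x::real. x powr (- 1 / 2)) has_integral 2) {0..1}"
    using has_integral_powr_from_0[of "- 1 / 2" 1] by simp
  then have "((\<lambda>x::real. indicator {0..1} x * x powr (- 1 / 2)) has_integral 2) UNIV"
    by (subst (asm) has_integral_restrict_UNIV[symmetric])
      (rule has_integral_eq[rotated], assumption, simp add: indicator_def)
  from nn_integral_has_integral_lborel[OF _ _ this] show ?thesis by simp
qed

text \<open>At distance more than 1 from \<open>a\<close> the integrand is at most 1, and the total
  mass gives the summand 1. Nearby, the density is at most \<open>C\<close> and each of the two
  sides contributes the integral 2.\<close>

lemma nn_integral_inv_sqrt_density:
  assumes meas: "\<rho> \<in> borel_measurable borel" and nonneg: "\<And>t. \<rho> t \<ge> 0"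
    and mass: "(\<integral>\<^sup>+ t. ennreal (\<rho> t) \<partial>lborel) = 1" and bdd: "\<And>t. \<rho> t \<le> C"
  shows "(\<integral>\<^sup>+ r. ennreal (\<bar>r - a\<bar> powr (- 1 / 2)) \<partial>density lborel (\<lambda>t. ennreal (\<rho> t))) \<le> ennreal (1 + 4 * C)"
proof -
  define f where "f x = ennreal (indicator {0..1} x * x powr (- 1 / 2))" for x :: real
  have f_meas [measurable]: "f \<in> borel_measurable borel" unfolding f_def by measurable
  have C: "C \<ge> 0" using nonneg[of 0] bdd[of 0] by linarith
  have int_f: "integral\<^sup>N lborel f = 2"
    using nn_integral_inv_sqrt_unit by (simp only: f_def[abs_def])
  have shift1: "(\<integral>\<^sup>+ r. f (r - a) \<partial>lborel) = 2"
    using nn_integral_real_affine[of f 1 "- a"] int_f by simp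
  have shift2: "(\<integral>\<^sup>+ r. f (a - r) \<partial>lborel) = 2"
    using nn_integral_real_affine[of f "-1" a] int_f by simp
  have le: "ennreal (\<bar>r - a\<bar> powr (- 1 / 2)) \<le> 1 + (f (r - a) + f (a - r))" for r
  proof (cases "\<bar>r - a\<bar> \<le> 1")
    case True
    show ?thesis
    proof (cases "r \<ge> a")
      case True
      then have "ennreal (\<bar>r - a\<bar> powr (- 1 / 2)) = f (r - a)"
        using \<open>\<bar>r - a\<bar> \<le> 1\<close> by (simp add: f_def)
      then show ?thesis by (metis add.commute le_iff_add add.assoc)
    next
      case False
      then have "ennreal (\<bar>r - a\<bar> powr (- 1 / 2)) = f (a - r)"
        using \<open>\<bar>r - a\<bar> \<le> 1\<close> by (simp add: f_def)
      then show ?thesis by (metis add.commute le_iff_add add.assoc)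
    qed
  next
    case False
    then have "\<bar>r - a\<bar> powr (- 1 / 2) \<le> 1 powr (- 1 / 2)" by (intro powr_mono2') auto
    then have "ennreal (\<bar>r - a\<bar> powr (- 1 / 2)) \<le> 1" by simp
    then show ?thesis by (meson le_iff_add order_trans)
  qed
  have "(\<integral>\<^sup>+ r. ennreal (\<bar>r - a\<bar> powr (- 1 / 2)) \<partial>density lborel (\<lambda>t. ennreal (\<rho> t)))
      = (\<integral>\<^sup>+ r. ennreal (\<rho> r) * ennreal (\<bar>r - a\<bar> powr (- 1 / 2)) \<partial>lborel)"
    using meas by (intro nn_integral_density) auto
  also have "\<dots> \<le> (\<integral>\<^sup>+ r. ennreal (\<rho> r) + ennreal C * (f (r - a) + f (a - r)) \<partial>lborel)"
  proof (intro nn_integral_mono)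
    fix r :: real
    have "ennreal (\<rho> r) * ennreal (\<bar>r - a\<bar> powr (- 1 / 2))
        \<le> ennreal (\<rho> r) * (1 + (f (r - a) + f (a - r)))" by (intro mult_left_mono le) auto
    also have "\<dots> = ennreal (\<rho> r) + ennreal (\<rho> r) * (f (r - a) + f (a - r))"
      by (simp add: distrib_left)
    also have "\<dots> \<le> ennreal (\<rho> r) + ennreal C * (f (r - a) + f (a - r))"
      using bdd by (intro add_left_mono mult_right_mono ennreal_leI) auto
    finally show "ennreal (\<rho> r) * ennreal (\<bar>r - a\<bar> powr (- 1 / 2))
        \<le> ennreal (\<rho> r) + ennreal C * (f (r - a) + f (a - r))" .
  qed
  also have "\<dots> = 1 + ennreal C * (2 + 2)"
    using meas by (simp add: nn_integral_add nn_integral_cmult mass shift1 shift2)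
  also have "\<dots> = ennreal (1 + 4 * C)"
    using C by (simp add: ennreal_plus ennreal_mult' mult.commute)
  finally show ?thesis .
qed

text \<open>A rational function of degree at most \<open>n\<close> that is bounded by \<open>B\<close> at \<open>n + 1\<close> separated
  complex points has fractional moments of order \<open>B powr t\<close> on the real line: interpolation
  bounds the numerator by the values of the denominator at these points, and the quotient of
  two values of the denominator is a product over its roots.\<close>

lemma rational_fractional_moment:
  fixes p q :: "complex poly" and f :: "real \<Rightarrow> complex"
  assumes meas: "\<rho> \<in> borel_measurable borel" and nonneg: "\<And>t. \<rho> t \<ge> 0"
    and mass: "(\<integral>\<^sup>+ t. ennreal (\<rho> t) \<partial>lborel) = 1" and bdd: "\<And>t. \<rho> t \<le> C"
    and cpt: "\<And>t. \<bar>t\<bar> > R \<Longrightarrow> \<rho> t = 0"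
    and deg: "degree p \<le> n" "degree q \<le> n" and q0: "q \<noteq> 0"
    and sep: "\<And>i j. i \<le> n \<Longrightarrow> j \<le> n \<Longrightarrow> i \<noteq> j \<Longrightarrow> 1 \<le> norm (\<zeta> i - \<zeta> j)"
    and D: "\<And>j r. j \<le> n \<Longrightarrow> \<bar>r\<bar> \<le> R \<Longrightarrow> norm (complex_of_real r - \<zeta> j) \<le> D" "D \<ge> 0"
    and B: "\<And>j. j \<le> n \<Longrightarrow> norm (poly p (\<zeta> j)) \<le> B * norm (poly q (\<zeta> j))" "B \<ge> 0"
    and f: "\<And>r. \<bar>r\<bar> \<le> R \<Longrightarrow> f r * poly q (complex_of_real r) = poly p (complex_of_real r)"
    and t: "0 \<le> t" "real n * t \<le> 1 / 2"
  shows "(\<integral>\<^sup>+ r. ennreal (norm (f r) powr t) \<partial>density lborel (\<lambda>t. ennreal (\<rho> t)))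
     \<le> ennreal ((D ^ n * real (Suc n) * B) powr t * (1 + real n * sqrt D * (1 + 4 * C)))"
proof -
  let ?M = "density lborel (\<lambda>t. ennreal (\<rho> t))"
  have C: "C \<ge> 0" using nonneg[of 0] bdd[of 0] by linarith
  obtain A where A: "size A = degree q" "q = Polynomial.smult (lead_coeff q) (\<Prod>x\<in>#A. [:-x, 1:])"
    using alg_closed_imp_factorization[OF q0] by blast
  define Q where "Q = (\<Prod>x\<in>#A. [:-x, 1:])"
  have q_eq: "poly q x = lead_coeff q * poly Q x" for x using A(2) unfolding Q_def by (metis poly_smult)
  have lc: "lead_coeff q \<noteq> 0" using q0 by simp
  define c where "c = D ^ n * real (Suc n) * B"
  have c0: "c \<ge> 0" using D(2) B(2) by (simp add: c_def)
  have pointwise: "norm (f r) powr t \<le> c powr t * (1 + (\<Sum>a\<in>set_mset A. sqrt D * \<bar>r - Re a\<bar> powr (- 1 / 2)))"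
    if r: "\<bar>r\<bar> \<le> R" "r \<notin> Re ` set_mset A" for r
  proof -
    have rA: "complex_of_real r \<notin># A" using r(2) by (metis Re_complex_of_real image_eqI)
    \<comment> \<open>\<open>P\<close> bounds the growth of \<open>q\<close> from \<open>r\<close>
      to any of the nodes; the leading coefficient occurs on both sides and drops out.\<close>
    define P where "P = (\<Prod>x\<in>#A. 1 + D / norm (complex_of_real r - x))"
    have P1: "P \<ge> 0"
      unfolding P_def by (induction A) (use D(2) in auto)
    have "poly Q (complex_of_real r) \<noteq> 0"
      using rA unfolding Q_def by (induction A) auto
    then have qr: "norm (poly q (complex_of_real r)) > 0" using q_eq lc by auto
    have "norm (poly p (complex_of_real r)) \<le> D ^ n * (\<Sum>j\<le>n. norm (poly p (\<zeta> j)))"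
      using D(1) r(1) by (intro norm_poly_le_interpolation deg sep) auto
    also have "\<dots> \<le> D ^ n * (\<Sum>j\<le>n. B * (norm (poly q (complex_of_real r)) * P))"
    proof (intro mult_left_mono sum_mono)
      fix j assume "j \<in> {..n}"
      then have j: "j \<le> n" by simp
      have "norm (poly Q (\<zeta> j)) \<le> norm (poly Q (complex_of_real r)) * P"
        unfolding Q_def P_def using D(1)[OF j r(1)] rA by (rule norm_linear_factors_le)
      then have "norm (lead_coeff q) * norm (poly Q (\<zeta> j))
          \<le> norm (lead_coeff q) * (norm (poly Q (complex_of_real r)) * P)"
        by (intro mult_left_mono) auto
      then have "norm (poly q (\<zeta> j)) \<le> norm (poly q (complex_of_real r)) * P"
        by (simp add: q_eq norm_mult mult.assoc)
      then have "B * norm (poly q (\<zeta> j)) \<le> B * (norm (poly q (complex_of_real r)) * P)"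
        using B(2) by (intro mult_left_mono) auto
      then show "norm (poly p (\<zeta> j)) \<le> B * (norm (poly q (complex_of_real r)) * P)"
        using B(1)[OF j] by linarith
    qed (use D(2) in auto)
    also have "\<dots> = c * P * norm (poly q (complex_of_real r))"
      by (simp add: c_def mult_ac)
    finally have "norm (f r) * norm (poly q (complex_of_real r)) \<le> c * P * norm (poly q (complex_of_real r))"
      using f[OF r(1)] by (metis norm_mult)
    then have "norm (f r) \<le> c * P" using qr by simp
    then have "norm (f r) powr t \<le> (c * P) powr t" using t by (intro powr_mono2) auto
    also have "\<dots> = c powr t * P powr t" using c0 P1 by (simp add: powr_mult)
    also have "\<dots> \<le> c powr t * (1 + (\<Sum>a\<in>set_mset A. sqrt D * \<bar>r - Re a\<bar> powr (- 1 / 2)))"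
      unfolding P_def using A(1) deg(2) t D(2) r(2)
      by (intro mult_left_mono linear_factors_powr_le[of A n]) auto
    finally show ?thesis .
  qed
  \<comment> \<open>The excluded points are finitely many and contain all real zeros of
    \<open>q\<close>, where the equation for \<open>f\<close> gives no information.\<close>
  have "AE r in lborel. r \<notin> Re ` set_mset A"
    by (rule AE_not_in) (intro finite_imp_null_set_lborel finite_imageI finite_set_mset)
  then have ae: "AE r in ?M. norm (f r) powr t \<le> c powr t * (1 + (\<Sum>a\<in>set_mset A. sqrt D * \<bar>r - Re a\<bar> powr (- 1 / 2)))"
    using meas
  proof (subst AE_density, measurable, elim AE_mp, intro AE_I2 impI)
    fix r assume "r \<notin> Re ` set_mset A" "0 < ennreal (\<rho> r)"
    moreover from this have "\<bar>r\<bar> \<le> R" using cpt[of r] by (cases "\<bar>r\<bar> > R") auto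
    ultimately show "norm (f r) powr t \<le> c powr t * (1 + (\<Sum>a\<in>set_mset A. sqrt D * \<bar>r - Re a\<bar> powr (- 1 / 2)))"
      using pointwise by blast
  qed
  have prob: "emeasure ?M UNIV = 1"
    using meas mass by (subst emeasure_density) auto
  have "(\<integral>\<^sup>+ r. ennreal (norm (f r) powr t) \<partial>?M)
      \<le> (\<integral>\<^sup>+ r. ennreal (c powr t) * (1 + (\<Sum>a\<in>set_mset A. ennreal (sqrt D) * ennreal (\<bar>r - Re a\<bar> powr (- 1 / 2)))) \<partial>?M)"
  proof (intro nn_integral_mono_AE)
    show "AE r in ?M. ennreal (norm (f r) powr t) \<le> ennreal (c powr t) *
        (1 + (\<Sum>a\<in>set_mset A. ennreal (sqrt D) * ennreal (\<bar>r - Re a\<bar> powr (- 1 / 2))))"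
      using ae
    proof eventually_elim
      case (elim r)
      let ?g = "\<lambda>a. \<bar>r - Re a\<bar> powr (- 1 / 2)"
      have "(\<Sum>a\<in>set_mset A. ennreal (sqrt D) * ennreal (?g a)) = ennreal (\<Sum>a\<in>set_mset A. sqrt D * ?g a)"
        using D(2) by (subst sum_ennreal[symmetric]) (auto simp: ennreal_mult)
      moreover have "1 + ennreal (\<Sum>a\<in>set_mset A. sqrt D * ?g a) = ennreal (1 + (\<Sum>a\<in>set_mset A. sqrt D * ?g a))"
        using D(2) by (subst ennreal_plus) (auto intro!: sum_nonneg)
      ultimately have "ennreal (c powr t) * (1 + (\<Sum>a\<in>set_mset A. ennreal (sqrt D) * ennreal (?g a)))
          = ennreal (c powr t * (1 + (\<Sum>a\<in>set_mset A. sqrt D * ?g a)))"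
        by (simp only: ennreal_mult'[OF powr_ge_zero])
      then show ?case using elim by (simp add: ennreal_leI)
    qed
  qed
  also have "\<dots> = ennreal (c powr t) * (1 + (\<Sum>a\<in>set_mset A. ennreal (sqrt D) *
      (\<integral>\<^sup>+ r. ennreal (\<bar>r - Re a\<bar> powr (- 1 / 2)) \<partial>?M)))"
    by (simp add: nn_integral_cmult nn_integral_add nn_integral_sum prob)
  also have "\<dots> \<le> ennreal (c powr t) * (1 + (\<Sum>a\<in>set_mset A. ennreal (sqrt D) * ennreal (1 + 4 * C)))"
    by (intro mult_left_mono add_left_mono sum_mono nn_integral_inv_sqrt_density meas nonneg mass bdd) auto
  also have "\<dots> = ennreal (c powr t * (1 + real (card (set_mset A)) * (sqrt D * (1 + 4 * C))))"
  proof -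
    have "(\<Sum>a\<in>set_mset A. ennreal (sqrt D) * ennreal (1 + 4 * C))
        = ennreal (real (card (set_mset A)) * (sqrt D * (1 + 4 * C)))"
      using C D(2) by (simp add: ennreal_mult ennreal_of_nat_eq_real_of_nat)
    moreover have "1 + ennreal (real (card (set_mset A)) * (sqrt D * (1 + 4 * C)))
        = ennreal (1 + real (card (set_mset A)) * (sqrt D * (1 + 4 * C)))"
      using C D(2) by (subst ennreal_plus) auto
    ultimately show ?thesis by (simp only: ennreal_mult'[OF powr_ge_zero])
  qed
  also have "\<dots> \<le> ennreal (c powr t * (1 + real n * (sqrt D * (1 + 4 * C))))"
  proof (intro ennreal_leI mult_left_mono add_left_mono mult_right_mono)
    have "card (set_mset A) \<le> size A"
      by (induction A) (auto intro: order_trans[OF card_insert_le_m1] simp: card_insert_if)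
    then show "real (card (set_mset A)) \<le> real n" using A(1) deg(2) by simp
  qed (use C D(2) in auto)
  finally show ?thesis by (simp add: c_def mult.assoc)
qed

subsection \<open>The one-block estimate\<close>

text \<open>On the sign-definite part \<open>\<Lambda> - I\<close> of the block the imaginary part of the diagonal controls
  \<open>\<psi>\<close> through the energy identity, no matter how \<open>\<Lambda>\<close> couples to the rest of \<open>\<Gamma>\<close>; the
  remaining sites \<open>I\<close> only couple to \<open>\<Lambda>\<close>, where the diagonal dominates the hopping.\<close>

lemma hop_block_bound:
  fixes \<Gamma> :: "(int^'d) set"
  defines "d \<equiv> real CARD('d)"
  assumes fin: "finite \<Gamma>" and L: "\<Lambda> \<subseteq> \<Gamma>" "w \<in> \<Lambda>" "card \<Lambda> \<le> n" and I: "I \<subseteq> \<Lambda>"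
    and lam: "lam \<ge> 1" and \<sigma>: "\<bar>\<sigma>\<bar> = 1" and \<tau>: "\<tau> > 0" and b: "b > 0" "b' \<ge> 0" and a: "a > 0"
    and Im_out: "\<And>v. v \<in> \<Gamma> - \<Lambda> \<Longrightarrow> \<sigma> * Im (D v) \<le> 0"
    and Im_in: "\<And>v. v \<in> \<Lambda> \<Longrightarrow> \<sigma> * Im (D v) \<le> - (lam * \<tau> * U v)"
    and U_bd: "\<And>v. v \<in> \<Lambda> - I \<Longrightarrow> b \<le> U v" and U_int: "\<And>v. v \<in> I \<Longrightarrow> - b' \<le> U v"
    and I_nbr: "\<And>v y. v \<in> I \<Longrightarrow> y \<in> \<Gamma> \<Longrightarrow> norm1 (v - y) = 1 \<Longrightarrow> y \<in> \<Lambda>"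
    and I_D: "\<And>v. v \<in> I \<Longrightarrow> lam * a \<le> norm (D v)"
    and par: "4 * d \<le> a" "16 * d\<^sup>2 * real n * b' \<le> a\<^sup>2 * b" "4 \<le> \<tau> * b"
    and sol: "\<And>v. v \<in> \<Gamma> \<Longrightarrow> hop_op \<Gamma> D \<psi> v = (if v = w then g else 0)" and g: "norm g \<le> 1"
  shows "\<forall>v\<in>\<Lambda>. norm (\<psi> v) \<le> 2 / lam"
proof -
  have finL: "finite \<Lambda>" using L fin finite_subset by blast
  have d1: "d \<ge> 1" unfolding d_def by simp
  define m where "m = Max ((\<lambda>v. norm (\<psi> v)) ` \<Lambda>)"
  have m_ge: "norm (\<psi> v) \<le> m" if "v \<in> \<Lambda>" for v
    unfolding m_def using finL that by (intro Max_ge) auto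
  have "m \<in> (\<lambda>v. norm (\<psi> v)) ` \<Lambda>" unfolding m_def using finL L by (intro Max_in) auto
  then obtain v0 where v0: "v0 \<in> \<Lambda>" "m = norm (\<psi> v0)" by auto
  have m0: "m \<ge> 0" using v0 by simp
  \<comment> \<open>Rescaling removes \<open>lam\<close>: the claim becomes \<mu> \<le> 2, and
    \<open>lam\<close> \<ge> 1 gives \<open>m\<close> \<le> \<mu>.\<close>
  define \<mu> where "\<mu> = lam * m"
  have \<mu>0: "\<mu> \<ge> 0" "m \<le> \<mu>" using m0 lam mult_right_mono[of 1 lam m] by (auto simp: \<mu>_def)
  \<comment> \<open>The equation at an interior site: all its neighbours lie in the block, so the
    maximum \<open>m\<close> over the block bounds them.\<close>
  have X: "lam * norm (\<psi> i) * a \<le> 1 + 2 * d * \<mu>" if i: "i \<in> I" for i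
  proof -
    have i\<Gamma>: "i \<in> \<Gamma>" using i I L by auto
    have eq: "D i * \<psi> i = (if i = w then g else 0) + (\<Sum>y\<in>{y \<in> \<Gamma>. norm1 (i - y) = 1}. \<psi> y)"
      using sol[OF i\<Gamma>] unfolding hop_op_def by (simp add: algebra_simps)
    have "norm (D i) * norm (\<psi> i) = norm (D i * \<psi> i)" by (simp only: norm_mult)
    also have "\<dots> \<le> norm (if i = w then g else 0) + norm (\<Sum>y\<in>{y \<in> \<Gamma>. norm1 (i - y) = 1}. \<psi> y)"
      unfolding eq by (rule norm_triangle_ineq)
    also have "\<dots> \<le> 1 + (\<Sum>y\<in>{y \<in> \<Gamma>. norm1 (i - y) = 1}. m)"
      using g m_ge I_nbr[OF i] by (intro add_mono order_trans[OF norm_sum] sum_mono) auto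
    also have "\<dots> \<le> 1 + 2 * d * m"
      using card_nbrs_in_le[of \<Gamma> i] m0 unfolding d_def by (auto intro!: mult_right_mono)
    also have "\<dots> \<le> 1 + 2 * d * \<mu>" using \<mu>0 d1 by (auto intro!: mult_left_mono)
    finally have "norm (D i) * norm (\<psi> i) \<le> 1 + 2 * d * \<mu>" .
    moreover have "lam * a * norm (\<psi> i) \<le> norm (D i) * norm (\<psi> i)"
      using I_D[OF i] by (intro mult_right_mono) auto
    ultimately show ?thesis by (simp add: mult_ac)
  qed
  \<comment> \<open>The sites outside the block enter with the favourable sign and are dropped; this
    makes the bound independent of the surroundings.\<close>
  have energy: "lam * \<tau> * (\<Sum>v\<in>\<Lambda>. U v * (norm (\<psi> v))\<^sup>2) \<le> m"
  proof -
    have "(\<Sum>v\<in>\<Gamma>. cnj (\<psi> v) * hop_op \<Gamma> D \<psi> v) = (\<Sum>v\<in>\<Gamma>. if v = w then cnj (\<psi> v) * g else 0)"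
      using sol by (intro sum.cong) auto
    also have "\<dots> = cnj (\<psi> w) * g" using L fin by auto
    finally have E: "Im (cnj (\<psi> w) * g) = (\<Sum>v\<in>\<Gamma>. Im (D v) * (norm (\<psi> v))\<^sup>2)"
      using Im_hop_energy_full[OF fin, of \<psi> D] by simp
    have "\<bar>\<sigma> * Im (cnj (\<psi> w) * g)\<bar> \<le> norm (cnj (\<psi> w) * g)"
      using abs_Im_le_cmod[of "cnj (\<psi> w) * g"] \<sigma> by (simp add: abs_mult)
    also have "\<dots> \<le> m * 1"
      unfolding norm_mult using m_ge[OF L(2)] g m0 by (intro mult_mono) auto
    finally have "- m \<le> \<sigma> * Im (cnj (\<psi> w) * g)" by linarith
    also have "\<dots> = (\<Sum>v\<in>\<Gamma>. (\<sigma> * Im (D v)) * (norm (\<psi> v))\<^sup>2)"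
      unfolding E by (simp add: sum_distrib_left mult.assoc)
    also have "\<dots> = (\<Sum>v\<in>\<Gamma> - \<Lambda>. (\<sigma> * Im (D v)) * (norm (\<psi> v))\<^sup>2)
        + (\<Sum>v\<in>\<Lambda>. (\<sigma> * Im (D v)) * (norm (\<psi> v))\<^sup>2)"
      using L fin by (intro sum.subset_diff)
    also have "\<dots> \<le> 0 + (\<Sum>v\<in>\<Lambda>. - (lam * \<tau> * U v) * (norm (\<psi> v))\<^sup>2)"
      by (intro add_mono sum_nonpos sum_mono mult_right_mono mult_nonpos_nonneg[OF Im_out] Im_in) auto
    also have "\<dots> = - (lam * \<tau> * (\<Sum>v\<in>\<Lambda>. U v * (norm (\<psi> v))\<^sup>2))"
      by (simp add: sum_distrib_left sum_negf mult.assoc)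
    finally show ?thesis by simp
  qed
  \<comment> \<open>Cases on the site of the maximum. If it is in \<open>I\<close>, then
    \<open>X\<close> and 4 d \<le> a suffice. Otherwise the energy bound applies, with the sites of
    \<open>I\<close>, where \<open>U\<close> may be negative, estimated by \<open>X\<close>.\<close>
  have "\<mu> \<le> 2"
  proof (cases "v0 \<in> I")
    case True
    from X[OF True] have "\<mu> * a \<le> 1 + 2 * d * \<mu>" by (simp add: \<mu>_def v0)
    moreover have "\<mu> * (4 * d) \<le> \<mu> * a" using par(1) \<mu>0 by (intro mult_left_mono) auto
    ultimately have "2 * (d * \<mu>) \<le> 1" by (simp add: mult_ac)
    moreover have "1 * \<mu> \<le> d * \<mu>" using d1 \<mu>0 by (intro mult_right_mono) auto
    ultimately show ?thesis by linarith
  next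
    case False
    have "b * (norm (\<psi> v0))\<^sup>2 \<le> (\<Sum>v\<in>\<Lambda> - I. U v * (norm (\<psi> v))\<^sup>2)"
    proof -
      have "b * (norm (\<psi> v0))\<^sup>2 \<le> U v0 * (norm (\<psi> v0))\<^sup>2"
        using U_bd v0 False by (intro mult_right_mono) auto
      also have "\<dots> \<le> (\<Sum>v\<in>\<Lambda> - I. U v * (norm (\<psi> v))\<^sup>2)"
      proof (rule member_le_sum)
        fix v assume "v \<in> \<Lambda> - I - {v0}"
        then have "0 \<le> U v" using U_bd[of v] b by auto
        then show "0 \<le> U v * (norm (\<psi> v))\<^sup>2" by simp
      qed (use v0 False finL in auto)
      finally show ?thesis .
    qed
    also have "\<dots> = (\<Sum>v\<in>\<Lambda>. U v * (norm (\<psi> v))\<^sup>2) - (\<Sum>v\<in>I. U v * (norm (\<psi> v))\<^sup>2)"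
      using finL I by (simp add: sum_diff)
    also have "(\<Sum>v\<in>\<Lambda>. U v * (norm (\<psi> v))\<^sup>2) \<le> m / (lam * \<tau>)"
      using energy lam \<tau> by (simp add: field_simps)
    also have "m / (lam * \<tau>) - (\<Sum>v\<in>I. U v * (norm (\<psi> v))\<^sup>2)
        \<le> m / (lam * \<tau>) + (\<Sum>v\<in>I. b' * ((1 + 2 * d * \<mu>) / (lam * a))\<^sup>2)"
    proof -
      have "(\<Sum>v\<in>I. - (U v * (norm (\<psi> v))\<^sup>2)) \<le> (\<Sum>v\<in>I. b' * ((1 + 2 * d * \<mu>) / (lam * a))\<^sup>2)"
      proof (intro sum_mono)
        fix v assume v: "v \<in> I"
        have "norm (\<psi> v) \<le> (1 + 2 * d * \<mu>) / (lam * a)"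
          using X[OF v] lam a by (simp add: field_simps)
        then have "(norm (\<psi> v))\<^sup>2 \<le> ((1 + 2 * d * \<mu>) / (lam * a))\<^sup>2" by (intro power_mono) auto
        then have "b' * (norm (\<psi> v))\<^sup>2 \<le> b' * ((1 + 2 * d * \<mu>) / (lam * a))\<^sup>2"
          using b by (intro mult_left_mono) auto
        moreover have "(- U v) * (norm (\<psi> v))\<^sup>2 \<le> b' * (norm (\<psi> v))\<^sup>2"
          using U_int[OF v] by (intro mult_right_mono) auto
        ultimately show "- (U v * (norm (\<psi> v))\<^sup>2) \<le> b' * ((1 + 2 * d * \<mu>) / (lam * a))\<^sup>2" by simp
      qed
      then show ?thesis by (simp add: sum_negf)
    qed
    also have "(\<Sum>v\<in>I. b' * ((1 + 2 * d * \<mu>) / (lam * a))\<^sup>2)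
        \<le> real n * b' * ((1 + 2 * d * \<mu>) / (lam * a))\<^sup>2"
    proof -
      have "card I \<le> n" using card_mono[OF finL I] L by simp
      then have "real (card I) * (b' * ((1 + 2 * d * \<mu>) / (lam * a))\<^sup>2)
          \<le> real n * (b' * ((1 + 2 * d * \<mu>) / (lam * a))\<^sup>2)"
        using b by (intro mult_right_mono) auto
      then show ?thesis by (simp add: mult.assoc)
    qed
    finally have "b * m\<^sup>2 \<le> m / (lam * \<tau>) + real n * b' * ((1 + 2 * d * \<mu>) / (lam * a))\<^sup>2"
      using v0 by simp
    then have "lam\<^sup>2 * (b * m\<^sup>2) \<le> lam\<^sup>2 * (m / (lam * \<tau>) + real n * b' * ((1 + 2 * d * \<mu>) / (lam * a))\<^sup>2)"
      by (intro mult_left_mono) auto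
    also have "lam\<^sup>2 * (b * m\<^sup>2) = b * \<mu>\<^sup>2" by (simp add: \<mu>_def power_mult_distrib)
    also have "lam\<^sup>2 * (m / (lam * \<tau>) + real n * b' * ((1 + 2 * d * \<mu>) / (lam * a))\<^sup>2)
        = \<mu> / \<tau> + real n * b' / a\<^sup>2 * (1 + 2 * d * \<mu>)\<^sup>2"
      using lam \<tau> a by (simp add: \<mu>_def field_simps power2_eq_square)
    also have "\<mu> / \<tau> \<le> b * \<mu> / 4"
    proof -
      have "\<mu> * 4 \<le> \<mu> * (\<tau> * b)" using par(3) \<mu>0 by (intro mult_left_mono) auto
      then show ?thesis using \<tau> by (simp add: field_simps)
    qed
    \<comment> \<open>The second parameter condition is tuned so that the quadratic term returns
      with the factor b / 2 and can be absorbed on the left.\<close>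
    also have "real n * b' / a\<^sup>2 * (1 + 2 * d * \<mu>)\<^sup>2 \<le> b / (16 * d\<^sup>2) * (2 + 8 * d\<^sup>2 * \<mu>\<^sup>2)"
    proof (intro mult_mono)
      have "(16 * d\<^sup>2) * (real n * b') \<le> a\<^sup>2 * b" using par(2) by (simp add: mult_ac)
      then show "real n * b' / a\<^sup>2 \<le> b / (16 * d\<^sup>2)" using a d1 by (simp add: field_simps)
      have "(1 + 2 * d * \<mu>)\<^sup>2 + (1 - 2 * d * \<mu>)\<^sup>2 = 2 + 8 * d\<^sup>2 * \<mu>\<^sup>2"
        by (simp add: power2_eq_square algebra_simps)
      moreover have "(1 - 2 * d * \<mu>)\<^sup>2 \<ge> 0" by simp
      ultimately show "(1 + 2 * d * \<mu>)\<^sup>2 \<le> 2 + 8 * d\<^sup>2 * \<mu>\<^sup>2" by linarith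
    qed (use b in auto)
    also have "b / (16 * d\<^sup>2) * (2 + 8 * d\<^sup>2 * \<mu>\<^sup>2) = b * (1 / (8 * d\<^sup>2)) + b * \<mu>\<^sup>2 / 2"
      using d1 by (simp add: field_simps power2_eq_square)
    also have "b * (1 / (8 * d\<^sup>2)) \<le> b * (1 / 8)"
    proof (intro mult_left_mono)
      have "1\<^sup>2 \<le> d\<^sup>2" using d1 by (intro power_mono) auto
      then show "1 / (8 * d\<^sup>2) \<le> 1 / 8" using d1 by (simp add: divide_le_eq_1)
    qed (use b in auto)
    finally have "b * \<mu>\<^sup>2 \<le> b * (\<mu> / 4 + 1 / 8 + \<mu>\<^sup>2 / 2)" by (simp add: algebra_simps)
    then have *: "\<mu>\<^sup>2 \<le> \<mu> / 4 + 1 / 8 + \<mu>\<^sup>2 / 2" using b by simp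
    show ?thesis
    proof (rule ccontr)
      assume "\<not> \<mu> \<le> 2"
      then have "2 * \<mu> < \<mu> * \<mu>" "\<mu> > 2" by auto
      with * show False unfolding power2_eq_square by linarith
    qed
  qed
  then have "m \<le> 2 / lam" using lam by (simp add: \<mu>_def field_simps)
  then show ?thesis using m_ge order_trans by blast
qed

text \<open>With source \<open>g = 0\<close> the block bound holds for every multiple of \<psi>, so
  \<psi> vanishes on the block. Outside it, the strict sign of the imaginary part and the energy
  identity finish.\<close>

lemma hop_block_injective:
  fixes \<Gamma> :: "(int^'d) set"
  defines "d \<equiv> real CARD('d)"
  assumes fin: "finite \<Gamma>" and L: "\<Lambda> \<subseteq> \<Gamma>" "w \<in> \<Lambda>" "card \<Lambda> \<le> n" and I: "I \<subseteq> \<Lambda>"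
    and lam: "lam \<ge> 1" and \<sigma>: "\<bar>\<sigma>\<bar> = 1" and \<tau>: "\<tau> > 0" and b: "b > 0" "b' \<ge> 0" and a: "a > 0"
    and Im_out: "\<And>v. v \<in> \<Gamma> - \<Lambda> \<Longrightarrow> \<sigma> * Im (D v) < 0"
    and Im_in: "\<And>v. v \<in> \<Lambda> \<Longrightarrow> \<sigma> * Im (D v) \<le> - (lam * \<tau> * U v)"
    and U_bd: "\<And>v. v \<in> \<Lambda> - I \<Longrightarrow> b \<le> U v" and U_int: "\<And>v. v \<in> I \<Longrightarrow> - b' \<le> U v"
    and I_nbr: "\<And>v y. v \<in> I \<Longrightarrow> y \<in> \<Gamma> \<Longrightarrow> norm1 (v - y) = 1 \<Longrightarrow> y \<in> \<Lambda>"
    and I_D: "\<And>v. v \<in> I \<Longrightarrow> lam * a \<le> norm (D v)"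
    and par: "4 * d \<le> a" "16 * d\<^sup>2 * real n * b' \<le> a\<^sup>2 * b" "4 \<le> \<tau> * b"
    and sol: "\<And>v. v \<in> \<Gamma> \<Longrightarrow> hop_op \<Gamma> D \<psi> v = 0"
  shows "\<forall>v\<in>\<Gamma>. \<psi> v = 0"
proof -
  have zero: "\<psi> v = 0" if v: "v \<in> \<Lambda>" for v
  proof (rule ccontr)
    assume nz: "\<psi> v \<noteq> 0"
    \<comment> \<open>Scales \<psi> to modulus \<open>3 / lam\<close> at \<open>v\<close>, above the
      bound \<open>2 / lam\<close>.\<close>
    define c where "c = (3 / lam) / norm (\<psi> v)"
    have "\<forall>v\<in>\<Lambda>. norm (of_real c * \<psi> v) \<le> 2 / lam"
      by (rule hop_block_bound[where g = 0, OF fin L I lam \<sigma> \<tau> b a _ Im_in U_bd U_int I_nbr I_D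
            par[unfolded d_def]])
        (use Im_out sol in \<open>auto simp: less_imp_le hop_op_scale\<close>)
    then have "norm (of_real c * \<psi> v) \<le> 2 / lam" using v by blast
    moreover have "norm (of_real c * \<psi> v) = 3 / lam" unfolding norm_mult norm_of_real using nz lam by (simp add: c_def)
    ultimately show False using lam by (simp add: field_simps)
  qed
  have "0 = \<sigma> * (\<Sum>v\<in>\<Gamma>. Im (D v) * (norm (\<psi> v))\<^sup>2)"
    using Im_hop_energy_full[OF fin, of \<psi> D] sol by simp
  also have "\<dots> = (\<Sum>v\<in>\<Gamma>. \<sigma> * Im (D v) * (norm (\<psi> v))\<^sup>2)"
    by (simp add: sum_distrib_left mult.assoc)
  finally have "(\<Sum>v\<in>\<Gamma>. - (\<sigma> * Im (D v) * (norm (\<psi> v))\<^sup>2)) = 0" by (simp add: sum_negf)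
  moreover have "- (\<sigma> * Im (D v) * (norm (\<psi> v))\<^sup>2) \<ge> 0" if "v \<in> \<Gamma>" for v
    using that zero[of v] Im_out[of v] by (cases "v \<in> \<Lambda>") (auto simp: mult_nonpos_nonneg less_imp_le)
  ultimately have "\<sigma> * Im (D v) * (norm (\<psi> v))\<^sup>2 = 0" if "v \<in> \<Gamma>" for v
    using fin that by (subst (asm) sum_nonneg_eq_0_iff) auto
  then have "\<psi> v = 0" if "v \<in> \<Gamma> - \<Lambda>" for v
    using that Im_out[OF that] by force
  then show ?thesis using zero by blast
qed

text \<open>At a site where |\<psi>| is maximal, the hopping contributes at most 2d times the
  maximum, which the diagonal exceeds by \<open>lam\<close>. It serves for |z| large compared with
  \<open>lam\<close>.\<close>

lemma hop_max_principle:
  fixes \<Gamma> :: "(int^'d) set"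
  assumes fin: "finite \<Gamma>" and D: "\<And>v. v \<in> \<Gamma> \<Longrightarrow> lam + 2 * real CARD('d) \<le> norm (D v)"
    and lam: "lam > 0" and sol: "hop_solves \<Gamma> D w \<psi>" and x: "x \<in> \<Gamma>"
  shows "norm (\<psi> x) \<le> 1 / lam"
proof -
  define m where "m = Max ((\<lambda>v. norm (\<psi> v)) ` \<Gamma>)"
  have m_ge: "norm (\<psi> v) \<le> m" if "v \<in> \<Gamma>" for v
    unfolding m_def using fin that by (intro Max_ge) auto
  have "m \<in> (\<lambda>v. norm (\<psi> v)) ` \<Gamma>" unfolding m_def using fin x by (intro Max_in) auto
  then obtain i where i: "i \<in> \<Gamma>" "m = norm (\<psi> i)" by auto
  have eq: "D i * \<psi> i = (if i = w then 1 else 0) + (\<Sum>y\<in>{y \<in> \<Gamma>. norm1 (i - y) = 1}. \<psi> y)"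
    using sol i(1) unfolding hop_op_def hop_solves_def by (auto simp: algebra_simps)
  have "norm (D i) * norm (\<psi> i) = norm (D i * \<psi> i)" by (simp only: norm_mult)
  also have "\<dots> \<le> norm (if i = w then 1 else 0 :: complex) + norm (\<Sum>y\<in>{y \<in> \<Gamma>. norm1 (i - y) = 1}. \<psi> y)"
    unfolding eq by (rule norm_triangle_ineq)
  also have "\<dots> \<le> 1 + (\<Sum>y\<in>{y \<in> \<Gamma>. norm1 (i - y) = 1}. m)"
    using m_ge by (intro add_mono order_trans[OF norm_sum] sum_mono) auto
  also have "\<dots> \<le> 1 + 2 * real CARD('d) * m"
    using card_nbrs_in_le[of \<Gamma> i] i by (auto intro!: mult_right_mono)
  finally have "norm (D i) * m \<le> 1 + 2 * real CARD('d) * m" using i by simp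
  moreover have "(lam + 2 * real CARD('d)) * m \<le> norm (D i) * m"
    using D[OF i(1)] i by (intro mult_right_mono) auto
  ultimately have "lam * m \<le> 1" by (simp add: algebra_simps)
  then have "m \<le> 1 / lam" using lam by (simp add: field_simps)
  then show ?thesis using m_ge[OF x] by linarith
qed

section \<open>Dependence on a single coupling\<close>

lemma finite_pot_support:
  assumes "finite (supp_u u)" shows "finite {k. u (x - k) \<noteq> 0}"
proof -
  have "{k. u (x - k) \<noteq> 0} = (\<lambda>v. x - v) ` supp_u u" by (force simp: supp_u_def)
  then show ?thesis using assms by simp
qed

lemma pot_fun_upd:
  assumes "finite (supp_u u)"
  shows "pot u (\<omega> (k := r)) x = pot u (\<omega> (k := 0)) x + r * u (x - k)"
proof -
  have "pot u (\<omega> (k := r)) x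
      = (\<Sum>j\<in>{j. u (x - j) \<noteq> 0}. (\<omega> (k := 0)) j * u (x - j) + (if j = k then r * u (x - j) else 0))"
    unfolding pot_def by (intro sum.cong) auto
  also have "\<dots> = pot u (\<omega> (k := 0)) x + r * u (x - k)"
    using finite_pot_support[OF assms, of x] by (simp add: sum.distrib pot_def)
  finally show ?thesis .
qed

lemma abs_pot_le:
  assumes u: "finite (supp_u u)" and \<omega>: "\<And>j. \<bar>\<omega> j\<bar> \<le> R"
  shows "\<bar>pot u \<omega> x\<bar> \<le> R * (\<Sum>v\<in>supp_u u. \<bar>u v\<bar>)"
proof -
  have "\<bar>pot u \<omega> x\<bar> \<le> (\<Sum>j\<in>{j. u (x - j) \<noteq> 0}. R * \<bar>u (x - j)\<bar>)"
    unfolding pot_def using \<omega> by (intro order_trans[OF sum_abs] sum_mono) (auto simp: abs_mult intro!: mult_right_mono)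
  also have "\<dots> = (\<Sum>v\<in>supp_u u. R * \<bar>u v\<bar>)"
    by (rule sum.reindex_bij_witness[where i = "\<lambda>v. x - v" and j = "\<lambda>j. x - j"]) (auto simp: supp_u_def)
  finally show ?thesis by (simp add: sum_distrib_left)
qed

text \<open>\<open>interior_boundary\<close> only counts neighbours. As a site has at most 2d of
  them in the whole lattice, a full count inside \<open>L\<close> leaves none outside.\<close>

lemma interior_nbrs_subset:
  fixes L :: "(int^'d) set"
  assumes "v \<in> L - interior_boundary L" "norm1 (v - y) = 1"
  shows "y \<in> L"
proof -
  have "{j \<in> L. norm1 (v - j) = 1} = {j. norm1 (v - j) = 1}"
  proof (rule card_subset_eq[OF finite_nbrs])
    have "2 * CARD('d) \<le> card {j \<in> L. norm1 (v - j) = 1}"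
      using assms(1) by (auto simp: interior_boundary_def)
    moreover have "card {j \<in> L. norm1 (v - j) = 1} \<le> card {j. norm1 (v - j) = 1}"
      by (intro card_mono finite_nbrs) auto
    ultimately show "card {j \<in> L. norm1 (v - j) = 1} = card {j. norm1 (v - j) = 1}"
      using card_nbrs_le[of v] by linarith
  qed auto
  then show ?thesis using assms(2) by blast
qed

text \<open>The diagonal of \<open>H_\<Gamma> - z\<close> after replacing \<open>\<omega>\<close> at \<open>k\<close> by a complex number \<open>\<zeta>\<close>.\<close>

definition complex_diag ::
  "(int^'d \<Rightarrow> real) \<Rightarrow> real \<Rightarrow> (int^'d \<Rightarrow> real) \<Rightarrow> complex \<Rightarrow> int^'d \<Rightarrow> complex \<Rightarrow> int^'d \<Rightarrow> complex" where
  "complex_diag u lam \<omega> z k \<zeta> v =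
     green_diag u lam (fun_upd \<omega> k 0) z v + \<zeta> * complex_of_real (lam * u (v - k))"

lemma green_diag_fun_upd:
  assumes "finite (supp_u u)"
  shows "green_diag u lam (fun_upd \<omega> k r) z = complex_diag u lam \<omega> z k (complex_of_real r)"
  unfolding complex_diag_def green_diag_def pot_fun_upd[OF assms, of \<omega> k r] by (auto simp: algebra_simps)

text \<open>The entries are affine in the coupling, which occurs only in the rows of the translate
  of \<Theta> by \<open>k\<close>. Hence both Cramer determinants have degree at most |\<Theta>|,
  however large \<Gamma> is.\<close>

lemma complex_diag_polys:
  fixes \<Gamma> :: "(int^'d) set"
  assumes fin: "finite \<Gamma>" and u: "finite (supp_u u)" and x: "x \<in> \<Gamma>"
  obtains p q :: "complex poly"
  where "degree p \<le> card (supp_u u)" "degree q \<le> card (supp_u u)"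
    "\<And>\<zeta>. poly q \<zeta> = fdet \<Gamma> (hop_mat (complex_diag u lam \<omega> z k \<zeta>))"
    "\<And>\<zeta> \<psi>. hop_solves \<Gamma> (complex_diag u lam \<omega> z k \<zeta>) w \<psi> \<Longrightarrow> \<psi> x * poly q \<zeta> = poly p \<zeta>"
proof -
  define A where "A v y = [:hop_mat (green_diag u lam (fun_upd \<omega> k 0) z) v y,
      if v = y then complex_of_real (lam * u (v - k)) else 0:]" for v y
  define A' where "A' v y = (if y = x then [:if v = w then 1 else 0:] else A v y)" for v y
  define m where "m v = (if u (v - k) \<noteq> 0 then 1 else 0 :: nat)" for v
  have polyA: "poly (A v y) \<zeta> = hop_mat (complex_diag u lam \<omega> z k \<zeta>) v y" for v y \<zeta>
    by (simp add: A_def hop_mat_def complex_diag_def)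
  have polyA': "poly (A' v y) \<zeta>
      = (if y = x then (if v = w then 1 else 0) else hop_mat (complex_diag u lam \<omega> z k \<zeta>) v y)" for v y \<zeta>
    by (simp add: A'_def polyA)
  have degA: "degree (A v y) \<le> m v" "degree (A' v y) \<le> m v" for v y
    by (auto simp: A'_def A_def m_def)
  have "(\<Sum>v\<in>\<Gamma>. m v) = card {v \<in> \<Gamma>. u (v - k) \<noteq> 0}"
    unfolding m_def using fin by (simp add: sum.If_cases Int_def)
  also have "\<dots> \<le> card (supp_u u)"
    by (rule card_inj_on_le[where f = "\<lambda>v. v - k"]) (auto simp: supp_u_def inj_on_def u[unfolded supp_u_def])
  finally have m: "(\<Sum>v\<in>\<Gamma>. m v) \<le> card (supp_u u)" .
  show ?thesis
  proof (rule that[of "fdet \<Gamma> A'" "fdet \<Gamma> A"])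
    show "degree (fdet \<Gamma> A') \<le> card (supp_u u)" "degree (fdet \<Gamma> A) \<le> card (supp_u u)"
      by (rule order_trans[OF degree_fdet_le[where m = m, OF fin] m], rule degA)+
    show "poly (fdet \<Gamma> A) \<zeta> = fdet \<Gamma> (hop_mat (complex_diag u lam \<omega> z k \<zeta>))" for \<zeta>
      by (simp only: fdet_poly polyA)
    fix \<zeta> \<psi> assume "hop_solves \<Gamma> (complex_diag u lam \<omega> z k \<zeta>) w \<psi>"
    then have "\<psi> x * fdet \<Gamma> (hop_mat (complex_diag u lam \<omega> z k \<zeta>))
       = fdet \<Gamma> (\<lambda>v y. if y = x then (if v = w then 1 else 0) else hop_mat (complex_diag u lam \<omega> z k \<zeta>) v y)"
      by (intro fdet_cramer[OF fin x]) (simp add: hop_solves_def hop_op_eq_hop_mat[OF fin])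
    then show "\<psi> x * poly (fdet \<Gamma> A) \<zeta> = poly (fdet \<Gamma> A') \<zeta>"
      by (simp only: fdet_poly polyA polyA')
  qed
qed

text \<open>\<open>K\<close> precedes all of \<open>lam\<close>, \<Gamma>, \<open>z\<close>,
  \<omega>, \<open>k\<close> and \<open>w\<close>; the induction on \<Gamma> relies on this
  uniformity. The bound on \<omega> omits the site \<open>k\<close>, whose value is integrated
  out.\<close>

lemma block_fractional_moment:
  fixes \<rho> :: "real \<Rightarrow> real" and u :: "int^'d \<Rightarrow> real"
  assumes meas: "\<rho> \<in> borel_measurable borel" and nonneg: "\<And>t. \<rho> t \<ge> 0"
    and mass: "(\<integral>\<^sup>+ t. ennreal (\<rho> t) \<partial>lborel) = 1" and bdd: "\<And>t. \<rho> t \<le> C"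
    and cpt: "\<And>t. \<bar>t\<bar> > R \<Longrightarrow> \<rho> t = 0" and R: "R \<ge> 0"
    and u_fin: "finite (supp_u u)" and u_0: "u 0 \<noteq> 0"
    and A2: "\<And>k. k \<in> interior_boundary (supp_u u) \<Longrightarrow> u k > 0"
    and t: "0 \<le> t" "real (card (supp_u u)) * t \<le> 1 / 2"
  shows "\<exists>K>0. \<forall>lam\<ge>1. \<forall>\<Gamma> z \<omega> k w. finite \<Gamma> \<longrightarrow> Im z \<noteq> 0 \<longrightarrow> (\<forall>j. j \<noteq> k \<longrightarrow> \<bar>\<omega> j\<bar> \<le> R) \<longrightarrow>
    k \<in> \<Gamma> \<longrightarrow> w \<in> \<Gamma> \<longrightarrow> u (w - k) \<noteq> 0 \<longrightarrow>
    (\<integral>\<^sup>+ r. ennreal (norm (green u lam (fun_upd \<omega> k r) \<Gamma> z k w) powr t)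
       \<partial>density lborel (\<lambda>t. ennreal (\<rho> t))) \<le> ennreal (K * lam powr (- t))"
proof -
  let ?M = "density lborel (\<lambda>t. ennreal (\<rho> t))"
  define \<Theta> where "\<Theta> = supp_u u"
  define n where "n = card \<Theta>"
  define d where "d = real CARD('d)"
  define U1 where "U1 = (\<Sum>v\<in>\<Theta>. \<bar>u v\<bar>)"
  define b where "b = Min ((\<lambda>v. \<bar>u v\<bar>) ` \<Theta>)"
  \<comment> \<open>Threshold for |z| / lam: above it the diagonal exceeds lam + 2 d in modulus,
    since the potential is at most lam R U1 and lam \<ge> 1.\<close>
  define C1 where "C1 = R * U1 + 2 * d + 1"
  \<comment> \<open>The summands serve the three parameter conditions of
    \<open>hop_block_bound\<close>; \<open>4\<close> also ensures a \<le> a^2, needed for the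
    second.\<close>
  define a where "a = 4 * d + 4 + 16 * d\<^sup>2 * real n * U1 / b"
  \<comment> \<open>The shift contributes at least lam \<tau> b on the block, the rest of the
    diagonal at most lam (R U1 + C1); lam a remains.\<close>
  define \<tau> where "\<tau> = (a + R * U1 + C1) / b"
  define D where "D = R + real n + \<tau>"
  \<comment> \<open>The leading 1 covers large |z|; the rest is the constant of
    \<open>rational_fractional_moment\<close> with \<open>B = 2 / lam\<close>, without the power of
    \<open>lam\<close>.\<close>
  define K where "K = 1 + (D ^ n * real (Suc n) * 2) powr t * (1 + real n * sqrt D * (1 + 4 * C))"
  have C: "C \<ge> 0" using nonneg[of 0] bdd[of 0] by linarith
  have fin\<Theta>: "finite \<Theta>" and ne: "\<Theta> \<noteq> {}" using u_fin u_0 by (auto simp: \<Theta>_def supp_u_def)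
  have d1: "d \<ge> 1" by (simp add: d_def)
  have U10: "U1 \<ge> 0" by (simp add: U1_def sum_nonneg)
  have u_le: "\<bar>u v\<bar> \<le> U1" if "v \<in> \<Theta>" for v
    unfolding U1_def using that fin\<Theta> by (intro member_le_sum) auto
  have b_le: "b \<le> \<bar>u v\<bar>" if "v \<in> \<Theta>" for v
    unfolding b_def using that fin\<Theta> by (intro Min_le) auto
  have "b \<in> (\<lambda>v. \<bar>u v\<bar>) ` \<Theta>" unfolding b_def using fin\<Theta> ne by (intro Min_in) auto
  then have b0: "b > 0" by (auto simp: \<Theta>_def supp_u_def)
  have a4: "a \<ge> 4 * d" "a \<ge> 4" "a \<ge> 16 * d\<^sup>2 * real n * U1 / b"
    using d1 U10 b0 by (auto simp: a_def add_increasing2)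
  have C10: "C1 \<ge> 0" using R U10 d1 by (simp add: C1_def)
  have \<tau>b: "\<tau> * b = a + R * U1 + C1" using b0 by (simp add: \<tau>_def)
  have \<tau>0: "\<tau> > 0" using b0 a4 C10 R U10 by (auto simp: \<tau>_def intro!: divide_pos_pos add_pos_nonneg)
  have D0: "D \<ge> 0" using R \<tau>0 by (simp add: D_def)
  have par: "4 * real CARD('d) \<le> a" "16 * (real CARD('d))\<^sup>2 * real n * U1 \<le> a\<^sup>2 * b" "4 \<le> \<tau> * b"
  proof -
    show "4 * real CARD('d) \<le> a" using a4 by (simp add: d_def)
    have "16 * d\<^sup>2 * real n * U1 \<le> a * b" using a4(3) b0 by (simp add: field_simps)
    also have "\<dots> \<le> (a * a) * b" using a4 b0 mult_left_mono[of 1 a a] by (intro mult_right_mono) auto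
    finally show "16 * (real CARD('d))\<^sup>2 * real n * U1 \<le> a\<^sup>2 * b" by (simp add: d_def power2_eq_square)
    show "4 \<le> \<tau> * b" unfolding \<tau>b using a4 R U10 C10 by (intro add_increasing2) auto
  qed
  have K1: "K \<ge> 1" using C D0 by (simp add: K_def)
  have "(\<integral>\<^sup>+ r. ennreal (norm (green u lam (fun_upd \<omega> k r) \<Gamma> z k w) powr t) \<partial>?M) \<le> ennreal (K * lam powr (- t))"
    if lam: "lam \<ge> 1" and fin: "finite \<Gamma>" and z: "Im z \<noteq> 0" and \<omega>: "\<And>j. j \<noteq> k \<Longrightarrow> \<bar>\<omega> j\<bar> \<le> R"
      and k: "k \<in> \<Gamma>" and w: "w \<in> \<Gamma>" "u (w - k) \<noteq> 0" for lam \<Gamma> z \<omega> k w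
  proof (cases "norm z \<ge> C1 * lam")
    case True
    have "norm (green u lam (fun_upd \<omega> k r) \<Gamma> z k w) powr t \<le> lam powr (- t)" if r: "\<bar>r\<bar> \<le> R" for r
    proof -
      have "norm (green u lam (fun_upd \<omega> k r) \<Gamma> z k w) \<le> 1 / lam"
      proof (rule hop_max_principle[OF fin _ _ green_finite(2)[OF fin z] k])
        fix v
        have "\<bar>pot u (fun_upd \<omega> k r) v\<bar> \<le> R * U1"
          unfolding U1_def \<Theta>_def using r \<omega> by (intro abs_pot_le[OF u_fin]) auto
        then have "lam * \<bar>pot u (fun_upd \<omega> k r) v\<bar> \<le> lam * (R * U1)" using lam by (intro mult_left_mono) auto
        then have "norm (complex_of_real (lam * pot u (fun_upd \<omega> k r) v)) \<le> lam * (R * U1)"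
          using lam by (simp add: abs_mult norm_mult)
        moreover have "lam * C1 = lam * (R * U1) + 2 * (d * lam) + lam" by (simp add: C1_def algebra_simps)
        moreover have "d * 1 \<le> d * lam" using lam d1 by (intro mult_left_mono) auto
        moreover have "norm z - norm (complex_of_real (lam * pot u (fun_upd \<omega> k r) v))
            \<le> norm (green_diag u lam (fun_upd \<omega> k r) z v)"
          unfolding green_diag_def by (metis norm_minus_commute norm_triangle_ineq2)
        ultimately show "lam + 2 * real CARD('d) \<le> norm (green_diag u lam (fun_upd \<omega> k r) z v)"
          using True unfolding d_def[symmetric] by (simp add: mult.commute)
      qed (use lam in auto)
      then have "norm (green u lam (fun_upd \<omega> k r) \<Gamma> z k w) powr t \<le> (1 / lam) powr t"
        using t by (intro powr_mono2) auto
      then show ?thesis using lam by (simp add: powr_divide powr_minus_divide)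
    qed
    then have "AE r in ?M. ennreal (norm (green u lam (fun_upd \<omega> k r) \<Gamma> z k w) powr t) \<le> ennreal (lam powr (- t))"
      using meas cpt by (subst AE_density) (auto intro!: AE_I2 ennreal_leI, metis ennreal_0 less_irrefl not_le)
    then have "(\<integral>\<^sup>+ r. ennreal (norm (green u lam (fun_upd \<omega> k r) \<Gamma> z k w) powr t) \<partial>?M)
        \<le> (\<integral>\<^sup>+ r. ennreal (lam powr (- t)) \<partial>?M)" by (rule nn_integral_mono_AE)
    also have "\<dots> = ennreal (1 * lam powr (- t))"
      using meas mass by (simp add: emeasure_density)
    also have "\<dots> \<le> ennreal (K * lam powr (- t))" using K1 by (intro ennreal_leI mult_right_mono) auto
    finally show ?thesis .
  next
    case False
    define \<sigma> where "\<sigma> = sgn (Im z)"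
    \<comment> \<open>The unit spacing gives the separation for interpolation. The height has the
      sign opposite to Im z, so that where \<open>u\<close> is positive both push the imaginary part
      of the diagonal the same way.\<close>
    define \<zeta> where "\<zeta> j = Complex (real j) (- \<sigma> * \<tau>)" for j :: nat
    define \<Lambda> where "\<Lambda> = {v \<in> \<Gamma>. v - k \<in> \<Theta>}"
    define I where "I = {v \<in> \<Lambda>. v - k \<notin> interior_boundary \<Theta>}"
    have \<sigma>1: "\<bar>\<sigma>\<bar> = 1" "\<sigma> * \<sigma> = 1" "\<sigma> * Im z = \<bar>Im z\<bar>" "\<bar>Im z\<bar> > 0"
      using z by (auto simp: \<sigma>_def sgn_if)
    have kL: "k \<in> \<Lambda>" "w \<in> \<Lambda>" using k w u_0 by (auto simp: \<Lambda>_def \<Theta>_def supp_u_def)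
    have LG: "\<Lambda> \<subseteq> \<Gamma>" "I \<subseteq> \<Lambda>" by (auto simp: \<Lambda>_def I_def)
    have cardL: "card \<Lambda> \<le> n"
      unfolding n_def by (rule card_inj_on_le[where f = "\<lambda>v. v - k"]) (auto simp: \<Lambda>_def inj_on_def fin\<Theta>)
    let ?D = "\<lambda>j. complex_diag u lam \<omega> z k (\<zeta> j)"
    have Im_D: "\<sigma> * Im (?D j v) = - (lam * \<tau> * u (v - k)) - \<bar>Im z\<bar>" for j v
    proof -
      have eq: "Im (?D j v) = - Im z - \<sigma> * \<tau> * (lam * u (v - k))" by (simp add: complex_diag_def \<zeta>_def)
      have "\<sigma> * Im (?D j v) = - (\<sigma> * Im z) - (\<sigma> * \<sigma>) * (\<tau> * (lam * u (v - k)))"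
        unfolding eq by (simp add: algebra_simps)
      then show ?thesis using \<sigma>1 by (simp add: mult_ac)
    qed
    have Im_out: "\<sigma> * Im (?D j v) < 0" if "v \<in> \<Gamma> - \<Lambda>" for j v
      unfolding Im_D using that \<sigma>1 by (auto simp: \<Lambda>_def \<Theta>_def supp_u_def)
    have Im_in: "\<sigma> * Im (?D j v) \<le> - (lam * \<tau> * u (v - k))" for j v unfolding Im_D by simp
    \<comment> \<open>(A2) enters here: on the boundary of the block the lower bound on |u| is one
      on \<open>u\<close> itself.\<close>
    have U_bd: "b \<le> u (v - k)" if "v \<in> \<Lambda> - I" for v
      using that b_le[of "v - k"] A2[of "v - k"] by (auto simp: I_def \<Lambda>_def \<Theta>_def)
    have U_int: "- U1 \<le> u (v - k)" if "v \<in> I" for v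
      using that u_le[of "v - k"] by (auto simp: I_def \<Lambda>_def)
    have I_nbr: "y \<in> \<Lambda>" if "v \<in> I" "y \<in> \<Gamma>" "norm1 (v - y) = 1" for v y
      using interior_nbrs_subset[of "v - k" \<Theta> "y - k"] that by (auto simp: I_def \<Lambda>_def)
    have I_D: "lam * a \<le> norm (?D j v)" if "v \<in> I" for j v
    proof -
      have "\<tau> = \<bar>Im (\<zeta> j)\<bar>" using \<tau>0 \<sigma>1 by (simp add: \<zeta>_def abs_mult)
      then have \<zeta>\<tau>: "\<tau> \<le> norm (\<zeta> j)" by (metis abs_Im_le_cmod)
      have "\<tau> * b \<le> norm (\<zeta> j) * \<bar>u (v - k)\<bar>"
        using that b_le[of "v - k"] b0 \<zeta>\<tau> \<tau>0 by (intro mult_mono) (auto simp: I_def \<Lambda>_def)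
      then have "lam * (a + R * U1 + C1) \<le> lam * (norm (\<zeta> j) * \<bar>u (v - k)\<bar>)"
        unfolding \<tau>b using lam by (intro mult_left_mono) auto
      also have "\<dots> = norm (\<zeta> j * complex_of_real (lam * u (v - k)))"
        using lam by (simp add: norm_mult abs_mult)
      finally have 1: "lam * (a + R * U1 + C1) \<le> norm (\<zeta> j * complex_of_real (lam * u (v - k)))" .
      have "\<bar>pot u (fun_upd \<omega> k 0) v\<bar> \<le> R * U1"
        unfolding U1_def \<Theta>_def using R \<omega> by (intro abs_pot_le[OF u_fin]) auto
      then have "lam * \<bar>pot u (fun_upd \<omega> k 0) v\<bar> \<le> lam * (R * U1)" using lam by (intro mult_left_mono) auto
      then have 2: "norm (complex_of_real (lam * pot u (fun_upd \<omega> k 0) v)) \<le> lam * (R * U1)"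
        using lam by (simp add: abs_mult norm_mult)
      have 3: "norm (green_diag u lam (fun_upd \<omega> k 0) z v) \<le> lam * (R * U1) + lam * C1"
        unfolding green_diag_def using 2 False
        by (intro order_trans[OF norm_triangle_ineq4] add_mono) (auto simp: mult.commute)
      have "norm (\<zeta> j * complex_of_real (lam * u (v - k))) - norm (green_diag u lam (fun_upd \<omega> k 0) z v)
          \<le> norm (?D j v)"
        unfolding complex_diag_def by (metis add.commute norm_diff_ineq)
      then show ?thesis using 1 3 by (simp add: distrib_left)
    qed
    obtain p q where pq: "degree p \<le> n" "degree q \<le> n"
      "\<And>\<xi>. poly q \<xi> = fdet \<Gamma> (hop_mat (complex_diag u lam \<omega> z k \<xi>))"
      "\<And>\<xi> \<psi>. hop_solves \<Gamma> (complex_diag u lam \<omega> z k \<xi>) w \<psi> \<Longrightarrow> \<psi> k * poly q \<xi> = poly p \<xi>"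
      using complex_diag_polys[OF fin u_fin k, of lam \<omega> z k w] unfolding n_def \<Theta>_def by metis
    have inj: "\<forall>v\<in>\<Gamma>. \<psi> v = 0" if "\<And>v. v \<in> \<Gamma> \<Longrightarrow> hop_op \<Gamma> (?D j) \<psi> v = 0" for j \<psi>
      using a4 by (intro hop_block_injective[OF fin LG(1) kL(2) cardL LG(2) lam \<sigma>1(1) \<tau>0 b0 U10 _
            Im_out Im_in U_bd U_int I_nbr I_D par that]) auto
    have at_\<zeta>: "norm (poly p (\<zeta> j)) \<le> 2 / lam * norm (poly q (\<zeta> j))" "poly q (\<zeta> j) \<noteq> 0" for j
    proof -
      show "poly q (\<zeta> j) \<noteq> 0" unfolding pq(3) by (rule hop_solves_finite_ex(1)[OF fin inj])
      obtain \<psi> where \<psi>: "hop_solves \<Gamma> (?D j) w \<psi>"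
        using hop_solves_finite_ex(2)[where D = "?D j" and y = w, OF fin inj[of j]] by blast
      have "\<forall>v\<in>\<Lambda>. norm (\<psi> v) \<le> 2 / lam"
        using a4 \<psi> less_imp_le[OF Im_out]
        by (intro hop_block_bound[where g = 1, OF fin LG(1) kL(2) cardL LG(2) lam \<sigma>1(1) \<tau>0 b0 U10 _
              _ Im_in U_bd U_int I_nbr I_D par]) (auto simp: hop_solves_def)
      then have "norm (\<psi> k) \<le> 2 / lam" using kL by blast
      then have "norm (\<psi> k) * norm (poly q (\<zeta> j)) \<le> 2 / lam * norm (poly q (\<zeta> j))"
        by (intro mult_right_mono) auto
      then show "norm (poly p (\<zeta> j)) \<le> 2 / lam * norm (poly q (\<zeta> j))"
        using pq(4)[OF \<psi>] by (metis norm_mult)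
    qed
    have "(\<integral>\<^sup>+ r. ennreal (norm (green u lam (fun_upd \<omega> k r) \<Gamma> z k w) powr t) \<partial>?M)
        \<le> ennreal ((D ^ n * real (Suc n) * (2 / lam)) powr t * (1 + real n * sqrt D * (1 + 4 * C)))"
    proof (rule rational_fractional_moment[OF meas nonneg mass bdd cpt pq(1,2), where \<zeta> = \<zeta>])
      show "q \<noteq> 0" using at_\<zeta>(2)[of 0] by auto
      show "1 \<le> norm (\<zeta> i - \<zeta> j)" if "i \<noteq> j" for i j
      proof -
        have "\<zeta> i - \<zeta> j = complex_of_real (real i - real j)" by (simp add: \<zeta>_def complex_eq_iff)
        then have "norm (\<zeta> i - \<zeta> j) = \<bar>real i - real j\<bar>" by (simp only: norm_of_real)
        then show ?thesis using that by linarith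
      qed
      show "norm (complex_of_real r - \<zeta> j) \<le> D" if "j \<le> n" "\<bar>r\<bar> \<le> R" for j r
      proof -
        have "norm (complex_of_real r - \<zeta> j) \<le> \<bar>r - real j\<bar> + \<bar>\<sigma> * \<tau>\<bar>"
          using cmod_le[of "complex_of_real r - \<zeta> j"] by (simp add: \<zeta>_def)
        also have "\<dots> \<le> D" using that \<sigma>1 \<tau>0 by (simp add: D_def abs_mult)
        finally show ?thesis .
      qed
      show "green u lam (fun_upd \<omega> k r) \<Gamma> z k w * poly q (complex_of_real r) = poly p (complex_of_real r)" for r
        using pq(4)[OF green_finite(2)[OF fin z, of u lam "fun_upd \<omega> k r" w, unfolded green_diag_fun_upd[OF u_fin]]] .
      show "real n * t \<le> 1 / 2" using t by (simp add: n_def \<Theta>_def)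
    qed (use D0 lam at_\<zeta>(1) t in auto)
    also have "D ^ n * real (Suc n) * (2 / lam) = D ^ n * real (Suc n) * 2 * (1 / lam)" by simp
    also have "(D ^ n * real (Suc n) * 2 * (1 / lam)) powr t = (D ^ n * real (Suc n) * 2) powr t * lam powr (- t)"
      using lam D0 by (subst powr_mult) (auto simp: powr_divide powr_minus_divide)
    also have "ennreal ((D ^ n * real (Suc n) * 2) powr t * lam powr (- t) * (1 + real n * sqrt D * (1 + 4 * C)))
        \<le> ennreal (K * lam powr (- t))"
    proof (rule ennreal_leI)
      have "(K - 1) * lam powr (- t) \<le> K * lam powr (- t)" by (intro mult_right_mono) auto
      then show "(D ^ n * real (Suc n) * 2) powr t * lam powr (- t) * (1 + real n * sqrt D * (1 + 4 * C)) \<le> K * lam powr (- t)"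
        by (simp add: K_def mult_ac)
    qed
    finally show ?thesis .
  qed
  then show ?thesis using K1 by (intro exI[of _ K]) auto
qed

subsection \<open>Exponential decay\<close>

text \<open>The shares f i / T lie in [0, 1], where lowering the exponent from 1 to \<open>t\<close>
  increases them, and they add up to 1.\<close>

lemma powr_sum_le:
  fixes f :: "'a \<Rightarrow> real"
  assumes "\<And>i. i \<in> S \<Longrightarrow> f i \<ge> 0" "0 < t" "t \<le> 1"
  shows "(\<Sum>i\<in>S. f i) powr t \<le> (\<Sum>i\<in>S. f i powr t)"
proof (cases "(\<Sum>i\<in>S. f i) = 0")
  case True
  then show ?thesis using assms(2) by (simp add: sum_nonneg)
next
  case False
  define T where "T = (\<Sum>i\<in>S. f i)"
  have T: "T > 0" using False assms(1) sum_nonneg[of S f] by (simp add: T_def order_less_le)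
  have fin: "finite S" using False sum.infinite by blast
  have "f i / T * T powr t \<le> f i powr t" if i: "i \<in> S" for i
  proof -
    have le: "0 \<le> f i / T" "f i / T \<le> 1"
      using assms(1) i T fin by (auto simp: T_def divide_le_eq_1 intro!: member_le_sum)
    have "f i / T = (f i / T) powr 1" by (rule powr_one[OF le(1), symmetric])
    also have "\<dots> \<le> (f i / T) powr t" using le assms(3) by (intro powr_mono') auto
    also have "\<dots> = f i powr t / T powr t" using assms(1)[OF i] T by (simp add: powr_divide)
    finally show ?thesis using T by (simp add: field_simps)
  qed
  then have "(\<Sum>i\<in>S. f i / T * T powr t) \<le> (\<Sum>i\<in>S. f i powr t)" by (intro sum_mono)
  moreover have "(\<Sum>i\<in>S. f i / T * T powr t) = T powr t"
    using T by (simp add: sum_distrib_right[symmetric] sum_divide_distrib[symmetric] T_def[symmetric])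
  ultimately show ?thesis by (simp add: T_def)
qed

section \<open>The product measure and measurability\<close>

lemma prob_space_density_lborel:
  assumes "\<rho> \<in> borel_measurable borel" "(\<integral>\<^sup>+ t. ennreal (\<rho> t) \<partial>lborel) = 1"
  shows "prob_space (density lborel (\<lambda>t. ennreal (\<rho> t)))"
  using assms by (intro prob_spaceI) (simp add: emeasure_density)

text \<open>Tonelli for one coordinate against all others. Points of the product over
  \<open>UNIV - {k}\<close> are \<open>undefined\<close> at \<open>k\<close>; \<open>fun_upd\<close>
  overwrites this value.\<close>

lemma nn_integral_disorder_split:
  fixes F :: "(int^'d \<Rightarrow> real) \<Rightarrow> ennreal"
  assumes meas: "\<rho> \<in> borel_measurable borel" and mass: "(\<integral>\<^sup>+ t. ennreal (\<rho> t) \<partial>lborel) = 1"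
    and F: "F \<in> borel_measurable (disorder_space \<rho>)"
  shows "(\<integral>\<^sup>+ \<omega>. F \<omega> \<partial>disorder_space \<rho>) =
    (\<integral>\<^sup>+ \<omega>. (\<integral>\<^sup>+ r. F (fun_upd \<omega> k r) \<partial>density lborel (\<lambda>t. ennreal (\<rho> t)))
       \<partial>PiM (UNIV - {k}) (\<lambda>_. density lborel (\<lambda>t. ennreal (\<rho> t))))"
proof -
  let ?M = "density lborel (\<lambda>t. ennreal (\<rho> t))"
  let ?P = "PiM (UNIV - {k}) (\<lambda>_. ?M)"
  interpret M: prob_space ?M by (rule prob_space_density_lborel[OF meas mass])
  interpret P: prob_space ?P by (intro prob_space_PiM M.prob_space_axioms)
  interpret MP: pair_sigma_finite ?M ?P ..
  have dist: "distr (?M \<Otimes>\<^sub>M ?P) (disorder_space \<rho>) (\<lambda>(r, \<omega>). fun_upd \<omega> k r) = disorder_space \<rho>"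
    using distr_pair_PiM_eq_PiM[of "UNIV - {k}" "\<lambda>_. ?M" k] M.prob_space_axioms
    by (simp add: disorder_space_def insert_absorb)
  have T: "(\<lambda>(r, \<omega>). fun_upd \<omega> k r) \<in> ?M \<Otimes>\<^sub>M ?P \<rightarrow>\<^sub>M disorder_space \<rho>"
    unfolding disorder_space_def
    using measurable_fun_upd[of UNIV "UNIV - {k}" k "\<lambda>p. snd p" "?M \<Otimes>\<^sub>M ?P" "\<lambda>_. ?M" fst]
    by (auto simp: case_prod_beta)
  have "(\<integral>\<^sup>+ \<omega>. F \<omega> \<partial>disorder_space \<rho>)
      = (\<integral>\<^sup>+ \<omega>. F \<omega> \<partial>distr (?M \<Otimes>\<^sub>M ?P) (disorder_space \<rho>) (\<lambda>(r, \<omega>). fun_upd \<omega> k r))"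
    by (simp only: dist)
  also have "\<dots> = (\<integral>\<^sup>+ p. F (case p of (r, \<omega>) \<Rightarrow> fun_upd \<omega> k r) \<partial>(?M \<Otimes>\<^sub>M ?P))"
    using F by (intro nn_integral_distr[OF T]) simp
  also have "\<dots> = (\<integral>\<^sup>+ \<omega>. (\<integral>\<^sup>+ r. F (case (r, \<omega>) of (r, \<omega>) \<Rightarrow> fun_upd \<omega> k r) \<partial>?M) \<partial>?P)"
    by (rule MP.nn_integral_snd[symmetric, OF measurable_compose[OF T F]])
  finally show ?thesis by simp
qed

text \<open>The index type is countable, so the exceptional null sets of the single sites can be
  united.\<close>

lemma AE_disorder_bounded:
  fixes J :: "'i::countable set" and \<rho> :: "real \<Rightarrow> real"
  assumes meas: "\<rho> \<in> borel_measurable borel" and mass: "(\<integral>\<^sup>+ t. ennreal (\<rho> t) \<partial>lborel) = 1"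
    and cpt: "\<And>t. \<bar>t\<bar> > R \<Longrightarrow> \<rho> t = 0"
  shows "AE \<omega> in PiM J (\<lambda>_. density lborel (\<lambda>t. ennreal (\<rho> t))). \<forall>j\<in>J. \<bar>\<omega> j\<bar> \<le> R"
proof -
  have "\<bar>r\<bar> \<le> R" if "0 < ennreal (\<rho> r)" for r
    using that cpt[of r] by (cases "\<bar>r\<bar> > R") auto
  then have "AE r in density lborel (\<lambda>t. ennreal (\<rho> t)). \<bar>r\<bar> \<le> R"
    using meas by (subst AE_density) auto
  then have "AE \<omega> in PiM J (\<lambda>_. density lborel (\<lambda>t. ennreal (\<rho> t))). \<bar>\<omega> j\<bar> \<le> R" if "j \<in> J" for j
    using that by (intro AE_PiM_component prob_space_density_lborel meas mass)
  then show ?thesis by (subst AE_ball_countable) auto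
qed

text \<open>Cramer's rule shows the Green function as a quotient of determinants whose entries are
  measurable in \<omega>.\<close>

lemma borel_measurable_green_finite:
  fixes \<Gamma> :: "(int^'d) set"
  assumes fin: "finite \<Gamma>" and z: "Im z \<noteq> 0"
  shows "(\<lambda>\<omega>. green u lam \<omega> \<Gamma> z x y) \<in> borel_measurable (disorder_space \<rho>)"
proof (cases "x \<in> \<Gamma>")
  case True
  have comp: "(\<lambda>\<omega>. \<omega> k) \<in> borel_measurable (disorder_space \<rho>)" for k :: "int^'d"
    using measurable_component_singleton[of k UNIV "\<lambda>_. density lborel (\<lambda>t. ennreal (\<rho> t))"]
    by (simp add: disorder_space_def)
  have "(\<lambda>\<omega>. pot u \<omega> v) \<in> borel_measurable (disorder_space \<rho>)" for v
    unfolding pot_def by (intro borel_measurable_sum borel_measurable_times comp borel_measurable_const)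
  note this [measurable]
  have "(\<lambda>\<omega>. green_diag u lam \<omega> z v) \<in> borel_measurable (disorder_space \<rho>)" for v
    unfolding green_diag_def by measurable
  then have "(\<lambda>\<omega>. hop_mat (green_diag u lam \<omega> z) v w) \<in> borel_measurable (disorder_space \<rho>)" for v w
    unfolding hop_mat_def by (cases "v = w") auto
  then show ?thesis
    unfolding green_eq_fdet[OF fin z True]
    by (intro borel_measurable_divide borel_measurable_fdet[OF fin]) auto
next
  case False
  then have "green u lam \<omega> \<Gamma> z x y = 0" for \<omega>
    using green_finite(1)[OF fin z, of u lam \<omega> y] by (simp add: l2_on_def)
  then show ?thesis by simp
qed

lemma borel_measurable_green:
  assumes z: "Im z \<noteq> 0"
  shows "(\<lambda>\<omega>. green u lam \<omega> \<Gamma> z x y) \<in> borel_measurable (disorder_space \<rho>)"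
  by (rule borel_measurable_LIMSEQ_metric[OF borel_measurable_green_finite[OF _ z]
        green_finite_volume_limit[OF z]]) simp

lemma green_cong:
  assumes "\<And>v. v \<in> \<Gamma> \<Longrightarrow> pot u \<omega> v = pot u \<omega>' v"
  shows "green u lam \<omega> \<Gamma> z x y = green u lam \<omega>' \<Gamma> z x y"
  using assms unfolding green_def H_restr_def by (simp cong: ball_cong)

text \<open>Cutting out the block of \<open>x\<close> leads to the smaller set with a new starting
  point next to the block and the same \<open>y\<close>. The last condition on \<epsilon> says that
  the loss exp (L + 1) per cut, times the number of edges leaving the block, is outweighed by
  \<epsilon>; so the prefactor exp L is reproduced at every step.\<close>

lemma green_finite_volume_decay:
  fixes u :: "int^'d \<Rightarrow> real" and \<Gamma> :: "(int^'d) set"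
  assumes meas: "\<rho> \<in> borel_measurable borel" and mass: "(\<integral>\<^sup>+ t. ennreal (\<rho> t) \<partial>lborel) = 1"
    and cpt: "\<And>t. \<bar>t\<bar> > R \<Longrightarrow> \<rho> t = 0"
    and u_fin: "finite (supp_u u)" and u_0: "u 0 \<noteq> 0" and t: "0 < t" "t \<le> 1"
    and L: "\<And>v. u v \<noteq> 0 \<Longrightarrow> real_of_int (norminf v) \<le> L"
    and \<epsilon>: "0 \<le> \<epsilon>" "\<epsilon> \<le> 1" "real (card (supp_u u)) * (2 * real CARD('d)) * \<epsilon> * exp (L + 1) \<le> 1"
    and z: "Im z \<noteq> 0"
    and block: "\<And>\<Gamma> \<omega> k w. finite \<Gamma> \<Longrightarrow> (\<forall>j. j \<noteq> k \<longrightarrow> \<bar>\<omega> j\<bar> \<le> R) \<Longrightarrow> k \<in> \<Gamma> \<Longrightarrow> w \<in> \<Gamma> \<Longrightarrow>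
       u (w - k) \<noteq> 0 \<Longrightarrow>
       (\<integral>\<^sup>+ r. ennreal (norm (green u lam (fun_upd \<omega> k r) \<Gamma> z k w) powr t)
          \<partial>density lborel (\<lambda>t. ennreal (\<rho> t))) \<le> ennreal \<epsilon>"
    and fin: "finite \<Gamma>" and xy: "x \<in> \<Gamma>" "y \<in> \<Gamma>"
  shows "(\<integral>\<^sup>+ \<omega>. ennreal (norm (green u lam \<omega> \<Gamma> z x y) powr t) \<partial>disorder_space \<rho>)
     \<le> ennreal (exp L * exp (- real_of_int (norminf (x - y))))"
  using fin xy
proof (induction \<Gamma> arbitrary: x rule: finite_psubset_induct)
  case (psubset \<Gamma>)
  note fin = \<open>finite \<Gamma>\<close> and x = \<open>x \<in> \<Gamma>\<close> and y = \<open>y \<in> \<Gamma>\<close>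
  let ?M = "density lborel (\<lambda>t. ennreal (\<rho> t))"
  let ?P = "PiM (UNIV - {x}) (\<lambda>_. ?M)"
  define W where "W = {v \<in> \<Gamma>. u (v - x) \<noteq> 0}"
  have xW: "x \<in> W" using x u_0 by (simp add: W_def)
  have W: "W \<subseteq> \<Gamma>" "finite W" using fin by (auto simp: W_def)
  have cardW: "card W \<le> card (supp_u u)"
    by (rule card_inj_on_le[where f = "\<lambda>v. v - x"]) (auto simp: W_def supp_u_def inj_on_def u_fin[unfolded supp_u_def])
  have G_meas [measurable]: "(\<lambda>\<omega>. green u lam \<omega> \<Gamma>' z v w) \<in> borel_measurable (disorder_space \<rho>)" for \<Gamma>' v w
    by (rule borel_measurable_green[OF z])
  have P1: "emeasure ?P (space ?P) = 1"
    by (intro prob_space.emeasure_space_1 prob_space_PiM prob_space_density_lborel meas mass)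
  have bounded: "AE \<omega> in ?P. \<forall>j. j \<noteq> x \<longrightarrow> \<bar>\<omega> j\<bar> \<le> R"
    using AE_disorder_bounded[OF meas mass cpt, of R "UNIV - {x}"] by (rule eventually_mono) auto
  have dist_W: "real_of_int (norminf (x - w)) \<le> L" if "w \<in> W" for w
  proof -
    have "norminf (x - w) = norminf (w - x)" by (simp add: norminf_def abs_minus_commute)
    then show ?thesis using L[of "w - x"] that by (simp add: W_def)
  qed
  show ?case
  proof (cases "y \<in> W")
    case True
    have "(\<integral>\<^sup>+ \<omega>. ennreal (norm (green u lam \<omega> \<Gamma> z x y) powr t) \<partial>disorder_space \<rho>)
      = (\<integral>\<^sup>+ \<omega>. (\<integral>\<^sup>+ r. ennreal (norm (green u lam (fun_upd \<omega> x r) \<Gamma> z x y) powr t) \<partial>?M) \<partial>?P)"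
      by (rule nn_integral_disorder_split[OF meas mass]) measurable
    also have "\<dots> \<le> (\<integral>\<^sup>+ \<omega>. ennreal \<epsilon> \<partial>?P)"
    proof (rule nn_integral_mono_AE, rule eventually_mono[OF bounded])
      fix \<omega> assume "\<forall>j. j \<noteq> x \<longrightarrow> \<bar>\<omega> j\<bar> \<le> R"
      then show "(\<integral>\<^sup>+ r. ennreal (norm (green u lam (fun_upd \<omega> x r) \<Gamma> z x y) powr t) \<partial>?M) \<le> ennreal \<epsilon>"
        using fin x y True by (intro block) (auto simp: W_def)
    qed
    also have "\<dots> = ennreal \<epsilon>" by (simp only: nn_integral_const P1 mult_1_right)
    also have "\<dots> \<le> ennreal (exp L * exp (- real_of_int (norminf (x - y))))"
    proof (rule ennreal_leI)
      \<comment> \<open>With \<open>y\<close> in the block the distance is at most \<open>L\<close>,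
        so the target is at least 1; this fixes the prefactor exp L.\<close>
      have "\<epsilon> \<le> exp (L + - real_of_int (norminf (x - y)))"
        using dist_W[OF True] by (intro order_trans[OF \<epsilon>(2)]) auto
      then show "\<epsilon> \<le> exp L * exp (- real_of_int (norminf (x - y)))" by (simp only: exp_add)
    qed
    finally show ?thesis .
  next
    case False
    then have yW: "y \<in> \<Gamma> - W" using y by simp
    define N where "N w = {w' \<in> \<Gamma> - W. norm1 (w - w') = 1}" for w
    define E where "E = exp L * exp (- real_of_int (norminf (x - y)))"
    have cut: "norm (green u lam \<omega> \<Gamma> z x y) powr t \<le> (\<Sum>w\<in>W. \<Sum>w'\<in>N w.
        norm (green u lam \<omega> \<Gamma> z x w) powr t * norm (green u lam \<omega> (\<Gamma> - W) z w' y) powr t)" for \<omega>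
    proof -
      have "norm (green u lam \<omega> \<Gamma> z x y) \<le> (\<Sum>w\<in>W. \<Sum>w'\<in>N w.
          norm (green u lam \<omega> \<Gamma> z x w) * norm (green u lam \<omega> (\<Gamma> - W) z w' y))"
        unfolding green_cut[OF fin z W(1) xW yW] N_def
        by (intro order_trans[OF norm_sum] sum_mono) (simp add: norm_mult)
      then have "norm (green u lam \<omega> \<Gamma> z x y) powr t \<le> (\<Sum>w\<in>W. \<Sum>w'\<in>N w.
          norm (green u lam \<omega> \<Gamma> z x w) * norm (green u lam \<omega> (\<Gamma> - W) z w' y)) powr t"
        using t by (intro powr_mono2) auto
      also have "\<dots> \<le> (\<Sum>w\<in>W. (\<Sum>w'\<in>N w.
          norm (green u lam \<omega> \<Gamma> z x w) * norm (green u lam \<omega> (\<Gamma> - W) z w' y)) powr t)"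
        using t by (intro powr_sum_le sum_nonneg) auto
      also have "\<dots> \<le> (\<Sum>w\<in>W. \<Sum>w'\<in>N w.
          (norm (green u lam \<omega> \<Gamma> z x w) * norm (green u lam \<omega> (\<Gamma> - W) z w' y)) powr t)"
        using t by (intro sum_mono powr_sum_le) auto
      finally show ?thesis by (simp add: powr_mult)
    qed
    have term_le: "(\<integral>\<^sup>+ \<omega>. ennreal (norm (green u lam \<omega> \<Gamma> z x w) powr t * norm (green u lam \<omega> (\<Gamma> - W) z w' y) powr t)
        \<partial>disorder_space \<rho>) \<le> ennreal (\<epsilon> * exp (L + 1) * E)" if w: "w \<in> W" and w': "w' \<in> N w" for w w'
    proof -
      let ?f = "\<lambda>\<omega>. ennreal (norm (green u lam \<omega> \<Gamma> z x w) powr t)"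
      let ?g = "\<lambda>\<omega>. ennreal (norm (green u lam \<omega> (\<Gamma> - W) z w' y) powr t)"
      \<comment> \<open>Every site of the smaller set satisfies u (v - x) = 0, so its potential does
        not contain the coupling at \<open>x\<close>.\<close>
      have indep: "?g (fun_upd \<omega> x r) = ?g (fun_upd \<omega> x 0)" for \<omega> r
      proof -
        have "green u lam (fun_upd \<omega> x r) (\<Gamma> - W) z w' y = green u lam (fun_upd \<omega> x 0) (\<Gamma> - W) z w' y"
          by (rule green_cong) (use pot_fun_upd[OF u_fin, of \<omega> x r] in \<open>auto simp: W_def\<close>)
        then show ?thesis by simp
      qed
      have M1: "emeasure ?M (space ?M) = 1"
        by (intro prob_space.emeasure_space_1 prob_space_density_lborel meas mass)
      have upd_meas: "(\<lambda>r. fun_upd \<omega> x r) \<in> ?M \<rightarrow>\<^sub>M disorder_space \<rho>" if "\<omega> \<in> space ?P" for \<omega>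
        unfolding disorder_space_def using that
        by (intro measurable_fun_upd[of UNIV "UNIV - {x}" x "\<lambda>_. \<omega>"]) auto
      have g_meas: "?g \<in> borel_measurable (disorder_space \<rho>)" by measurable
      have "(\<integral>\<^sup>+ \<omega>. ennreal (norm (green u lam \<omega> \<Gamma> z x w) powr t * norm (green u lam \<omega> (\<Gamma> - W) z w' y) powr t)
          \<partial>disorder_space \<rho>) = (\<integral>\<^sup>+ \<omega>. ?f \<omega> * ?g \<omega> \<partial>disorder_space \<rho>)"
        by (simp add: ennreal_mult')
      also have "\<dots> = (\<integral>\<^sup>+ \<omega>. (\<integral>\<^sup>+ r. ?f (fun_upd \<omega> x r) * ?g (fun_upd \<omega> x r) \<partial>?M) \<partial>?P)"
        by (rule nn_integral_disorder_split[OF meas mass]) measurable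
      also have "\<dots> \<le> (\<integral>\<^sup>+ \<omega>. ennreal \<epsilon> * (\<integral>\<^sup>+ r. ?g (fun_upd \<omega> x r) \<partial>?M) \<partial>?P)"
      proof (rule nn_integral_mono_AE, rule eventually_mono[OF eventually_conj[OF bounded AE_space]])
        fix \<omega> assume "(\<forall>j. j \<noteq> x \<longrightarrow> \<bar>\<omega> j\<bar> \<le> R) \<and> \<omega> \<in> space ?P"
        then have \<omega>: "\<forall>j. j \<noteq> x \<longrightarrow> \<bar>\<omega> j\<bar> \<le> R" "\<omega> \<in> space ?P" by auto
        have f_meas: "(\<lambda>r. ?f (fun_upd \<omega> x r)) \<in> borel_measurable ?M"
          by (rule measurable_compose[OF upd_meas[OF \<omega>(2)]]) measurable
        have "(\<integral>\<^sup>+ r. ?f (fun_upd \<omega> x r) * ?g (fun_upd \<omega> x r) \<partial>?M)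
            = (\<integral>\<^sup>+ r. ?f (fun_upd \<omega> x r) * ?g (fun_upd \<omega> x 0) \<partial>?M)"
          by (intro nn_integral_cong arg_cong2[where f = "(*)"] refl indep)
        also have "\<dots> = (\<integral>\<^sup>+ r. ?f (fun_upd \<omega> x r) \<partial>?M) * ?g (fun_upd \<omega> x 0)"
          by (rule nn_integral_multc[OF f_meas])
        also have "\<dots> \<le> ennreal \<epsilon> * ?g (fun_upd \<omega> x 0)"
          by (intro mult_right_mono block) (use fin \<omega>(1) x w in \<open>auto simp: W_def\<close>)
        \<comment> \<open>The constant is averaged over the coupling again, so that the full
          expectation can be reassembled for the induction hypothesis.\<close>
        also have "?g (fun_upd \<omega> x 0) = (\<integral>\<^sup>+ r. ?g (fun_upd \<omega> x 0) \<partial>?M)"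
          by (simp only: nn_integral_const M1 mult_1_right)
        also have "\<dots> = (\<integral>\<^sup>+ r. ?g (fun_upd \<omega> x r) \<partial>?M)"
          by (intro nn_integral_cong indep[symmetric])
        finally show "(\<integral>\<^sup>+ r. ?f (fun_upd \<omega> x r) * ?g (fun_upd \<omega> x r) \<partial>?M)
            \<le> ennreal \<epsilon> * (\<integral>\<^sup>+ r. ?g (fun_upd \<omega> x r) \<partial>?M)" .
      qed
      also have "\<dots> = (\<integral>\<^sup>+ \<omega>. (\<integral>\<^sup>+ r. ennreal \<epsilon> * ?g (fun_upd \<omega> x r) \<partial>?M) \<partial>?P)"
        by (intro nn_integral_cong nn_integral_cmult[symmetric] measurable_compose[OF upd_meas g_meas]) simp
      also have "\<dots> = (\<integral>\<^sup>+ \<omega>. ennreal \<epsilon> * ?g \<omega> \<partial>disorder_space \<rho>)"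
        by (rule nn_integral_disorder_split[OF meas mass, symmetric]) measurable
      also have "\<dots> = ennreal \<epsilon> * (\<integral>\<^sup>+ \<omega>. ?g \<omega> \<partial>disorder_space \<rho>)"
        by (rule nn_integral_cmult[OF g_meas])
      also have "\<dots> \<le> ennreal \<epsilon> * ennreal (exp L * exp (- real_of_int (norminf (w' - y))))"
        using xW W w' yW by (intro mult_left_mono psubset.IH) (auto simp: N_def)
      also have "\<dots> \<le> ennreal \<epsilon> * ennreal (exp (L + 1) * E)"
      proof (intro mult_left_mono ennreal_leI)
        have nb: "norm1 (w - w') = 1" using w' by (simp add: N_def)
        \<comment> \<open>From \<open>x\<close> to \<open>w\<close> at most \<open>L\<close>, from
          \<open>w\<close> to \<open>w'\<close> at most 1: the origin of exp (L + 1).\<close>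
        have "norminf (x - y) \<le> norminf (x - w) + (norminf (w - w') + norminf (w' - y))"
          using norminf_triangle[of "x - w" "w - y"] norminf_triangle[of "w - w'" "w' - y"] by simp
        then have "real_of_int (norminf (x - y)) \<le> L + 1 + real_of_int (norminf (w' - y))"
          using dist_W[OF w] norminf_le_norm1[of "w - w'"] nb by linarith
        then have "exp (- real_of_int (norminf (w' - y))) \<le> exp (L + 1 + - real_of_int (norminf (x - y)))"
          by simp
        then have "exp (- real_of_int (norminf (w' - y))) \<le> exp (L + 1) * exp (- real_of_int (norminf (x - y)))"
          by (simp only: exp_add)
        then have "exp L * exp (- real_of_int (norminf (w' - y)))
            \<le> exp L * (exp (L + 1) * exp (- real_of_int (norminf (x - y))))"
          by (intro mult_left_mono) auto
        then show "exp L * exp (- real_of_int (norminf (w' - y))) \<le> exp (L + 1) * E"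
          by (simp add: E_def mult_ac)
      qed simp
      also have "\<dots> = ennreal (\<epsilon> * exp (L + 1) * E)"
        using \<epsilon>(1) by (simp add: ennreal_mult' mult.assoc)
      finally show ?thesis .
    qed
    have "(\<integral>\<^sup>+ \<omega>. ennreal (norm (green u lam \<omega> \<Gamma> z x y) powr t) \<partial>disorder_space \<rho>)
      \<le> (\<integral>\<^sup>+ \<omega>. (\<Sum>w\<in>W. \<Sum>w'\<in>N w. ennreal
        (norm (green u lam \<omega> \<Gamma> z x w) powr t * norm (green u lam \<omega> (\<Gamma> - W) z w' y) powr t)) \<partial>disorder_space \<rho>)"
    proof (rule nn_integral_mono)
      fix \<omega>
      show "ennreal (norm (green u lam \<omega> \<Gamma> z x y) powr t) \<le> (\<Sum>w\<in>W. \<Sum>w'\<in>N w. ennreal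
        (norm (green u lam \<omega> \<Gamma> z x w) powr t * norm (green u lam \<omega> (\<Gamma> - W) z w' y) powr t))"
        using ennreal_leI[OF cut[of \<omega>]] by (simp add: sum_ennreal sum_nonneg)
    qed
    also have "\<dots> = (\<Sum>w\<in>W. \<Sum>w'\<in>N w. \<integral>\<^sup>+ \<omega>. ennreal
        (norm (green u lam \<omega> \<Gamma> z x w) powr t * norm (green u lam \<omega> (\<Gamma> - W) z w' y) powr t) \<partial>disorder_space \<rho>)"
      by (subst nn_integral_sum, measurable, intro sum.cong refl nn_integral_sum, measurable)
    also have "\<dots> \<le> (\<Sum>w\<in>W. \<Sum>w'\<in>N w. ennreal (\<epsilon> * exp (L + 1) * E))"
      by (intro sum_mono term_le)
    also have "\<dots> = ennreal (\<Sum>w\<in>W. \<Sum>w'\<in>N w. \<epsilon> * exp (L + 1) * E)"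
      using \<epsilon>(1) by (simp add: sum_ennreal sum_nonneg E_def del: sum_constant)
    also have "\<dots> \<le> ennreal E"
    proof (rule ennreal_leI)
      have c0: "0 \<le> \<epsilon> * exp (L + 1) * E" using \<epsilon>(1) by (simp add: E_def)
      have "(\<Sum>w\<in>W. \<Sum>w'\<in>N w. \<epsilon> * exp (L + 1) * E) \<le> (\<Sum>w\<in>W. 2 * real CARD('d) * (\<epsilon> * exp (L + 1) * E))"
      proof (intro sum_mono)
        fix w
        have "real (card (N w)) \<le> 2 * real CARD('d)" using card_nbrs_in_le[of "\<Gamma> - W" w] by (simp add: N_def)
        then show "(\<Sum>w'\<in>N w. \<epsilon> * exp (L + 1) * E) \<le> 2 * real CARD('d) * (\<epsilon> * exp (L + 1) * E)"
          using c0 mult_right_mono[of "real (card (N w))" "2 * real CARD('d)" "\<epsilon> * exp (L + 1) * E"] by simp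
      qed
      also have "\<dots> = real (card W) * (2 * real CARD('d) * (\<epsilon> * exp (L + 1) * E))" by simp
      also have "\<dots> \<le> real (card (supp_u u)) * (2 * real CARD('d) * (\<epsilon> * exp (L + 1) * E))"
        using cardW c0 by (intro mult_right_mono) auto
      also have "\<dots> = (real (card (supp_u u)) * (2 * real CARD('d)) * \<epsilon> * exp (L + 1)) * E" by simp
      also have "\<dots> \<le> 1 * E" using \<epsilon>(3) by (intro mult_right_mono) (auto simp: E_def)
      finally show "(\<Sum>w\<in>W. \<Sum>w'\<in>N w. \<epsilon> * exp (L + 1) * E) \<le> E" by simp
    qed
    finally show ?thesis by (simp add: E_def)
  qed
qed

text \<open>Fatou along the boxes. Only large boxes count, and these contain \<open>x\<close> and
  \<open>y\<close>.\<close>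

lemma green_decay_of_finite_volume:
  fixes \<Gamma> :: "(int^'d) set"
  assumes z: "Im z \<noteq> 0" and t: "0 < t" and xy: "x \<in> \<Gamma>" "y \<in> \<Gamma>"
    and fin: "\<And>\<Gamma>'. finite \<Gamma>' \<Longrightarrow> x \<in> \<Gamma>' \<Longrightarrow> y \<in> \<Gamma>' \<Longrightarrow>
      (\<integral>\<^sup>+ \<omega>. ennreal (norm (green u lam \<omega> \<Gamma>' z x y) powr t) \<partial>disorder_space \<rho>) \<le> B"
  shows "(\<integral>\<^sup>+ \<omega>. ennreal (norm (green u lam \<omega> \<Gamma> z x y) powr t) \<partial>disorder_space \<rho>) \<le> B"
proof -
  let ?g = "\<lambda>\<Gamma> \<omega>. ennreal (norm (green u lam \<omega> \<Gamma> z x y) powr t)"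
  have lim: "(\<lambda>N. ?g (\<Gamma> \<inter> lattice_box N) \<omega>) \<longlonglongrightarrow> ?g \<Gamma> \<omega>" for \<omega>
    \<comment> \<open>Positivity of \<open>t\<close> makes the power continuous even where the limit
      is 0.\<close>
    using t by (intro tendsto_ennrealI tendsto_powr' tendsto_norm green_finite_volume_limit[OF z]) auto
  have meas [measurable]: "(\<lambda>\<omega>. green u lam \<omega> \<Gamma>' z x y) \<in> borel_measurable (disorder_space \<rho>)" for \<Gamma>'
    by (rule borel_measurable_green[OF z])
  have "(\<integral>\<^sup>+ \<omega>. ?g \<Gamma> \<omega> \<partial>disorder_space \<rho>)
      = (\<integral>\<^sup>+ \<omega>. liminf (\<lambda>N. ?g (\<Gamma> \<inter> lattice_box N) \<omega>) \<partial>disorder_space \<rho>)"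
    using lim_imp_Liminf[OF _ lim] by simp
  also have "\<dots> \<le> liminf (\<lambda>N. \<integral>\<^sup>+ \<omega>. ?g (\<Gamma> \<inter> lattice_box N) \<omega> \<partial>disorder_space \<rho>)"
    by (rule nn_integral_liminf) measurable
  also have "\<dots> \<le> B"
  proof (rule Liminf_le)
    show "\<forall>\<^sub>F N in sequentially. (\<integral>\<^sup>+ \<omega>. ?g (\<Gamma> \<inter> lattice_box N) \<omega> \<partial>disorder_space \<rho>) \<le> B"
      using eventually_ge_at_top[of "nat (max (norminf x) (norminf y))"]
    proof eventually_elim
      case (elim N)
      then show ?case
        using xy by (intro fin finite_Int disjI2 finite_lattice_box) (auto simp: lattice_box_def)
    qed
  qed simp
  finally show ?thesis .
qed

text \<open>The measurability clause makes the nonnegative integral a genuine expectation. The order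
  of the quantifiers keeps the constants independent of \<Gamma>, \<open>z\<close>, \<open>x\<close>
  and \<open>y\<close>.\<close>

theorem theorem2p4:
  fixes \<rho> :: "real \<Rightarrow> real" and u :: "int^'d \<Rightarrow> real"
  assumes rho_meas: "\<rho> \<in> borel_measurable borel"
    and rho_nonneg: "\<And>t. \<rho> t \<ge> 0"
    and rho_prob: "(\<integral>\<^sup>+ t. ennreal (\<rho> t) \<partial>lborel) = 1"
    and rho_bdd: "\<exists>C. \<forall>t. \<rho> t \<le> C"
    and rho_cpt: "\<exists>R. \<forall>t. \<bar>t\<bar> > R \<longrightarrow> \<rho> t = 0"
    and u_fin: "finite (supp_u u)"
    and u_0: "u 0 \<noteq> 0"
    and A2: "\<And>k. k \<in> interior_boundary (supp_u u) \<Longrightarrow> u k > 0"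
    and s: "0 < s" "s < 1/3"
  shows "\<exists>lam0. \<forall>lam > lam0. \<exists>\<mu> A. 0 < \<mu> \<and> 0 < A \<and>
     (\<forall>\<Gamma> :: (int^'d) set. \<forall>z. Im z \<noteq> 0 \<longrightarrow> (\<forall>x\<in>\<Gamma>. \<forall>y\<in>\<Gamma>.
        (\<exists>f \<in> borel_measurable (disorder_space \<rho>). AE \<omega> in disorder_space \<rho>.
            f \<omega> = norm (green u lam \<omega> \<Gamma> z x y) powr (s / (2 * card (supp_u u)))) \<and>
        (\<integral>\<^sup>+ \<omega>. ennreal (norm (green u lam \<omega> \<Gamma> z x y) powr (s / (2 * card (supp_u u))))
            \<partial>disorder_space \<rho>)
          \<le> ennreal (A * exp (- \<mu> * real_of_int (norminf (x - y))))))"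
proof -
  define n where "n = card (supp_u u)"
  define t where "t = s / (2 * real n)"
  have n1: "n \<ge> 1" using u_fin u_0 by (auto simp: n_def supp_u_def Suc_le_eq card_gt_0_iff)
  have t0: "0 < t" using s n1 by (simp add: t_def)
  have nt: "real n * t \<le> 1 / 2" using s n1 by (simp add: t_def)
  have t1: "t \<le> 1"
  proof -
    have "1 * t \<le> real n * t" using n1 t0 by (intro mult_right_mono) auto
    then show ?thesis using nt by simp
  qed
  obtain C where C: "\<And>t. \<rho> t \<le> C" using rho_bdd by blast
  obtain R0 where R0: "\<And>t. \<bar>t\<bar> > R0 \<Longrightarrow> \<rho> t = 0" using rho_cpt by blast
  define R where "R = max R0 0"
  have R: "R \<ge> 0" "\<And>t. \<bar>t\<bar> > R \<Longrightarrow> \<rho> t = 0" using R0 by (auto simp: R_def)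
  obtain K where K: "K > 0" and block: "\<And>lam \<Gamma> z \<omega> k w. lam \<ge> 1 \<Longrightarrow> finite \<Gamma> \<Longrightarrow> Im z \<noteq> 0 \<Longrightarrow>
      (\<forall>j. j \<noteq> k \<longrightarrow> \<bar>\<omega> j\<bar> \<le> R) \<Longrightarrow> k \<in> \<Gamma> \<Longrightarrow> w \<in> \<Gamma> \<Longrightarrow> u (w - k) \<noteq> 0 \<Longrightarrow>
    (\<integral>\<^sup>+ r. ennreal (norm (green u lam (fun_upd \<omega> k r) \<Gamma> z k w) powr t)
       \<partial>density lborel (\<lambda>t. ennreal (\<rho> t))) \<le> ennreal (K * lam powr (- t))"
    using block_fractional_moment[OF rho_meas rho_nonneg rho_prob C R(2) R(1) u_fin u_0 A2, of t] t0 nt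
    by (force simp: n_def)
  define L where "L = real_of_int (Max (norminf ` supp_u u))"
  have L: "real_of_int (norminf v) \<le> L" if "u v \<noteq> 0" for v
    unfolding L_def of_int_le_iff using u_fin that by (intro Max_ge) (auto simp: supp_u_def)
  have L0: "L \<ge> 0" using L[OF u_0] norminf_nonneg[of "0 :: int^'d"] by linarith
  \<comment> \<open>Bound on the number of edges leaving a block, times the loss for the distance
    bridged by one cut.\<close>
  define c where "c = real n * (2 * real CARD('d)) * exp (L + 1)"
  have c1: "c \<ge> 1"
  proof -
    have "1 * 1 * 1 \<le> real n * (2 * real CARD('d)) * exp (L + 1)"
      using n1 L0 by (intro mult_mono) (auto simp: Suc_le_eq intro: order_trans[of 1 "real CARD('d)"])
    then show ?thesis by (simp add: c_def)
  qed
  \<comment> \<open>Solves c K lam^(-t) = 1 for \<open>lam\<close>; the maximum with 1 meets the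
    range of the one-block estimate.\<close>
  define lam0 where "lam0 = max 1 ((K * c) powr (1 / t))"
  have small: "c * (K * lam powr (- t)) \<le> 1" if "lam > lam0" for lam
  proof -
    have lam: "lam > 0" "(K * c) powr (1 / t) \<le> lam" using that by (auto simp: lam0_def)
    have "K * c = ((K * c) powr (1 / t)) powr t" using K c1 t0 by (simp add: powr_powr)
    also have "\<dots> \<le> lam powr t" using lam t0 by (intro powr_mono2) auto
    finally show ?thesis using lam by (simp add: powr_minus_divide field_simps)
  qed
  \<comment> \<open>Rate 1 and prefactor exp L serve for every \<open>lam\<close> above
    \<open>lam0\<close>, because \<open>lam0\<close> has absorbed all other factors.\<close>
  show ?thesis
  proof (rule exI[of _ lam0], intro allI impI, rule exI[of _ 1], rule exI[of _ "exp L"],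
      intro conjI allI impI ballI)
    fix lam z x y and \<Gamma> :: "(int^'d) set"
    assume lam: "lam > lam0" and z: "Im z \<noteq> 0" and x: "x \<in> \<Gamma>" and y: "y \<in> \<Gamma>"
    have lam1: "lam \<ge> 1" using lam by (simp add: lam0_def)
    define \<epsilon> where "\<epsilon> = K * lam powr (- t)"
    have \<epsilon>0: "\<epsilon> \<ge> 0" using K by (simp add: \<epsilon>_def)
    have c\<epsilon>: "c * \<epsilon> \<le> 1" using small[OF lam] by (simp add: \<epsilon>_def)
    have \<epsilon>1: "\<epsilon> \<le> 1" using mult_right_mono[OF c1 \<epsilon>0] c\<epsilon> by linarith
    have [measurable]: "(\<lambda>\<omega>. green u lam \<omega> \<Gamma> z x y) \<in> borel_measurable (disorder_space \<rho>)"
      by (rule borel_measurable_green[OF z])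
    show "\<exists>f \<in> borel_measurable (disorder_space \<rho>). AE \<omega> in disorder_space \<rho>.
        f \<omega> = norm (green u lam \<omega> \<Gamma> z x y) powr (s / (2 * card (supp_u u)))"
      by (rule bexI[of _ "\<lambda>\<omega>. norm (green u lam \<omega> \<Gamma> z x y) powr (s / (2 * card (supp_u u)))"]) auto
    have "(\<integral>\<^sup>+ \<omega>. ennreal (norm (green u lam \<omega> \<Gamma> z x y) powr t) \<partial>disorder_space \<rho>)
        \<le> ennreal (exp L * exp (- real_of_int (norminf (x - y))))"
    proof (rule green_decay_of_finite_volume[OF z t0 x y])
      fix \<Gamma>' assume "finite \<Gamma>'" "x \<in> \<Gamma>'" "y \<in> \<Gamma>'"
      then show "(\<integral>\<^sup>+ \<omega>. ennreal (norm (green u lam \<omega> \<Gamma>' z x y) powr t) \<partial>disorder_space \<rho>)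
          \<le> ennreal (exp L * exp (- real_of_int (norminf (x - y))))"
        using block[OF lam1 _ z] c\<epsilon>
        by (intro green_finite_volume_decay[where \<epsilon> = \<epsilon> and R = R, OF rho_meas rho_prob R(2) u_fin u_0 t0 t1 L \<epsilon>0 \<epsilon>1 _ z])
          (auto simp: \<epsilon>_def c_def n_def mult_ac)
    qed
    then show "(\<integral>\<^sup>+ \<omega>. ennreal (norm (green u lam \<omega> \<Gamma> z x y) powr (s / (2 * card (supp_u u))))
        \<partial>disorder_space \<rho>) \<le> ennreal (exp L * exp (- 1 * real_of_int (norminf (x - y))))"
      by (simp add: t_def n_def)
  qed auto
qed

end
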